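(* For each $(t,x)\in\mathbb R_+\times\mathbb R$, $u^\varepsilon(t,x)$ converges in $L^2(P)$, as $\varepsilon\to0$, to the deterministic limit $$u(t,x)=\mathbb E[g(x+B_t)]\,\exp(t\Sigma),\qquad \Sigma=\int_0^\infty\mathbb E\,\Phi(r,B_r)\,dr,$$ which is a solution of the deterministic parabolic PDE $$\frac{\partial u}{\partial t}(t,x)=\frac12\frac{\partial^2u}{\partial x^2}(t,x)+\Sigma\,u(t,x),\quad t\ge0,\ x\in\mathbb R;\qquad u(0,x)=g(x),\ x\in\mathbb R.$$
   Context: Setting. $(\mathcal S,\mathcal A,P)$ and $(\Omega,\mathcal F,\mathbb P)$ are probability spaces with expectations $E$ and $\mathbb E$; everything lives on the product space, and $\mathbb E$ applied to a function on the product integrates only over $\Omega$. $B$ is a standard Brownian motion on $(\Omega,\mathcal F,\mathbb P)$. $c=\{c(t,x):t\in\mathbb R_+,x\in\mathbb R\}$ is a stationary (jointly measurable) real random field on $(\mathcal S,\mathcal A,P)$ with $E\,c(t,x)=0$, uniformly bounded in $(t,x,s)\in\mathbb R_+\times\mathbb R\times\mathcal S$. $\Phi(t,x):=E[c(s,y)c(s+t,y+x)]$, assumed in $L^1(\mathbb R\times\mathbb R)$. Mixing assumption. For $A\subset\mathbb R_+\times\mathbb R$ let $\mathcal F_A=\sigma\{c(t,x):(t,x)\in A\}$ and $$\alpha_{\rm um}(r)=\sup_{A_1,A_2:\ \mathrm{dist}(A_1,A_2)\ge r}\ \ \sup_{S_1\in\mathcal F_{A_1},\,S_2\in\mathcal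 F_{A_2},\,P(S_2)\ne0}|P(S_1|S_2)-P(S_1)|.$$ It is assumed that there exist $C,\delta>0$ such that $\alpha_{\rm um}(r)\le C(1+r)^{-(2+\delta)}$ for all $r\ge0$. The equation. $g\in L^2(\mathbb R)\cap C(\mathbb R)$ and $u^\varepsilon$ is the solution of $\partial_tu^\varepsilon=\frac12\partial_{xx}u^\varepsilon+\frac1\varepsilon c\left(\frac t{\varepsilon^2},\frac x\varepsilon\right)u^\varepsilon$, $u^\varepsilon(0,x)=g(x)$, given by the Feynman–Kac formula $$u^\varepsilon(t,x)=\mathbb E\left[g(x+B_t)\exp\left(\varepsilon^{-1}\int_0^tc\left(\frac s{\varepsilon^2},\frac{x+B_s}\varepsilon\right)ds\right)\right].$$ *)

theory Defs
  imports "HOL-Probability.Probability"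
begin

definition standard_brownian_motion :: "'w measure \<Rightarrow> (real \<Rightarrow> 'w \<Rightarrow> real) \<Rightarrow> bool" where
  "standard_brownian_motion M B \<longleftrightarrow>
     prob_space M \<and>
     (\<forall>t\<ge>0. B t \<in> borel_measurable M) \<and>
     (\<forall>\<omega>\<in>space M. B 0 \<omega> = 0 \<and> continuous_on {0..} (\<lambda>t. B t \<omega>)) \<and>
     (\<forall>s t. 0 \<le> s \<longrightarrow> s < t \<longrightarrow>
        distributed M lborel (\<lambda>\<omega>. B t \<omega> - B s \<omega>) (normal_density 0 (sqrt (t - s)))) \<and>
     (\<forall>n (\<tau> :: nat \<Rightarrow> real). 0 \<le> \<tau> 0 \<longrightarrow> mono_on {..n} \<tau> \<longrightarrow>
        prob_space.indep_vars M (\<lambda>_. borel) (\<lambda>i \<omega>. B (\<tau> (Suc i)) \<omega> - B (\<tau> i) \<omega>) {..<n})"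

text \<open>
  A random field \<open>c t x a\<close> indexed by time \<open>t\<close>, position \<open>x\<close> and sample point \<open>a\<close> is only
  meaningful for \<open>t \<ge> 0\<close>; its values at negative times are never used below.
\<close>

definition jointly_measurable_field :: "'s measure \<Rightarrow> (real \<Rightarrow> real \<Rightarrow> 's \<Rightarrow> real) \<Rightarrow> bool" where
  "jointly_measurable_field S c \<longleftrightarrow>
     (\<lambda>((t, x), a). c t x a)
       \<in> borel_measurable (restrict_space (borel :: (real \<times> real) measure) ({0..} \<times> UNIV) \<Otimes>\<^sub>M S)"

text \<open>Strict stationarity: the finite-dimensional laws are invariant under the space-time
  shifts that map \<open>{0..} \<times> UNIV\<close> into itself.\<close>

definition stationary_field :: "'s measure \<Rightarrow> (real \<Rightarrow> real \<Rightarrow> 's \<Rightarrow> real) \<Rightarrow> bool" where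
  "stationary_field S c \<longleftrightarrow>
     (\<forall>J :: (real \<times> real) set. finite J \<longrightarrow> J \<subseteq> {0..} \<times> UNIV \<longrightarrow>
       (\<forall>h\<ge>0. \<forall>y.
         distr S (Pi\<^sub>M J (\<lambda>_. borel)) (\<lambda>a. \<lambda>p\<in>J. c (fst p + h) (snd p + y) a) =
         distr S (Pi\<^sub>M J (\<lambda>_. borel)) (\<lambda>a. \<lambda>p\<in>J. c (fst p) (snd p) a)))"

text \<open>
  The covariance \<open>E[c(s, y) c(s + t, y + x)]\<close> as a function of \<open>(t, x)\<close>, for \<open>t\<close> of either sign.
  It is evaluated at the base point \<open>y = 0\<close> and the smallest \<open>s \<ge> 0\<close> with \<open>s + t \<ge> 0\<close>; for a
  stationary field the choice of base point is irrelevant, see \<open>field_cov_eq\<close> below.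
\<close>

definition field_cov :: "'s measure \<Rightarrow> (real \<Rightarrow> real \<Rightarrow> 's \<Rightarrow> real) \<Rightarrow> real \<Rightarrow> real \<Rightarrow> real" where
  "field_cov S c t x = (LINT a|S. c (max 0 (-t)) 0 a * c (max 0 (-t) + t) x a)"

lemma field_cov_eq:
  assumes meas: "jointly_measurable_field S c"
    and stat: "stationary_field S c"
    and s: "0 \<le> s" "0 \<le> s + t"
  shows "field_cov S c t x = (LINT a|S. c s y a * c (s + t) (y + x) a)"
proof -
  define s0 where "s0 = max 0 (-t)"
  define p where "p = (s0, 0 :: real)"
  define q where "q = (s0 + t, x)"
  define J where "J = {p, q}"
  define h where "h = s - s0"
  have s0: "0 \<le> s0" "0 \<le> s0 + t" "0 \<le> h"
    using s by (auto simp: s0_def h_def)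
  have m: "c r z \<in> borel_measurable S" if "0 \<le> r" for r z
  proof -
    have "(\<lambda>a. ((r, z), a)) \<in>
        S \<rightarrow>\<^sub>M (restrict_space (borel :: (real \<times> real) measure) ({0..} \<times> UNIV) \<Otimes>\<^sub>M S)"
      using that by (intro measurable_Pair measurable_const) (auto simp: space_restrict_space)
    from measurable_compose[OF this meas[unfolded jointly_measurable_field_def]]
    show ?thesis by simp
  qed
  have J: "finite J" "J \<subseteq> {0..} \<times> UNIV"
    using s0 by (auto simp: J_def p_def q_def)
  let ?f = "\<lambda>z :: real \<times> real \<Rightarrow> real. z p * z q"
  have f: "?f \<in> borel_measurable (Pi\<^sub>M J (\<lambda>_. borel))"
    by (intro borel_measurable_times measurable_component_singleton) (auto simp: J_def)
  have mJ: "(\<lambda>a. \<lambda>r\<in>J. c (fst r + h') (snd r + y') a) \<in> S \<rightarrow>\<^sub>M Pi\<^sub>M J (\<lambda>_. borel)" if "0 \<le> h'" for h' y'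
    by (intro measurable_restrict m) (use that J in auto)
  have d: "distr S (Pi\<^sub>M J (\<lambda>_. borel)) (\<lambda>a. \<lambda>p\<in>J. c (fst p + h) (snd p + y) a) =
        distr S (Pi\<^sub>M J (\<lambda>_. borel)) (\<lambda>a. \<lambda>p\<in>J. c (fst p) (snd p) a)"
    using stat J s0 by (simp add: stationary_field_def)
  have "field_cov S c t x =
      integral\<^sup>L (distr S (Pi\<^sub>M J (\<lambda>_. borel)) (\<lambda>a. \<lambda>p\<in>J. c (fst p) (snd p) a)) ?f"
    using integral_distr[OF mJ[of 0 0] f]
    by (simp add: field_cov_def J_def p_def q_def s0_def)
  also have "\<dots> = integral\<^sup>L (distr S (Pi\<^sub>M J (\<lambda>_. borel))
      (\<lambda>a. \<lambda>p\<in>J. c (fst p + h) (snd p + y) a)) ?f"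
    by (simp only: d)
  also have "\<dots> = (LINT a|S. c s y a * c (s + t) (y + x) a)"
    using integral_distr[OF mJ[OF s0(3)] f, of y]
    by (simp add: J_def p_def q_def h_def algebra_simps)
  finally show ?thesis .
qed

definition field_sigma :: "'s measure \<Rightarrow> (real \<Rightarrow> real \<Rightarrow> 's \<Rightarrow> real) \<Rightarrow> (real \<times> real) set \<Rightarrow> 's set set" where
  "field_sigma S c A = sigma_sets (space S)
     {c (fst p) (snd p) -` U \<inter> space S | p U. p \<in> A \<and> U \<in> sets borel}"

text \<open>
  The index sets are required to be nonempty because \<open>setdist\<close> to the empty set is \<open>0\<close> by
  convention; empty index sets generate the trivial \<open>\<sigma>\<close>-algebra and would contribute the value
  \<open>0\<close> only. The set of reals below is nonempty and bounded by \<open>1\<close>.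
\<close>

definition alpha_um :: "'s measure \<Rightarrow> (real \<Rightarrow> real \<Rightarrow> 's \<Rightarrow> real) \<Rightarrow> real \<Rightarrow> real" where
  "alpha_um S c r = Sup {\<bar>\<P>(a in S. a \<in> S1 \<bar> a \<in> S2) - measure S S1\<bar> | A1 A2 S1 S2.
     A1 \<subseteq> {0..} \<times> UNIV \<and> A2 \<subseteq> {0..} \<times> UNIV \<and> A1 \<noteq> {} \<and> A2 \<noteq> {} \<and> r \<le> setdist A1 A2 \<and>
     S1 \<in> field_sigma S c A1 \<and> S2 \<in> field_sigma S c A2 \<and> measure S S2 \<noteq> 0}"

text \<open>The Feynman--Kac formula; the result is a random variable on \<open>S\<close>, the last argument being
  the sample point.\<close>

definition u_eps ::
  "'w measure \<Rightarrow> (real \<Rightarrow> 'w \<Rightarrow> real) \<Rightarrow> (real \<Rightarrow> real \<Rightarrow> 's \<Rightarrow> real) \<Rightarrow> (real \<Rightarrow> real) \<Rightarrow>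
   real \<Rightarrow> real \<Rightarrow> real \<Rightarrow> 's \<Rightarrow> real" where
  "u_eps \<Omega> B c g \<epsilon> t x a =
     (LINT \<omega>|\<Omega>. g (x + B t \<omega>) *
        exp (1 / \<epsilon> * (LINT s:{0..t}|lborel. c (s / \<epsilon>\<^sup>2) ((x + B s \<omega>) / \<epsilon>) a)))"

definition Sigma_eff ::
  "'s measure \<Rightarrow> 'w measure \<Rightarrow> (real \<Rightarrow> 'w \<Rightarrow> real) \<Rightarrow> (real \<Rightarrow> real \<Rightarrow> 's \<Rightarrow> real) \<Rightarrow> real" where
  "Sigma_eff S \<Omega> B c = (LINT r:{0..}|lborel. (LINT \<omega>|\<Omega>. field_cov S c r (B r \<omega>)))"

definition u_lim ::
  "'w measure \<Rightarrow> (real \<Rightarrow> 'w \<Rightarrow> real) \<Rightarrow> (real \<Rightarrow> real) \<Rightarrow> real \<Rightarrow> real \<Rightarrow> real \<Rightarrow> real" where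
  "u_lim \<Omega> B g \<sigma> t x = (LINT \<omega>|\<Omega>. g (x + B t \<omega>)) * exp (t * \<sigma>)"

definition square_integrable :: "'a measure \<Rightarrow> ('a \<Rightarrow> real) \<Rightarrow> bool" where
  "square_integrable M f \<longleftrightarrow> f \<in> borel_measurable M \<and> integrable M (\<lambda>x. (f x)\<^sup>2)"

definition converges_in_L2 ::
  "'a measure \<Rightarrow> ('i \<Rightarrow> 'a \<Rightarrow> real) \<Rightarrow> ('a \<Rightarrow> real) \<Rightarrow> 'i filter \<Rightarrow> bool" where
  "converges_in_L2 M X Y F \<longleftrightarrow>
     (\<forall>\<^sub>F i in F. square_integrable M (X i)) \<and> square_integrable M Y \<and>
     ((\<lambda>i. LINT a|M. (X i a - Y a)\<^sup>2) \<longlongrightarrow> 0) F"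

text \<open>
  Classical solutions of \<open>\<partial>u/\<partial>t = 1/2 \<partial>\<^sup>2u/\<partial>x\<^sup>2 + \<sigma> u\<close>, \<open>u(0, \<cdot>) = g\<close>: of class \<open>C\<^sup>1\<^sup>,\<^sup>2\<close> for
  \<open>t > 0\<close>, where the equation holds pointwise, and continuous up to \<open>t = 0\<close>. For an initial
  condition that is merely continuous the derivatives need not exist at \<open>t = 0\<close>.
\<close>

definition solves_parabolic_Cauchy ::
  "real \<Rightarrow> (real \<Rightarrow> real) \<Rightarrow> (real \<Rightarrow> real \<Rightarrow> real) \<Rightarrow> bool" where
  "solves_parabolic_Cauchy \<sigma> g u \<longleftrightarrow>
     continuous_on ({0..} \<times> UNIV) (\<lambda>(t, x). u t x) \<and>
     (\<forall>x. u 0 x = g x) \<and>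
     (\<exists>ut ux uxx :: real \<Rightarrow> real \<Rightarrow> real.
        continuous_on ({0<..} \<times> UNIV) (\<lambda>(t, x). ut t x) \<and>
        continuous_on ({0<..} \<times> UNIV) (\<lambda>(t, x). ux t x) \<and>
        continuous_on ({0<..} \<times> UNIV) (\<lambda>(t, x). uxx t x) \<and>
        (\<forall>t>0. \<forall>x.
           ((\<lambda>\<tau>. u \<tau> x) has_real_derivative ut t x) (at t) \<and>
           ((\<lambda>\<xi>. u t \<xi>) has_real_derivative ux t x) (at x) \<and>
           ((\<lambda>\<xi>. ux t \<xi>) has_real_derivative uxx t x) (at x) \<and>
           ut t x = 1 / 2 * uxx t x + \<sigma> * u t x))"

end

theory Submission
  imports Defs "HOL-Real_Asymp.Real_Asymp"
begin

text \<open>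
  Fix Brownian paths and put \<open>Z s = exp (1/\<epsilon> \<integral>\<^sub>0\<^sup>s f)\<close>, where \<open>f\<close> is the field (or the sum of two
  copies of it) along the rescaled paths. Expanding \<open>(E Z)' = E[f Z] / \<epsilon>\<close> twice around the time
  \<open>s - \<epsilon>\<^sup>2 h\<close>, uniform mixing decouples \<open>f\<close> from the past, with errors that are multiples of \<open>E Z\<close>:
  hence \<open>ln (E Z)\<close> equals an integrated covariance along the paths up to \<open>o(1)\<close>, uniformly in the
  paths, if \<open>h = \<epsilon> powr -a\<close> with \<open>a < 1/2 < a (2 + \<delta>) / 2\<close>. No central limit theorem and no
  exponential moment bound is needed.

  By independence of increments the covariance along one path has variance \<open>O(\<epsilon>\<^sup>2 h)\<close> and
  converges to \<open>t \<Sigma>\<close>; the one along two independent paths has \<open>L\<^sup>1\<close> norm \<open>O(\<epsilon>)\<close> because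
  the covariance is integrable and the Gaussian density is at most \<open>s powr -1/2\<close>. Writing
  \<open>E (u\<^sup>\<epsilon> - u)\<^sup>2\<close> as an integral over two independent Brownian paths, the Cauchy--Schwarz inequality
  concludes.
\<close>

subsection \<open>Integrals of bounded measurable functions\<close>

text \<open>The obstacle is the size of \<open>Z\<close>: only exp (K t / \<epsilon>) bounds it, so
  a covariance inequality whose error carries the suprema of both factors would be worthless.
  Uniform mixing conditions on the second event, so for a nonnegative weight the decoupling error is
  proportional to the mean of that weight; after division by \<open>E Z\<close> it becomes an error
  in \<open>ln (E Z)\<close>. Freezing is multiplicative in the same way: over a time span 2
  \<epsilon>^2 h the weight changes at most by the factor exp (2 K \<epsilon> h), which tends to 1.

  The same mixing estimate makes the covariance integrable in time uniformly in space. The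
  integrated covariances are therefore bounded by a constant times t along every path. The
  exponential is Lipschitz on that range, so second moments on the diagonal and a first moment off
  the diagonal suffice.\<close>

lemma integral_Icc_split:
  fixes f :: "real \<Rightarrow> real"
  assumes "set_integrable lborel {a..b} f" "a \<le> c" "c \<le> b"
  shows "(LINT r:{a..b}|lborel. f r) = (LINT r:{a..c}|lborel. f r) + (LINT r:{c..b}|lborel. f r)"
proof -
  have *: "set_integrable lborel {a..c} f" "set_integrable lborel {c..b} f" "set_integrable lborel {c<..b} f"
    by (rule set_integrable_subset[OF assms(1)]; use assms in auto)+
  have "(LINT r:{a..b}|lborel. f r) = (LINT r:{a..c} \<union> {c<..b}|lborel. f r)"
    using assms by (intro arg_cong[where f="\<lambda>A. set_lebesgue_integral lborel A f"]) auto
  also have "\<dots> = (LINT r:{a..c}|lborel. f r) + (LINT r:{c<..b}|lborel. f r)"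
    by (rule set_integral_Un) (use * in auto)
  also have "(LINT r:{c<..b}|lborel. f r) = (LINT r:{c..b}|lborel. f r)"
    unfolding set_lebesgue_integral_def
  proof (rule integral_cong_AE)
    have m: "f \<in> borel_measurable (restrict_space lborel {c..b})" if "set_integrable lborel {c..b} f" for c b
      using that by (simp add: set_integrable_def borel_measurable_restrict_space_iff borel_measurable_integrable)
    show "(\<lambda>x. indicat_real {c<..b} x *\<^sub>R f x) \<in> borel_measurable lborel"
      using *(3) by (auto simp: set_integrable_def)
    show "(\<lambda>x. indicat_real {c..b} x *\<^sub>R f x) \<in> borel_measurable lborel"
      using *(2) by (auto simp: set_integrable_def)
    have "AE x in lborel. x \<noteq> c" by (rule AE_lborel_singleton)
    then show "AE x in lborel. indicat_real {c<..b} x *\<^sub>R f x = indicat_real {c..b} x *\<^sub>R f x"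
      by eventually_elim (auto simp: indicator_def)
  qed
  finally show ?thesis .
qed

lemma set_integrable_bounded_Icc:
  fixes f :: "real \<Rightarrow> real"
  assumes [measurable]: "f \<in> borel_measurable borel" and "\<And>r. r \<in> {a..b} \<Longrightarrow> \<bar>f r\<bar> \<le> K"
  shows "set_integrable lborel {a..b} f"
  unfolding set_integrable_def
proof (rule Bochner_Integration.integrable_bound)
  show "integrable lborel (\<lambda>r. indicat_real {a..b} r *\<^sub>R K)"
    by (intro integrable_scaleR_left integrable_real_indicator) (cases "a \<le> b"; simp)+
  show "AE r in lborel. norm (indicat_real {a..b} r *\<^sub>R f r) \<le> norm (indicat_real {a..b} r *\<^sub>R K)"
    using assms(2) by (auto simp: indicator_def intro!: AE_I2) (smt (verit) atLeastAtMost_iff)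
qed simp

lemma set_integral_Icc_bound:
  fixes f :: "real \<Rightarrow> real"
  assumes "f \<in> borel_measurable borel" "\<And>r. r \<in> {a..b} \<Longrightarrow> \<bar>f r\<bar> \<le> K" "a \<le> b"
  shows "\<bar>LINT r:{a..b}|lborel. f r\<bar> \<le> K * (b - a)"
proof -
  have "\<bar>LINT r:{a..b}|lborel. f r\<bar> \<le> (LINT r:{a..b}|lborel. \<bar>f r\<bar>)"
    using set_integral_norm_bound[OF set_integrable_bounded_Icc[OF assms(1,2)]] by simp
  also have "\<dots> \<le> (LINT r:{a..b}|lborel. K)"
  proof (rule set_integral_mono)
    show "set_integrable lborel {a..b} (\<lambda>r. \<bar>f r\<bar>)"
      by (rule set_integrable_bounded_Icc[where K=K]) (use assms in auto)
    show "set_integrable lborel {a..b} (\<lambda>r. K)"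
      by (rule set_integrable_bounded_Icc[where K="\<bar>K\<bar>"]) auto
  qed (use assms in auto)
  also have "\<dots> = K * (b - a)"
    using assms(3) by (simp add: set_lebesgue_integral_def)
  finally show ?thesis .
qed

text \<open>The integrand is only measurable, so the indefinite integral need not be differentiable;
  but the difference of the two sides is, with derivative zero everywhere.\<close>

lemma integral_chain_rule:
  fixes f \<phi> \<phi>' :: "real \<Rightarrow> real" and G0 :: real
  defines "G \<equiv> \<lambda>s. G0 + (LINT r:{0..s}|lborel. f r)"
  assumes f[measurable]: "f \<in> borel_measurable borel" and K: "\<And>r. r \<in> {0..t} \<Longrightarrow> \<bar>f r\<bar> \<le> K"
    and t: "0 \<le> t"
    and \<phi>: "\<And>s. s \<in> {0..t} \<Longrightarrow> (\<phi> has_real_derivative \<phi>' (G s)) (at (G s))"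
    and cont: "continuous_on {0..t} (\<lambda>s. \<phi>' (G s))"
    and meas[measurable]: "(\<lambda>s. \<phi>' (G s)) \<in> borel_measurable borel"
  shows "\<phi> (G t) = \<phi> G0 + (LINT s:{0..t}|lborel. \<phi>' (G s) * f s)"
proof -
  obtain L where L: "\<And>s. s \<in> {0..t} \<Longrightarrow> \<bar>\<phi>' (G s)\<bar> \<le> L"
  proof -
    have "bounded ((\<lambda>s. \<phi>' (G s)) ` {0..t})"
      by (rule compact_imp_bounded[OF compact_continuous_image[OF cont compact_Icc]])
    then obtain L where "\<forall>x\<in>{0..t}. \<bar>\<phi>' (G x)\<bar> \<le> L" by (auto simp: bounded_iff)
    then show ?thesis by (intro that[of L]) auto
  qed
  have K0: "0 \<le> K" using K[of 0] t by force
  have L0: "0 \<le> L" using L[of 0] t by force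
  define g where "g s = \<phi>' (G s) * f s" for s
  have g[measurable]: "g \<in> borel_measurable borel" unfolding g_def by measurable
  have gb: "\<bar>g s\<bar> \<le> L * K" if "s \<in> {0..t}" for s
    unfolding g_def abs_mult using L[OF that] K[OF that] L0 by (intro mult_mono) auto
  define D where "D s = \<phi> (G s) - (LINT r:{0..s}|lborel. g r)" for s
  have Gd: "G b - G a = (LINT r:{a..b}|lborel. f r)" if "0 \<le> a" "a \<le> b" "b \<le> t" for a b
    using integral_Icc_split[of 0 b f a] set_integrable_bounded_Icc[OF f, of 0 b K] K that by (auto simp: G_def)
  have gd: "(LINT r:{0..b}|lborel. g r) - (LINT r:{0..a}|lborel. g r) = (LINT r:{a..b}|lborel. g r)" 
    if "0 \<le> a" "a \<le> b" "b \<le> t" for a b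
    using integral_Icc_split[of 0 b g a] set_integrable_bounded_Icc[OF g, of 0 b "L*K"] gb that by (auto simp: G_def)
  have Glip: "\<bar>G b - G a\<bar> \<le> K * (b - a)" if "0 \<le> a" "a \<le> b" "b \<le> t" for a b
    unfolding Gd[OF that] by (rule set_integral_Icc_bound) (use K that in auto)
  have Glip': "\<bar>G b - G a\<bar> \<le> K * \<bar>b - a\<bar>" if "a \<in> {0..t}" "b \<in> {0..t}" for a b
    using Glip[of a b] Glip[of b a] that by (cases "a \<le> b") auto
  have D0: "(D has_vector_derivative 0) (at s within {0..t})" if s: "s \<in> {0..t}" for s
    unfolding has_vector_derivative_def has_derivative_within_alt
  proof (intro conjI allI impI)
    show "bounded_linear (\<lambda>x::real. x *\<^sub>R (0::real))" by simp
    fix e :: real assume e: "0 < e"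
    \<comment> \<open>The increment of \<open>D\<close> collects two errors of size
      \<open>e' * K * \<bar>y - s\<bar>\<close>: the linearisation of \<open>\<phi>\<close> at
      \<open>G s\<close> and the oscillation of \<open>\<phi>'\<close> along \<open>G\<close>. The
      summand 1 keeps the quotient meaningful when \<open>K = 0\<close>.\<close>
    define e' where "e' = e / (2 * (K + 1))"
    have e': "e' > 0" "2 * e' * K \<le> e" using e K0 by (auto simp: e'_def field_simps)
    have "(\<phi> has_derivative (\<lambda>h. \<phi>' (G s) * h)) (at (G s))"
      using \<phi>[OF s] by (simp add: has_field_derivative_def)
    then obtain d1 where d1: "d1 > 0"
      "\<And>y. \<bar>y - G s\<bar> < d1 \<Longrightarrow> \<bar>\<phi> y - \<phi> (G s) - \<phi>' (G s) * (y - G s)\<bar> \<le> e' * \<bar>y - G s\<bar>"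
      unfolding has_derivative_at_alt using e'(1) by (metis real_norm_def)
    from cont s e'(1) obtain d2 where d2: "d2 > 0"
      "\<And>r. r \<in> {0..t} \<Longrightarrow> \<bar>r - s\<bar> < d2 \<Longrightarrow> \<bar>\<phi>' (G r) - \<phi>' (G s)\<bar> < e'"
      unfolding continuous_on_iff dist_real_def by metis
    define d where "d = min d2 (d1 / (K + 1))"
    have d: "d > 0" using d1(1) d2(1) K0 by (auto simp: d_def)
    show "\<exists>d>0. \<forall>y\<in>{0..t}. norm (y - s) < d \<longrightarrow> norm (D y - D s - (y - s) *\<^sub>R 0) \<le> e * norm (y - s)"
    proof (intro exI[of _ d] conjI ballI impI d)
      fix y assume y: "y \<in> {0..t}" "norm (y - s) < d"
      have "\<bar>G y - G s\<bar> \<le> K * \<bar>y - s\<bar>" using Glip'[of s y] s y by auto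
      also have "\<dots> \<le> (K+1) * \<bar>y - s\<bar>" by (simp add: algebra_simps)
      also have "\<dots> < d1" using y(2) K0 by (auto simp: d_def field_simps)
      finally have 1: "\<bar>\<phi> (G y) - \<phi> (G s) - \<phi>' (G s) * (G y - G s)\<bar> \<le> e' * \<bar>G y - G s\<bar>"
        by (rule d1(2))
      also have "\<dots> \<le> e' * (K * \<bar>y - s\<bar>)" using Glip'[of s y] s y e'(1) by auto
      finally have 1: "\<bar>\<phi> (G y) - \<phi> (G s) - \<phi>' (G s) * (G y - G s)\<bar> \<le> e' * (K * \<bar>y - s\<bar>)" .
      have 2: "\<bar>(LINT r:{a..b}|lborel. g r) - \<phi>' (G s) * (LINT r:{a..b}|lborel. f r)\<bar> \<le> e' * K * (b - a)"
        if ab: "0 \<le> a" "a \<le> b" "b \<le> t" "\<And>r. r \<in> {a..b} \<Longrightarrow> \<bar>r - s\<bar> < d2" for a b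
      proof -
        have "(LINT r:{a..b}|lborel. g r) - \<phi>' (G s) * (LINT r:{a..b}|lborel. f r)
           = (LINT r:{a..b}|lborel. g r - \<phi>' (G s) * f r)"
          by (subst set_integral_diff(2))
             (use ab gb K in \<open>auto intro!: set_integrable_bounded_Icc[OF g, of _ _ "L*K"] set_integrable_mult_right
                set_integrable_bounded_Icc[OF f, of _ _ "K"]\<close>)
        also have "\<bar>\<dots>\<bar> \<le> e' * K * (b - a)"
        proof (rule set_integral_Icc_bound)
          fix r assume r: "r \<in> {a..b}"
          have "\<bar>\<phi>' (G r) - \<phi>' (G s)\<bar> * \<bar>f r\<bar> \<le> e' * K"
            using d2(2)[of r] ab(4)[of r] ab r K[of r] e'(1) by (intro mult_mono) auto
          then show "\<bar>g r - \<phi>' (G s) * f r\<bar> \<le> e' * K"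
            by (simp add: g_def abs_mult[symmetric] algebra_simps)
        qed (use ab in auto)
        finally show ?thesis .
      qed
      have "\<bar>D y - D s\<bar> \<le> 2 * e' * K * \<bar>y - s\<bar>"
      proof (cases "s \<le> y")
        case True
        then show ?thesis using 1 2[of s y] Gd[of s y] gd[of s y] s y
          by (auto simp: D_def d_def abs_le_iff algebra_simps)
      next
        case False
        then have "G s - G y = (LINT r:{y..s}|lborel. f r)" using Gd[of y s] s y by auto
        then have eq: "\<phi>' (G s) * (G y - G s) = - (\<phi>' (G s) * (LINT r:{y..s}|lborel. f r))" 
          by (metis minus_diff_eq mult_minus_right)
        have "\<bar>(LINT r:{y..s}|lborel. g r) - \<phi>' (G s) * (LINT r:{y..s}|lborel. f r)\<bar> \<le> e' * K * \<bar>y - s\<bar>"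
          using 2[of y s] False s y by (auto simp: d_def)
        then show ?thesis using 1 gd[of y s] s y False unfolding eq
          by (auto simp: D_def abs_le_iff algebra_simps)
      qed
      also have "\<dots> \<le> e * \<bar>y - s\<bar>" using e'(2) by (intro mult_right_mono) auto
      finally show "norm (D y - D s - (y - s) *\<^sub>R 0) \<le> e * norm (y - s)" by simp
    qed
  qed
  have "D t = D 0"
    using has_vector_derivative_zero_constant[OF convex_real_interval(5) D0] t
    by (metis atLeastAtMost_iff order_refl)
  moreover have "G 0 = G0"
    using set_integral_Icc_bound[OF f, of 0 0 K] K t by (simp add: G_def)
  moreover have "(LINT r:{0..0}|lborel. g r) = 0"
    using set_integral_Icc_bound[OF g, of 0 0 "L*K"] gb t by (simp add: G_def)
  ultimately show ?thesis by (simp add: D_def g_def)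
qed


text \<open>The majorant may depend on x because one application multiplies a bounded process by the
  error of a conditional expectation, which is integrable but bounded only almost
  everywhere.\<close>

lemma (in finite_measure)
  fixes h :: "real \<Rightarrow> 'a \<Rightarrow> real"
  assumes h[measurable]: "(\<lambda>(u, x). h u x) \<in> borel_measurable (borel \<Otimes>\<^sub>M M)"
    and G: "integrable M G" and le: "\<And>u x. u \<in> {a..b} \<Longrightarrow> x \<in> space M \<Longrightarrow> \<bar>h u x\<bar> \<le> G x"
  shows integrable_Icc_times: "integrable (lborel \<Otimes>\<^sub>M M) (\<lambda>(u, x). indicator {a..b} u * h u x)"
    and Fubini_Icc: "(LINT x|M. (LINT u:{a..b}|lborel. h u x)) = (LINT u:{a..b}|lborel. LINT x|M. h u x)"
    and integrable_Icc_inner: "integrable M (\<lambda>x. LINT u:{a..b}|lborel. h u x)"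
proof -
  interpret P: pair_sigma_finite lborel M ..
  have G'[measurable]: "G \<in> borel_measurable M" using G by auto
  have ih: "integrable M (h u)" if "u \<in> {a..b}" for u
    by (rule Bochner_Integration.integrable_bound[OF G]) (use le[OF that] in \<open>force intro!: AE_I2\<close>)+
  show I: "integrable (lborel \<Otimes>\<^sub>M M) (\<lambda>(u, x). indicator {a..b} u * h u x)"
  proof (rule P.Fubini_integrable)
    show "AE u in lborel. integrable M (\<lambda>x. case (u, x) of (u, x) \<Rightarrow> indicat_real {a..b} u * h u x)"
      by (rule AE_I2) (auto simp: indicator_def ih)
    show "integrable lborel (\<lambda>u. LINT x|M. norm (case (u, x) of (u, x) \<Rightarrow> indicat_real {a..b} u * h u x))"
    proof (rule Bochner_Integration.integrable_bound)
      show "integrable lborel (\<lambda>u. indicator {a..b} u *\<^sub>R (LINT x|M. G x))"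
        by (intro integrable_scaleR_left integrable_real_indicator) (cases "a \<le> b"; simp)+
      show "AE u in lborel. norm (LINT x|M. norm (case (u, x) of (u, x) \<Rightarrow> indicat_real {a..b} u * h u x))
         \<le> norm (indicator {a..b} u *\<^sub>R (LINT x|M. G x))"
      proof (rule AE_I2)
        fix u
        consider "u \<notin> {a..b}" | "u \<in> {a..b}" by blast
        then show "norm (LINT x|M. norm (case (u, x) of (u, x) \<Rightarrow> indicat_real {a..b} u * h u x))
         \<le> norm (indicator {a..b} u *\<^sub>R (LINT x|M. G x))"
        proof cases
        case u: 2
        have "(LINT x|M. \<bar>h u x\<bar>) \<le> (LINT x|M. G x)"
          by (rule integral_mono) (use ih[OF u] G le[OF u] in auto)
        then show ?thesis
          using Bochner_Integration.integral_nonneg[of M "\<lambda>x. \<bar>h u x\<bar>"] u by simp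
        qed (auto simp: indicator_def)
      qed
    qed measurable
  qed simp
  have "(LINT x|M. (LINT u:{a..b}|lborel. h u x)) = (LINT x|M. LINT u|lborel. indicator {a..b} u * h u x)"
    by (simp add: set_lebesgue_integral_def)
  also have "\<dots> = (LINT u|lborel. LINT x|M. indicator {a..b} u * h u x)"
    using P.Fubini_integral[of "\<lambda>u x. indicator {a..b} u * h u x"] I by simp
  also have "\<dots> = (LINT u:{a..b}|lborel. LINT x|M. h u x)"
    by (simp add: set_lebesgue_integral_def)
  finally show "(LINT x|M. (LINT u:{a..b}|lborel. h u x)) = (LINT u:{a..b}|lborel. LINT x|M. h u x)" .
  show "integrable M (\<lambda>x. LINT u:{a..b}|lborel. h u x)"
    using P.integrable_snd[of "\<lambda>u x. indicator {a..b} u * h u x"] I by (simp add: set_lebesgue_integral_def)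
qed

lemma (in finite_measure) integrable_bounded:
  fixes f :: "'a \<Rightarrow> real"
  assumes "f \<in> borel_measurable M" "\<And>x. x \<in> space M \<Longrightarrow> \<bar>f x\<bar> \<le> C"
  shows "integrable M f"
  by (rule integrable_const_bound[where B=C]) (use assms in \<open>auto intro!: AE_I2\<close>)

text \<open>\<open>X x\<close> is the length of the set of levels below it, so testing
  \<open>V\<close> against \<open>X\<close> averages the tests of \<open>V\<close> on superlevel
  sets over levels in \<open>{0..L}\<close>. The statement is one-sided; changing the sign of
  \<open>V\<close> gives the other side. For \<open>k = 0\<close> the range \<open>L\<close>
  disappears, which is what allows exponentially large weights.\<close>

lemma (in finite_measure) layer_cake_lower_bound:
  fixes X V :: "'a \<Rightarrow> real"
  assumes X[measurable]: "X \<in> borel_measurable M" and V[measurable]: "V \<in> borel_measurable M"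
    and XL: "\<And>x. x \<in> space M \<Longrightarrow> 0 \<le> X x \<and> X x \<le> L" and C: "\<And>x. x \<in> space M \<Longrightarrow> \<bar>V x\<bar> \<le> C"
    and k: "\<And>u. - k \<le> (LINT x|M. indicator {y. u < X y} x * V x)" and L: "0 \<le> L"
  shows "- k * L \<le> (LINT x|M. X x * V x)"
proof -
  define h where "h u x = indicator {y. u < X y} x * V x" for u x
  have h: "(\<lambda>(u, x). h u x) \<in> borel_measurable (borel \<Otimes>\<^sub>M M)"
    unfolding h_def indicator_def mem_Collect_eq by measurable
  have hC: "\<bar>h u x\<bar> \<le> C" if "x \<in> space M" for u x
    using C[OF that] by (auto simp: h_def indicator_def)
  have *: "(LINT u:{0..L}|lborel. h u x) = X x * V x" if x: "x \<in> space M" for x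
  proof -
    \<comment> \<open>The level condition is \<open>u < X x\<close>, while \<open>{0..X x}\<close>
      contains its end point.\<close>
    have "AE u in lborel. u \<noteq> X x" by (rule AE_lborel_singleton)
    then have "(LINT u:{0..L}|lborel. h u x) = (LINT u|lborel. indicator {0..X x} u * V x)"
      unfolding set_lebesgue_integral_def h_def
    proof (intro integral_cong_AE)
      show "AE u in lborel. indicat_real {0..L} u *\<^sub>R (indicat_real {y. u < X y} x * V x) = indicat_real {0..X x} u * V x"
        using \<open>AE u in lborel. u \<noteq> X x\<close> by eventually_elim (use XL[OF x] in \<open>auto simp: indicator_def\<close>)
      have "(\<lambda>u. indicat_real {0..L} u *\<^sub>R ((if u < X x then 1 else 0) * V x)) \<in> borel_measurable lborel" by measurable
      then show "(\<lambda>u. indicat_real {0..L} u *\<^sub>R (indicat_real {y. u < X y} x * V x)) \<in> borel_measurable lborel"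
        by (simp add: indicator_def[of "{y. _ y}"])
    qed simp
    also have "\<dots> = X x * V x" using XL[OF x] by simp
    finally show ?thesis .
  qed
  have "- k * L = (LINT u:{0..L}|lborel. - k)" using L by (simp add: set_lebesgue_integral_def)
  also have "\<dots> \<le> (LINT u:{0..L}|lborel. LINT x|M. h u x)"
  proof (rule set_integral_mono)
    show "set_integrable lborel {0..L} (\<lambda>u. LINT x|M. h u x)"
    proof (rule set_integrable_bounded_Icc)
      show "(\<lambda>u. LINT x|M. h u x) \<in> borel_measurable borel" using h by (rule borel_measurable_lebesgue_integral)
      fix u
      have "\<bar>LINT x|M. h u x\<bar> \<le> (LINT x|M. \<bar>h u x\<bar>)" by (rule integral_abs_bound)
      also have "\<dots> \<le> (LINT x|M. C)"
        using h by (intro integral_mono integrable_bounded[where C=C]) (auto simp: hC intro: measurable_compose_Pair1 order_trans[OF abs_ge_zero hC])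
      finally show "\<bar>LINT x|M. h u x\<bar> \<le> measure M (space M) * C" by simp
    qed
    show "set_integrable lborel {0..L} (\<lambda>x. - k)" by (rule set_integrable_bounded_Icc[where K="\<bar>k\<bar>"]) auto
  qed (use k in \<open>auto simp: h_def\<close>)
  also have "\<dots> = (LINT x|M. (LINT u:{0..L}|lborel. h u x))"
    by (rule Fubini_Icc[symmetric, where G="\<lambda>_. C"]) (use h hC in auto)
  also have "\<dots> = (LINT x|M. X x * V x)" by (rule Bochner_Integration.integral_cong) (auto simp: *)
  finally show ?thesis .
qed

text \<open>Measurability with respect to the product of all of \<open>M\<close> does not make the integral
  \<open>F\<close>-measurable; it is only equal almost everywhere to its conditional expectation.\<close>

lemma (in finite_measure) integral_Icc_AE_subalgebra:
  fixes f :: "real \<Rightarrow> 'a \<Rightarrow> real"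
  assumes f[measurable]: "(\<lambda>(u, x). f u x) \<in> borel_measurable (borel \<Otimes>\<^sub>M M)"
    and K: "\<And>u x. u \<in> {a..b} \<Longrightarrow> x \<in> space M \<Longrightarrow> \<bar>f u x\<bar> \<le> K"
    and F: "subalgebra M F" and fF: "\<And>u. u \<in> {a..b} \<Longrightarrow> f u \<in> borel_measurable F"
    and ab: "a \<le> b"
  obtains J where "J \<in> borel_measurable F" "AE x in M. (LINT u:{a..b}|lborel. f u x) = J x"
proof -
  interpret finite_measure_subalgebra M F by standard (rule F)
  interpret sigma_finite_subalgebra M F
    by (rule finite_measure_subalgebra_is_sigma_finite) unfold_locales
  define I where "I x = (LINT u:{a..b}|lborel. f u x)" for x
  define J where "J = real_cond_exp M F I"
  define C where "C = K * (b - a)"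
  have Im[measurable]: "I \<in> borel_measurable M"
    unfolding I_def set_lebesgue_integral_def by measurable
  have fx: "(\<lambda>u. f u x) \<in> borel_measurable borel" if "x \<in> space M" for x using that by measurable
  have IC: "\<bar>I x\<bar> \<le> C" if "x \<in> space M" for x
    unfolding I_def C_def by (rule set_integral_Icc_bound) (use K that ab fx in auto)
  have I: "integrable M I" using IC by (intro integrable_bounded[where C=C]) auto
  have J: "integrable M J" unfolding J_def by (rule real_cond_exp_int(1)[OF I])
  have Jm[measurable]: "J \<in> borel_measurable M" unfolding J_def by measurable
  have "AE x in M. J x \<le> C" unfolding J_def
    by (rule real_cond_exp_le_c[OF I]) (rule AE_I2, use IC in \<open>auto simp: abs_le_iff\<close>)
  moreover have "AE x in M. J x \<ge> - C" unfolding J_def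
    by (rule real_cond_exp_ge_c[OF I]) (rule AE_I2, use IC in \<open>force simp: abs_le_iff\<close>)
  ultimately have JC: "AE x in M. \<bar>J x\<bar> \<le> C" by eventually_elim auto
  have II: "integrable M (\<lambda>x. I x * I x)"
    by (rule integrable_bounded[where C="C*C"]) (auto simp only: abs_mult intro!: mult_mono IC order_trans[OF abs_ge_zero IC], simp_all)
  have JI: "integrable M (\<lambda>x. J x * I x)"
    by (rule Bochner_Integration.integrable_bound[OF integrable_mult_right[OF J, of C]])
       (measurable, rule AE_I2, auto simp: abs_mult mult.commute intro!: mult_right_mono order_trans[OF IC abs_ge_self])
  have JJ: "integrable M (\<lambda>x. J x * J x)"
    by (rule Bochner_Integration.integrable_bound[OF integrable_mult_right[OF J, of C]])
       (measurable, use JC in eventually_elim, simp only: real_norm_def abs_mult, intro mult_right_mono, auto)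
  have 1: "(LINT x|M. J x * J x) = (LINT x|M. J x * I x)"
    using real_cond_exp_intg(2)[OF JI] by (simp add: J_def)
  \<comment> \<open>Each \<open>f u\<close> is measurable for the subalgebra, hence orthogonal to
    the error \<open>I - J\<close> of the conditional expectation.\<close>
  have fu0: "(LINT x|M. f u x * (I x - J x)) = 0" if u: "u \<in> {a..b}" for u
  proof -
    have fm[measurable]: "f u \<in> borel_measurable M" by measurable
    have fI: "integrable M (\<lambda>x. f u x * I x)"
      by (rule Bochner_Integration.integrable_bound[OF integrable_mult_right[OF I, of K]])
        (measurable, rule AE_I2, auto simp: abs_mult intro!: mult_right_mono order_trans[OF K[OF u] abs_ge_self])
    have fJ: "integrable M (\<lambda>x. f u x * J x)"
      unfolding J_def by (rule real_cond_exp_intg(1)[OF fI fF[OF u]]) simp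
    show ?thesis
      using real_cond_exp_intg(2)[OF fI fF[OF u]] fI fJ by (simp add: J_def right_diff_distrib)
  qed
  \<comment> \<open>Fubini writes \<open>I\<close> itself as an integral of the \<open>f u\<close>,
    so \<open>I\<close> is orthogonal to \<open>I - J\<close> as well. Since \<open>J\<close> is
    too, the norm of \<open>I - J\<close> vanishes.\<close>
  have "(LINT x|M. I x * (I x - J x)) = (LINT x|M. (LINT u:{a..b}|lborel. f u x * (I x - J x)))"
    by (simp add: I_def)
  also have "\<dots> = (LINT u:{a..b}|lborel. LINT x|M. f u x * (I x - J x))"
  proof (rule Fubini_Icc)
    show "integrable M (\<lambda>x. K * \<bar>I x - J x\<bar>)" using I J by auto
  qed (use K in \<open>auto simp: abs_mult intro!: mult_right_mono\<close>)
  also have "\<dots> = 0" unfolding set_lebesgue_integral_def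
    by (rule Bochner_Integration.integral_eq_zero_AE) (auto simp: indicator_def fu0)
  finally have 2: "(LINT x|M. I x * (I x - J x)) = 0" .
  have "(LINT x|M. (I x - J x)\<^sup>2) = (LINT x|M. I x * (I x - J x)) - ((LINT x|M. J x * I x) - (LINT x|M. J x * J x))"
    using II JI JJ
    by (subst Bochner_Integration.integral_diff[symmetric]; (subst Bochner_Integration.integral_diff[symmetric])?)
       (auto simp: power2_eq_square algebra_simps)
  then have "(LINT x|M. (I x - J x)\<^sup>2) = 0" using 1 2 by simp
  moreover have "integrable M (\<lambda>x. (I x - J x)\<^sup>2)"
  proof -
    have "(\<lambda>x. (I x - J x)\<^sup>2) = (\<lambda>x. I x * I x - 2 * (J x * I x) + J x * J x)"
      by (auto simp: power2_eq_square algebra_simps)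
    then show ?thesis using II JI JJ by simp
  qed
  ultimately have "AE x in M. (I x - J x)\<^sup>2 = 0"
    by (subst integral_nonneg_eq_0_iff_AE[symmetric]) auto
  then have "AE x in M. I x = J x" by eventually_elim auto
  moreover have "J \<in> borel_measurable F" unfolding J_def by simp
  ultimately show ?thesis using that by (auto simp: I_def)
qed

subsection \<open>Exponential moments of decorrelating processes\<close>

lemma abs_le_of_exp:
  fixes d D :: real
  assumes "\<bar>d\<bar> \<le> D"
  shows "exp d \<le> exp D" "\<bar>exp d - 1\<bar> \<le> exp D - 1"
proof -
  show 1: "exp d \<le> exp D" using assms by simp
  have "exp (-D) \<le> exp d" using assms by simp
  \<comment> \<open>For negative \<open>d\<close> the claim reduces to
    \<open>1 - exp (-D) \<le> exp D - 1\<close>, that is, cosh D is at least 1.\<close>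
  moreover have "2 \<le> exp D + exp (-D)"
  proof -
    have "0 \<le> (exp (D/2) - exp (-D/2))\<^sup>2" by simp
    also have "\<dots> = exp D + exp (-D) - 2"
      by (simp add: power2_eq_square algebra_simps exp_add[symmetric])
    finally show ?thesis by simp
  qed
  ultimately show "\<bar>exp d - 1\<bar> \<le> exp D - 1" using 1 by linarith
qed

text \<open>\<open>ln (E Z)\<close> is the integral of \<open>\<theta> * b s / m s\<close>, with
  \<open>m\<close> the mean of \<open>Z\<close> and \<open>b s\<close> that of
  \<open>f s * Z s\<close>. Stepping back by \<open>\<eta>\<close> leaves a first order term
  controlled by \<open>H1\<close>; the second order term is factored by \<open>H2\<close> after a
  further step back. All errors are multiples of \<open>m s\<close>, so they survive the division
  and no upper bound on \<open>Z\<close> enters the estimate.\<close>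

lemma (in prob_space) log_exponential_moment_expansion:
  fixes f :: "real \<Rightarrow> 'a \<Rightarrow> real" and \<theta> \<eta> t p1 p2 K :: real
  defines "Z \<equiv> \<lambda>s a. exp (\<theta> * (LINT u:{0..s}|lborel. f u a))"
  defines "G \<equiv> exp (2 * \<theta> * K * \<eta>)"
  assumes f[measurable]: "(\<lambda>(u, a). f u a) \<in> borel_measurable (borel \<Otimes>\<^sub>M M)"
    and K: "\<And>u a. a \<in> space M \<Longrightarrow> \<bar>f u a\<bar> \<le> K"
    and pos: "0 \<le> \<theta>" "0 \<le> \<eta>" "0 \<le> t" "0 \<le> p1" "0 \<le> p2"
    and H1: "\<And>s. 0 \<le> s \<Longrightarrow> s \<le> t \<Longrightarrow>
      \<bar>LINT a|M. f s a * Z (max 0 (s - \<eta>)) a\<bar> \<le> p1 * (LINT a|M. Z (max 0 (s - \<eta>)) a)"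
    and H2: "\<And>r s. 0 \<le> r \<Longrightarrow> r \<le> s \<Longrightarrow> s \<le> t \<Longrightarrow>
      \<bar>(LINT a|M. f s a * f r a * Z (max 0 (r - \<eta>)) a)
        - (LINT a|M. f s a * f r a) * (LINT a|M. Z (max 0 (r - \<eta>)) a)\<bar>
       \<le> p2 * (LINT a|M. Z (max 0 (r - \<eta>)) a)"
  shows "\<bar>ln (LINT a|M. Z t a) - \<theta>\<^sup>2 * (LINT s:{0..t}|lborel. (LINT r:{max 0 (s - \<eta>)..s}|lborel. (LINT a|M. f s a * f r a)))\<bar>
    \<le> (\<theta> * p1 * G + \<theta>\<^sup>2 * \<eta> * (p2 * G + 3 * K\<^sup>2 * (G - 1))) * t"
proof -
  have K0: "0 \<le> K" using K not_empty by force
  define F where "F s a = (LINT u:{0..s}|lborel. f u a)" for s a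
  have Z_def': "Z s a = exp (\<theta> * F s a)" for s a by (simp add: Z_def F_def)
  have F_alt: "F s a = (LINT u|lborel. (if 0 \<le> u \<and> u \<le> s then 1 else 0) * f u a)" for s a
    unfolding F_def set_lebesgue_integral_def by (intro Bochner_Integration.integral_cong refl) (auto simp: indicator_def)
  have Fm[measurable]: "(\<lambda>(s, a). F s a) \<in> borel_measurable (borel \<Otimes>\<^sub>M M)"
    unfolding F_alt by measurable
  have Zm[measurable]: "(\<lambda>(s, a). Z s a) \<in> borel_measurable (borel \<Otimes>\<^sub>M M)"
    unfolding Z_def' by measurable
  have fa: "(\<lambda>u. f u a) \<in> borel_measurable borel" if "a \<in> space M" for a using that by measurable
  have Fa: "(\<lambda>u. F u a) \<in> borel_measurable borel" if "a \<in> space M" for a using that by measurable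
  have Za: "(\<lambda>u. Z u a) \<in> borel_measurable borel" if "a \<in> space M" for a using that by measurable
  have Zs[measurable]: "Z s \<in> borel_measurable M" for s by measurable
  have fs[measurable]: "f s \<in> borel_measurable M" for s by measurable
  have Fdiff: "F s a - F r a = (LINT u:{r..s}|lborel. f u a)" if "a \<in> space M" "0 \<le> r" "r \<le> s" for r s a
    using integral_Icc_split[of 0 s "\<lambda>u. f u a" r] set_integrable_bounded_Icc[OF fa, of a 0 s K] K that
    by (auto simp: F_def)
  have FK: "\<bar>F s a - F r a\<bar> \<le> K * (s - r)" if "a \<in> space M" "0 \<le> r" "r \<le> s" for r s a
    unfolding Fdiff[OF that] by (rule set_integral_Icc_bound) (use fa K that in auto)
  have F0: "F 0 a = 0" if "a \<in> space M" for a
    using set_integral_Icc_bound[OF fa[OF that], of 0 0 K] K that by (simp add: F_def)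
  have Zpos: "0 < Z s a" for s a by (simp add: Z_def)
  have FK0: "\<bar>F s a\<bar> \<le> K * s" if "a \<in> space M" "0 \<le> s" for s a
    using FK[of a 0 s] F0[of a] that by simp
  have Zb: "Z s a \<le> exp (\<theta> * (K * s))" "exp (- (\<theta> * (K * s))) \<le> Z s a" if "a \<in> space M" "0 \<le> s" for s a
  proof -
    have "\<bar>\<theta> * F s a\<bar> \<le> \<theta> * (K * s)"
      using mult_left_mono[OF FK0[OF that] pos(1)] pos(1) by (simp add: abs_mult)
    then show "Z s a \<le> exp (\<theta> * (K * s))" "exp (- (\<theta> * (K * s))) \<le> Z s a"
      unfolding Z_def' exp_le_cancel_iff by linarith+
  qed
  have Zi: "integrable M (Z s)" if "0 \<le> s" for s
    using Zb Zpos that by (intro integrable_bounded[where C="exp (\<theta> * (K * s))"]) (auto simp: less_imp_le)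
  have Zmono: "exp (\<theta> * (K * r)) \<le> exp (\<theta> * (K * s))" if "r \<le> s" for r s
    using that pos(1) K0 by (auto intro!: mult_left_mono)
  have Zbs: "Z u a \<le> exp (\<theta> * (K * s))" if "a \<in> space M" "0 \<le> u" "u \<le> s" for s u a
    using order_trans[OF Zb(1)[of a u] Zmono[of u s]] that by simp
  \<comment> \<open>The chain rule for exp along a merely Lipschitz exponent, applied on
    \<open>{0..s}\<close> and on \<open>{0..r}\<close> and subtracted.\<close>
  have Zdiff: "Z s a = Z r a + \<theta> * (LINT u:{r..s}|lborel. f u a * Z u a)" if a: "a \<in> space M" and rs: "0 \<le> r" "r \<le> s" for r s a
  proof -
    have 1: "Z s a = 1 + (LINT u:{0..s}|lborel. Z u a * (\<theta> * f u a))" if s: "0 \<le> s" for s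
    proof -
      have eq: "(\<lambda>s. 0 + (LINT r:{0..s}|lborel. \<theta> * f r a)) = (\<lambda>s. \<theta> * F s a)" by (simp add: F_def)
      have "continuous_on {0..s} (\<lambda>s. F s a)"
        by (rule lipschitz_on_continuous_on[of K], rule lipschitz_onI, unfold dist_real_def)
           (use FK[of a] a K0 in \<open>metis abs_minus_commute abs_of_nonneg atLeastAtMost_iff diff_ge_0_iff_ge linear\<close>, use K0 in simp)
      then have "continuous_on {0..s} (\<lambda>s. exp (\<theta> * F s a))" by (intro continuous_intros)
      moreover have em: "(\<lambda>s. exp (\<theta> * F s a)) \<in> borel_measurable borel" using Fa[OF a] by measurable
      ultimately have "exp (\<theta> * F s a) = exp 0 + (LINT u:{0..s}|lborel. exp (\<theta> * F u a) * (\<theta> * f u a))"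
        using integral_chain_rule[of "\<lambda>u. \<theta> * f u a" s "\<theta> * K" exp exp 0, unfolded eq] s fa[OF a] K[OF a] pos(1) em
        by (auto simp: F_def abs_mult mult_left_mono)
      then show ?thesis by (simp add: Z_def')
    qed
    have "set_integrable lborel {0..s} (\<lambda>u. Z u a * (\<theta> * f u a))"
    proof (rule set_integrable_bounded_Icc[where K="exp (\<theta> * (K * s)) * (\<theta> * K)"])
      show "\<bar>Z u a * (\<theta> * f u a)\<bar> \<le> exp (\<theta> * (K * s)) * (\<theta> * K)" if "u \<in> {0..s}" for u
        unfolding abs_mult using that Zbs[OF a, of u s] Zpos[of u a] K[OF a, of u] pos(1) K0
        by (intro mult_mono) auto
    qed (use Za[OF a] fa[OF a] in measurable)
    from integral_Icc_split[OF this rs(1) rs(2)] 1[of s] 1[of r] rs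
    show ?thesis by (simp add: mult_ac)
  qed
  define m where "m s = (LINT a|M. Z s a)" for s
  define b where "b s = (LINT a|M. f s a * Z s a)" for s
  have mm[measurable]: "m \<in> borel_measurable borel" unfolding m_def by measurable
  have bm[measurable]: "b \<in> borel_measurable borel" unfolding b_def by measurable
  have fZ_le: "\<bar>w * Z u a\<bar> \<le> C * exp (\<theta> * (K * s))" if "a \<in> space M" "0 \<le> u" "u \<le> s" "\<bar>w\<bar> \<le> C" for u s a w C
    unfolding abs_mult using that Zbs[of a u s] Zpos[of u a] by (intro mult_mono) auto
  have ff_le: "\<bar>f s a * f r a\<bar> \<le> K\<^sup>2" if "a \<in> space M" for s r a
    unfolding abs_mult power2_eq_square using K[OF that] K0 by (intro mult_mono) auto
  have fZi: "integrable M (\<lambda>a. f u a * Z s a)" if "0 \<le> s" for u s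
    by (rule integrable_bounded[where C="K * exp (\<theta> * (K * s))"]) (use fZ_le[of _ s s] K that in auto)
  have ffZi: "integrable M (\<lambda>a. f u a * f r a * Z s a)" if "0 \<le> s" for u r s
    by (rule integrable_bounded[where C="K\<^sup>2 * exp (\<theta> * (K * s))"]) (use fZ_le[of _ s s] ff_le that in auto)
  have m_pos: "0 < m s" if "0 \<le> s" for s
  proof -
    have "0 < exp (- (\<theta> * (K * s)))" by simp
    also have "\<dots> = (LINT a|M. exp (- (\<theta> * (K * s))))" by (simp add: prob_space)
    also have "\<dots> \<le> m s" unfolding m_def by (intro integral_mono Zi that) (use Zb that in auto)
    finally show ?thesis .
  qed
  have b_le: "\<bar>b u\<bar> \<le> K * exp (\<theta> * (K * s))" if "0 \<le> u" "u \<le> s" for u s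
  proof -
    have "\<bar>b u\<bar> \<le> (LINT a|M. \<bar>f u a * Z u a\<bar>)" unfolding b_def by (rule integral_abs_bound)
    also have "\<dots> \<le> (LINT a|M. K * exp (\<theta> * (K * s)))"
      by (intro integral_mono integrable_abs fZi that) (use fZ_le[of _ u s] K that in auto)
    finally show ?thesis by (simp add: prob_space)
  qed
  have m_diff: "m s = m r + \<theta> * (LINT u:{r..s}|lborel. b u)" if rs: "0 \<le> r" "r \<le> s" for r s
  proof -
    note fub = Fubini_Icc[of "\<lambda>u a. f u a * Z u a" "\<lambda>_. K * exp (\<theta> * (K * s))" r s]
      integrable_Icc_inner[of "\<lambda>u a. f u a * Z u a" "\<lambda>_. K * exp (\<theta> * (K * s))" r s]
    have fub: "integrable M (\<lambda>x. LINT u:{r..s}|lborel. f u x * Z u x)"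
      "(LINT x|M. (LINT u:{r..s}|lborel. f u x * Z u x)) = (LINT u:{r..s}|lborel. b u)"
      unfolding b_def by (rule fub; use rs fZ_le K in simp)+
    have "m s = (LINT a|M. Z r a + \<theta> * (LINT u:{r..s}|lborel. f u a * Z u a))"
      unfolding m_def using rs by (intro Bochner_Integration.integral_cong refl Zdiff)
    also have "\<dots> = m r + \<theta> * (LINT u:{r..s}|lborel. b u)"
      using fub Zi rs by (simp add: m_def)
    finally show ?thesis .
  qed
  have m0: "m 0 = 1" using F0 by (simp add: m_def Z_def' prob_space cong: Bochner_Integration.integral_cong)
  have m_cont: "continuous_on {0..t} m"
  proof (rule lipschitz_on_continuous_on[of "\<theta> * (K * exp (\<theta> * (K * t)))"], rule lipschitz_onI, unfold dist_real_def)
    have *: "\<bar>m x - m y\<bar> \<le> \<theta> * (K * exp (\<theta> * (K * t))) * \<bar>x - y\<bar>" if "x \<in> {0..t}" "y \<in> {0..t}" "x \<le> y" for x y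
    proof -
      have "\<bar>LINT u:{x..y}|lborel. b u\<bar> \<le> (K * exp (\<theta> * (K * t))) * (y - x)"
        by (rule set_integral_Icc_bound) (use that b_le in auto)
      then have "\<theta> * \<bar>LINT u:{x..y}|lborel. b u\<bar> \<le> \<theta> * ((K * exp (\<theta> * (K * t))) * (y - x))"
        using pos(1) by (rule mult_left_mono)
      then show ?thesis using m_diff[of x y] that pos(1) by (auto simp: abs_mult mult_ac)
    qed
    show "\<bar>m x - m y\<bar> \<le> \<theta> * (K * exp (\<theta> * (K * t))) * \<bar>x - y\<bar>" if "x \<in> {0..t}" "y \<in> {0..t}" for x y
      using *[of x y] *[of y x] that by (cases "x \<le> y") (auto simp: abs_minus_commute)
  qed (use K0 pos in auto)
  have ln_eq: "ln (m t) = (LINT s:{0..t}|lborel. inverse (m s) * (\<theta> * b s))"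
  proof -
    have eq: "1 + (LINT r:{0..s}|lborel. \<theta> * b r) = m s" if "0 \<le> s" for s
      using m_diff[of 0 s] that m0 by simp
    \<comment> \<open>\<open>m\<close> rewritten in the shape required by
      \<open>integral_chain_rule\<close>, a constant plus an indefinite integral for every argument;
      the two are identified on \<open>{0..t}\<close>.\<close>
    define m' where "m' s = 1 + (LINT r:{0..s}|lborel. \<theta> * b r)" for s
    have m'_alt: "m' s = 1 + (LINT u|lborel. (if 0 \<le> u \<and> u \<le> s then 1 else 0) * (\<theta> * b u))" for s
      unfolding m'_def set_lebesgue_integral_def by (intro arg_cong2[where f="(+)"] Bochner_Integration.integral_cong refl) (auto simp: indicator_def)
    have [measurable]: "m' \<in> borel_measurable borel" unfolding m'_alt by measurable
    have m': "m' s = m s" if "s \<in> {0..t}" for s using eq that by (simp add: m'_def)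
    have "ln (m' t) = ln 1 + (LINT s:{0..t}|lborel. inverse (m' s) * (\<theta> * b s))"
      unfolding m'_def
    proof (rule integral_chain_rule[where K="\<theta> * (K * exp (\<theta> * (K * t)))"], goal_cases)
      case (2 r) then show ?case using b_le[of r t] pos(1) by (auto simp: abs_mult intro!: mult_left_mono)
    next
      case (4 s) then show ?case unfolding m'_def[symmetric] using m'[OF 4] m_pos[of s] by (auto intro!: derivative_eq_intros simp: inverse_eq_divide)
    next
      case 5
      have "continuous_on {0..t} (\<lambda>s. inverse (m s))" using m_cont m_pos by (intro continuous_on_inverse) force+
      then show ?case unfolding m'_def[symmetric] by (rule continuous_on_eq) (use m' in auto)
    next
      case 6 show ?case unfolding m'_def[symmetric] by measurable
    qed (use pos in \<open>simp_all add: m'_def[symmetric]\<close>)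
    then show ?thesis using m' pos(3)
      by (auto simp: set_lebesgue_integral_def indicator_def intro!: Bochner_Integration.integral_cong)
  qed
  define e where "e = \<theta> * p1 * G + \<theta>\<^sup>2 * \<eta> * (p2 * G + 3 * K\<^sup>2 * (G - 1))"
  define v where "v s = (LINT r:{max 0 (s - \<eta>)..s}|lborel. (LINT a|M. f s a * f r a))" for s
  have v_alt: "v s = (LINT r|lborel. (if max 0 (s - \<eta>) \<le> r \<and> r \<le> s then 1 else 0) * (LINT a|M. f s a * f r a))" for s
    unfolding v_def set_lebesgue_integral_def by (intro Bochner_Integration.integral_cong refl) (auto simp: indicator_def)
  have vm[measurable]: "v \<in> borel_measurable borel"
    unfolding v_alt by measurable
  have G1: "1 \<le> G" using pos K0 by (simp add: G_def)
  \<comment> \<open>The span is \<open>2 * \<eta>\<close> because two delays are taken: r lies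
    within \<open>\<eta>\<close> of s, and \<open>r - \<eta>\<close> lies one delay further
    back.\<close>
  have Zcmp: "Z r a \<le> G * Z s a" "\<bar>Z r a - Z s a\<bar> \<le> (G - 1) * Z s a" 
    if "a \<in> space M" "0 \<le> r" "r \<le> s" "s - r \<le> 2 * \<eta>" for r s a
  proof -
    define d where "d = \<theta> * (F r a - F s a)"
    have Zr: "Z r a = exp d * Z s a" by (simp add: Z_def' d_def exp_add[symmetric] algebra_simps)
    have "\<bar>F r a - F s a\<bar> \<le> K * (2 * \<eta>)"
      using FK[OF that(1-3)] mult_left_mono[OF that(4) K0] by (simp add: abs_minus_commute)
    then have "\<bar>d\<bar> \<le> 2 * \<theta> * K * \<eta>"
      using mult_left_mono[OF _ pos(1)] by (force simp: d_def abs_mult pos(1) mult_ac)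
    from abs_le_of_exp[OF this] have ed: "exp d \<le> G" "\<bar>exp d - 1\<bar> \<le> G - 1" by (simp_all add: G_def)
    show "Z r a \<le> G * Z s a" unfolding Zr using ed(1) Zpos[of s a] by (intro mult_right_mono) auto
    have "\<bar>Z r a - Z s a\<bar> = \<bar>exp d - 1\<bar> * Z s a"
      unfolding Zr using Zpos[of s a] by (metis abs_mult abs_of_pos left_diff_distrib mult_1)
    also have "\<dots> \<le> (G - 1) * Z s a" using ed(2) Zpos[of s a] by (intro mult_right_mono) auto
    finally show "\<bar>Z r a - Z s a\<bar> \<le> (G - 1) * Z s a" .
  qed
  have mcmp: "m r \<le> G * m s" "\<bar>m r - m s\<bar> \<le> (G - 1) * m s" if "0 \<le> r" "r \<le> s" "s - r \<le> 2 * \<eta>" for r s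
  proof -
    have "m r \<le> (LINT a|M. G * Z s a)" unfolding m_def
      by (intro integral_mono integrable_mult_right Zi) (use that Zcmp in auto)
    then show "m r \<le> G * m s" by (simp add: m_def)
    have "\<bar>m r - m s\<bar> = \<bar>LINT a|M. Z r a - Z s a\<bar>" using Zi that by (simp add: m_def)
    also have "\<dots> \<le> (LINT a|M. \<bar>Z r a - Z s a\<bar>)" by (rule integral_abs_bound)
    also have "\<dots> \<le> (LINT a|M. (G - 1) * Z s a)"
      by (intro integral_mono integrable_mult_right integrable_abs Bochner_Integration.integrable_diff Zi) (use that Zcmp in auto)
    finally show "\<bar>m r - m s\<bar> \<le> (G - 1) * m s" by (simp add: m_def)
  qed
  \<comment> \<open>The relation between \<open>b s\<close> and \<open>v s * m s\<close> before
    division by \<open>m s\<close>. The equation \<open>bs\<close> splits off the weight at the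
    delayed time \<open>s0\<close>; the remaining integral of \<open>w\<close> carries the
    covariance.\<close>
  have main: "\<bar>\<theta> * b s - \<theta>\<^sup>2 * v s * m s\<bar> \<le> e * m s" if s: "0 \<le> s" "s \<le> t" for s
  proof -
    define s0 where "s0 = max 0 (s - \<eta>)"
    have s0: "0 \<le> s0" "s0 \<le> s" "s - s0 \<le> \<eta>" using s pos by (auto simp: s0_def)
    define w where "w r = (LINT a|M. f s a * f r a * Z r a)" for r
    have [measurable]: "w \<in> borel_measurable borel" unfolding w_def by measurable
    have bs: "b s = (LINT a|M. f s a * Z s0 a) + \<theta> * (LINT r:{s0..s}|lborel. w r)"
    proof -
      note fub = Fubini_Icc[of "\<lambda>u a. f s a * f u a * Z u a" "\<lambda>_. K\<^sup>2 * exp (\<theta> * (K * s))" s0 s]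
        integrable_Icc_inner[of "\<lambda>u a. f s a * f u a * Z u a" "\<lambda>_. K\<^sup>2 * exp (\<theta> * (K * s))" s0 s]
      have fub: "integrable M (\<lambda>x. LINT u:{s0..s}|lborel. f s x * f u x * Z u x)"
        "(LINT x|M. (LINT u:{s0..s}|lborel. f s x * f u x * Z u x)) = (LINT u:{s0..s}|lborel. w u)"
        unfolding w_def by (rule fub; use s0 fZ_le ff_le in simp)+
      have "b s = (LINT a|M. f s a * Z s0 a + \<theta> * (LINT u:{s0..s}|lborel. f s a * f u a * Z u a))"
        unfolding b_def 
      proof (intro Bochner_Integration.integral_cong refl)
        fix a assume a: "a \<in> space M"
        have ring: "x * (y + z * w) = x * y + z * (x * w)" for x y z w :: real by (simp add: algebra_simps)
        have "(LINT u:{s0..s}|lborel. f s a * f u a * Z u a) = f s a * (LINT u:{s0..s}|lborel. f u a * Z u a)"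
          by (simp add: mult.assoc)
        then show "f s a * Z s a = f s a * Z s0 a + \<theta> * (LINT u:{s0..s}|lborel. f s a * f u a * Z u a)"
          using Zdiff[OF a s0(1,2)] by (simp only: ring)
      qed
      also have "\<dots> = (LINT a|M. f s a * Z s0 a) + \<theta> * (LINT r:{s0..s}|lborel. w r)"
        using fub fZi[of s0 s] s0 by simp
      finally show ?thesis .
    qed
    have 1: "\<bar>LINT a|M. f s a * Z s0 a\<bar> \<le> p1 * G * m s"
    proof -
      have "p1 * m s0 \<le> p1 * (G * m s)" using mcmp(1)[of s0 s] s0 pos by (intro mult_left_mono) auto
      then show ?thesis using H1[OF s] by (simp add: s0_def m_def mult_ac)
    qed
    define E where "E r = (LINT a|M. f s a * f r a)" for r
    have [measurable]: "E \<in> borel_measurable borel" unfolding E_def by measurable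
    have E_le: "\<bar>E r\<bar> \<le> K\<^sup>2" for r
    proof -
      have "\<bar>E r\<bar> \<le> (LINT a|M. \<bar>f s a * f r a\<bar>)" unfolding E_def by (rule integral_abs_bound)
      also have "\<dots> \<le> (LINT a|M. K\<^sup>2)" 
        by (intro integral_mono integrable_abs integrable_bounded[where C="K\<^sup>2"]) (use ff_le in auto)
      finally show ?thesis by (simp add: prob_space)
    qed
    \<comment> \<open>Three replacements: \<open>Z r\<close> by \<open>Z r0\<close>, routed through
      \<open>Z s\<close> and costing \<open>2 * (G - 1)\<close>; the decoupling by
      \<open>H2\<close>; and \<open>m r0\<close> by \<open>m s\<close>, costing one more
      \<open>G - 1\<close>. This is the origin of the factor 3.\<close>
    have 2: "\<bar>w r - E r * m s\<bar> \<le> (p2 * G + 3 * K\<^sup>2 * (G - 1)) * m s" if r: "r \<in> {s0..s}" for r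
    proof -
      define r0 where "r0 = max 0 (r - \<eta>)"
      have r0: "0 \<le> r0" "r0 \<le> r" "r \<le> s" "0 \<le> r" "s - r0 \<le> 2 * \<eta>" "s - r \<le> 2 * \<eta>" using s0 r pos by (auto simp: r0_def)
      have "w r - (LINT a|M. f s a * f r a * Z r0 a) = (LINT a|M. f s a * f r a * (Z r a - Z r0 a))"
        unfolding w_def using ffZi[of r s r] ffZi[of r0 s r] r0 by (simp add: right_diff_distrib)
      also have "\<bar>\<dots>\<bar> \<le> (LINT a|M. \<bar>f s a * f r a * (Z r a - Z r0 a)\<bar>)" by (rule integral_abs_bound)
      also have "\<dots> \<le> (LINT a|M. K\<^sup>2 * (2 * (G - 1)) * Z s a)"
      proof (intro integral_mono integrable_abs integrable_mult_right Zi s)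
        show "integrable M (\<lambda>a. f s a * f r a * (Z r a - Z r0 a))"
          using ffZi[of r s r] ffZi[of r0 s r] r0 by (simp add: right_diff_distrib)
        fix a assume a: "a \<in> space M"
        have "\<bar>Z r a - Z r0 a\<bar> \<le> 2 * (G - 1) * Z s a"
          using Zcmp(2)[OF a, of r s] Zcmp(2)[OF a, of r0 s] r0 by (simp add: algebra_simps)
        then show "\<bar>f s a * f r a * (Z r a - Z r0 a)\<bar> \<le> K\<^sup>2 * (2 * (G - 1)) * Z s a"
          using ff_le[OF a, of s r] unfolding abs_mult[of "f s a * f r a"] mult.assoc[of "K\<^sup>2"] by (intro mult_mono) auto
      qed
      finally have A: "\<bar>w r - (LINT a|M. f s a * f r a * Z r0 a)\<bar> \<le> K\<^sup>2 * (2 * (G - 1)) * m s" by (simp add: m_def)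
      have "p2 * m r0 \<le> p2 * (G * m s)" using mcmp(1)[of r0 s] r0 pos by (intro mult_left_mono) auto
      then have B: "\<bar>(LINT a|M. f s a * f r a * Z r0 a) - E r * m r0\<bar> \<le> p2 * G * m s"
        using H2[of r s] r0 s by (simp add: r0_def m_def E_def mult_ac)
      have C: "\<bar>E r * m r0 - E r * m s\<bar> \<le> K\<^sup>2 * ((G - 1) * m s)"
        unfolding right_diff_distrib[symmetric] abs_mult using E_le[of r] mcmp(2)[of r0 s] r0 by (intro mult_mono) auto
      show ?thesis using A B C by (simp add: algebra_simps) 
    qed
    have "(LINT r:{s0..s}|lborel. w r) - v s * m s = (LINT r:{s0..s}|lborel. w r - E r * m s)"
    proof (subst set_integral_diff(2))
      show "set_integrable lborel {s0..s} (\<lambda>r. E r * m s)"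
        by (rule set_integrable_bounded_Icc[where K="K\<^sup>2 * m s"]) 
           (use E_le m_pos[of s] s in \<open>auto simp: abs_mult intro!: mult_right_mono\<close>)
      show "set_integrable lborel {s0..s} w"
      proof (rule set_integrable_bounded_Icc[where K="(p2 * G + 3 * K\<^sup>2 * (G - 1)) * m s + K\<^sup>2 * m s"])
        fix r assume r: "r \<in> {s0..s}"
        have "\<bar>E r * m s\<bar> \<le> K\<^sup>2 * m s" using E_le m_pos[of s] s by (auto simp: abs_mult intro!: mult_right_mono)
        then show "\<bar>w r\<bar> \<le> (p2 * G + 3 * K\<^sup>2 * (G - 1)) * m s + K\<^sup>2 * m s" using 2[OF r] by (simp add: abs_le_iff)
      qed simp
    qed (simp add: v_def E_def s0_def)
    also have "\<bar>\<dots>\<bar> \<le> (p2 * G + 3 * K\<^sup>2 * (G - 1)) * m s * (s - s0)"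
      by (rule set_integral_Icc_bound) (use 2 s0 in auto)
    also have "\<dots> \<le> (p2 * G + 3 * K\<^sup>2 * (G - 1)) * m s * \<eta>"
      using s0 pos G1 m_pos[of s] s by (intro mult_left_mono) auto
    finally have 3: "\<bar>(LINT r:{s0..s}|lborel. w r) - v s * m s\<bar> \<le> (p2 * G + 3 * K\<^sup>2 * (G - 1)) * m s * \<eta>" .
    have "\<theta> * b s - \<theta>\<^sup>2 * v s * m s = \<theta> * (LINT a|M. f s a * Z s0 a) + \<theta>\<^sup>2 * ((LINT r:{s0..s}|lborel. w r) - v s * m s)"
      unfolding bs by (simp add: algebra_simps power2_eq_square)
    also have "\<bar>\<dots>\<bar> \<le> \<theta> * \<bar>LINT a|M. f s a * Z s0 a\<bar> + \<theta>\<^sup>2 * \<bar>(LINT r:{s0..s}|lborel. w r) - v s * m s\<bar>"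
      using pos(1) by (auto intro!: order_trans[OF abs_triangle_ineq] simp: abs_mult)
    also have "\<dots> \<le> \<theta> * (p1 * G * m s) + \<theta>\<^sup>2 * ((p2 * G + 3 * K\<^sup>2 * (G - 1)) * m s * \<eta>)"
      using 1 3 pos(1) by (intro add_mono mult_left_mono) auto
    finally show ?thesis by (simp add: e_def algebra_simps)
  qed
  have main': "\<bar>inverse (m s) * (\<theta> * b s) - \<theta>\<^sup>2 * v s\<bar> \<le> e" if s: "s \<in> {0..t}" for s
  proof -
    have mp: "m s > 0" using s m_pos by auto
    have "inverse (m s) * (\<theta> * b s) - \<theta>\<^sup>2 * v s = (\<theta> * b s - \<theta>\<^sup>2 * v s * m s) / m s" using mp by (simp add: field_simps)
    then show ?thesis using main[of s] s mp by (simp add: abs_divide pos_divide_le_eq)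
  qed
  have v_le: "\<bar>v s\<bar> \<le> K\<^sup>2 * \<eta>" if s: "s \<in> {0..t}" for s
  proof -
    have "\<bar>v s\<bar> \<le> K\<^sup>2 * (s - max 0 (s - \<eta>))" unfolding v_def
    proof (rule set_integral_Icc_bound)
      fix r
      have "\<bar>LINT a|M. f s a * f r a\<bar> \<le> (LINT a|M. \<bar>f s a * f r a\<bar>)" by (rule integral_abs_bound)
      also have "\<dots> \<le> (LINT a|M. K\<^sup>2)" 
        by (intro integral_mono integrable_abs integrable_bounded[where C="K\<^sup>2"]) (use ff_le in auto)
      finally show "\<bar>LINT a|M. f s a * f r a\<bar> \<le> K\<^sup>2" by (simp add: prob_space)
    qed (use s pos in auto)
    also have "\<dots> \<le> K\<^sup>2 * \<eta>" by (rule mult_left_mono) auto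
    finally show ?thesis .
  qed
  have "ln (m t) - \<theta>\<^sup>2 * (LINT s:{0..t}|lborel. v s) = (LINT s:{0..t}|lborel. inverse (m s) * (\<theta> * b s) - \<theta>\<^sup>2 * v s)"
  proof (subst set_integral_diff(2))
    show vi: "set_integrable lborel {0..t} (\<lambda>s. \<theta>\<^sup>2 * v s)"
      by (rule set_integrable_bounded_Icc[where K="\<theta>\<^sup>2 * (K\<^sup>2 * \<eta>)"]) (use v_le in \<open>auto simp: abs_mult intro!: mult_left_mono\<close>)
    show "set_integrable lborel {0..t} (\<lambda>s. inverse (m s) * (\<theta> * b s))"
    proof (rule set_integrable_bounded_Icc[where K="e + \<theta>\<^sup>2 * (K\<^sup>2 * \<eta>)"])
      fix s assume s: "s \<in> {0..t}"
      have "\<bar>\<theta>\<^sup>2 * v s\<bar> \<le> \<theta>\<^sup>2 * (K\<^sup>2 * \<eta>)" using v_le[OF s] by (auto simp: abs_mult intro!: mult_left_mono)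
      then show "\<bar>inverse (m s) * (\<theta> * b s)\<bar> \<le> e + \<theta>\<^sup>2 * (K\<^sup>2 * \<eta>)" using main'[OF s] by (simp add: abs_le_iff)
    qed simp
  qed (simp add: ln_eq)
  also have "\<bar>\<dots>\<bar> \<le> e * (t - 0)"
    by (rule set_integral_Icc_bound) (use main' pos in auto)
  finally show ?thesis by (simp add: m_def v_def e_def)
qed

subsection \<open>Mixing fields\<close>

locale mixing_field = prob_space S for S :: "'s measure" +
  fixes c :: "real \<Rightarrow> real \<Rightarrow> 's \<Rightarrow> real" and K :: real
  assumes c_meas: "jointly_measurable_field S c"
    and c_bound: "\<And>t x a. 0 \<le> t \<Longrightarrow> a \<in> space S \<Longrightarrow> \<bar>c t x a\<bar> \<le> K"
    and c_mean: "\<And>t x. 0 \<le> t \<Longrightarrow> (LINT a|S. c t x a) = 0"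
begin

lemma K_nonneg: "0 \<le> K"
  using c_bound[of 0 _ 0] not_empty by force

text \<open>Truncating the time at \<open>0\<close> makes the field measurable and bounded on the whole plane.\<close>

definition cp :: "real \<Rightarrow> real \<Rightarrow> 's \<Rightarrow> real" where
  "cp t x a = c (max 0 t) x a"

lemma cp_eq: "0 \<le> t \<Longrightarrow> cp t x a = c t x a"
  by (simp add: cp_def max_def)

lemma cp_measurable[measurable]:
  "(\<lambda>((t, x), a). cp t x a) \<in> borel_measurable ((borel \<Otimes>\<^sub>M borel) \<Otimes>\<^sub>M S)"
proof -
  have "(\<lambda>((t, x), a). ((max 0 t, x), a)) \<in> ((borel :: (real \<times> real) measure) \<Otimes>\<^sub>M S) \<rightarrow>\<^sub>M
      (restrict_space (borel :: (real \<times> real) measure) ({0..} \<times> UNIV) \<Otimes>\<^sub>M S)"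
  proof (rule measurable_pair)
    show "fst \<circ> (\<lambda>((t, x), a). ((max 0 t, x), a)) \<in> (borel :: (real \<times> real) measure) \<Otimes>\<^sub>M S \<rightarrow>\<^sub>M
        restrict_space (borel :: (real \<times> real) measure) ({0..} \<times> UNIV)"
      by (rule measurable_restrict_space2) (auto simp: split_beta' comp_def borel_prod[symmetric])
    show "snd \<circ> (\<lambda>((t, x), a). ((max 0 t, x), a)) \<in> (borel :: (real \<times> real) measure) \<Otimes>\<^sub>M S \<rightarrow>\<^sub>M S"
      by (auto simp: split_beta' comp_def)
  qed
  from measurable_compose[OF this c_meas[unfolded jointly_measurable_field_def]]
  show ?thesis by (simp add: split_beta' cp_def borel_prod)
qed

lemma cp_measurable'[measurable (raw)]:
  assumes "f \<in> borel_measurable N" "g \<in> borel_measurable N" "h \<in> N \<rightarrow>\<^sub>M S"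
  shows "(\<lambda>x. cp (f x) (g x) (h x)) \<in> borel_measurable N"
proof -
  have "(\<lambda>x. ((f x, g x), h x)) \<in> N \<rightarrow>\<^sub>M ((borel \<Otimes>\<^sub>M borel) \<Otimes>\<^sub>M S)"
    using assms by measurable
  from measurable_compose[OF this cp_measurable] show ?thesis by simp
qed

lemma cp_bound: "a \<in> space S \<Longrightarrow> \<bar>cp t x a\<bar> \<le> K"
  unfolding cp_def by (rule c_bound) auto

lemma cp_mean: "(LINT a|S. cp t x a) = 0"
  unfolding cp_def by (rule c_mean) auto

definition field_alg :: "(real \<times> real) set \<Rightarrow> 's measure" where
  "field_alg A = sigma (space S) {c (fst p) (snd p) -` U \<inter> space S | p U. p \<in> A \<and> U \<in> sets borel}"

lemma space_field_alg[simp]: "space (field_alg A) = space S"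
  by (simp add: field_alg_def space_measure_of_conv)

lemma sets_field_alg: "sets (field_alg A) = field_sigma S c A"
  unfolding field_alg_def field_sigma_def by (rule sets_measure_of) auto

lemma measurable_field_alg:
  assumes "p \<in> A" shows "c (fst p) (snd p) \<in> borel_measurable (field_alg A)"
proof (rule measurableI)
  fix U :: "real set" assume "U \<in> sets borel"
  then show "c (fst p) (snd p) -` U \<inter> space (field_alg A) \<in> sets (field_alg A)"
    unfolding sets_field_alg field_sigma_def by (intro sigma_sets.Basic) (use assms \<open>U \<in> sets borel\<close> in fastforce)
qed simp

lemma subalgebra_field_alg:
  assumes "A \<subseteq> {0..} \<times> UNIV" shows "subalgebra S (field_alg A)"
  unfolding subalgebra_def
proof
  have "c (fst p) (snd p) \<in> borel_measurable S" if "p \<in> A" for p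
  proof -
    have "cp (fst p) (snd p) \<in> borel_measurable S" by measurable
    moreover have "cp (fst p) (snd p) = c (fst p) (snd p)" using that assms by (auto simp: cp_eq fun_eq_iff)
    ultimately show ?thesis by simp
  qed
  then show "sets (field_alg A) \<subseteq> sets S"
    unfolding sets_field_alg field_sigma_def by (intro sets.sigma_sets_subset) (auto intro: measurable_sets)
qed simp

text \<open>Multiplying the conditional form by the probability of \<open>S2\<close> keeps that
  probability as a factor of the error. This is the gain over strong mixing, and for a null set the
  bound is trivial.\<close>

lemma alpha_um_bound:
  assumes A: "A1 \<subseteq> {0..} \<times> UNIV" "A2 \<subseteq> {0..} \<times> UNIV" "A1 \<noteq> {}" "A2 \<noteq> {}" "r \<le> setdist A1 A2"
    and S: "S1 \<in> field_sigma S c A1" "S2 \<in> field_sigma S c A2"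
  shows "\<bar>measure S (S1 \<inter> S2) - measure S S1 * measure S S2\<bar> \<le> alpha_um S c r * measure S S2"
proof (cases "measure S S2 = 0")
  case True
  have "S1 \<inter> S2 \<subseteq> S2" by auto
  moreover have "S2 \<in> sets S" using S(2) subalgebra_field_alg[OF A(2)] by (auto simp: subalgebra_def sets_field_alg)
  ultimately have "measure S (S1 \<inter> S2) \<le> measure S S2" by (intro finite_measure_mono)
  then show ?thesis using True measure_nonneg[of S "S1 \<inter> S2"] by simp
next
  case False
  have sets: "S1 \<in> sets S" "S2 \<in> sets S"
    using S subalgebra_field_alg[OF A(1)] subalgebra_field_alg[OF A(2)] by (auto simp: subalgebra_def sets_field_alg)
  let ?A = "{\<bar>\<P>(a in S. a \<in> S1 \<bar> a \<in> S2) - measure S S1\<bar> | A1 A2 S1 S2.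
     A1 \<subseteq> {0..} \<times> UNIV \<and> A2 \<subseteq> {0..} \<times> UNIV \<and> A1 \<noteq> {} \<and> A2 \<noteq> {} \<and> r \<le> setdist A1 A2 \<and>
     S1 \<in> field_sigma S c A1 \<and> S2 \<in> field_sigma S c A2 \<and> measure S S2 \<noteq> 0}"
  \<comment> \<open>\<open>Sup\<close> over the reals dominates the members of a set only if the set
    is bounded above; conditional probabilities lie between 0 and 1.\<close>
  have cond_le: "0 \<le> \<P>(a in S. a \<in> S1 \<bar> a \<in> S2) \<and> \<P>(a in S. a \<in> S1 \<bar> a \<in> S2) \<le> 1"
    if "A2 \<subseteq> {0..} \<times> UNIV" "S2 \<in> field_sigma S c A2" for S1 A2 S2
  proof -
    have "S2 \<in> sets S" using that subalgebra_field_alg[OF that(1)] by (auto simp: subalgebra_def sets_field_alg)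
    then have "measure S {a \<in> space S. a \<in> S1 \<and> a \<in> S2} \<le> measure S {a \<in> space S. a \<in> S2}"
      by (intro finite_measure_mono) (auto simp: sets.Int_space_eq2 Collect_conj_eq)
    then show ?thesis by (simp add: cond_prob_def divide_le_eq_1 measure_nonneg) (metis measure_nonneg order_less_le)
  qed
  have "bdd_above ?A"
  proof (rule bdd_aboveI)
    fix z assume "z \<in> ?A"
    then obtain A1 A2 S1 S2 where z: "z = \<bar>\<P>(a in S. a \<in> S1 \<bar> a \<in> S2) - measure S S1\<bar>"
      "A2 \<subseteq> {0..} \<times> UNIV" "S2 \<in> field_sigma S c A2" by blast
    show "z \<le> 1" using cond_le[OF z(2,3), of S1] measure_nonneg[of S S1] prob_le_1[of S1] unfolding z(1) by linarith
  qed
  moreover have "\<bar>\<P>(a in S. a \<in> S1 \<bar> a \<in> S2) - measure S S1\<bar> \<in> ?A" using A S False by blast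
  ultimately have "\<bar>\<P>(a in S. a \<in> S1 \<bar> a \<in> S2) - measure S S1\<bar> \<le> alpha_um S c r"
    unfolding alpha_um_def by (rule cSup_upper[rotated])
  then have "\<bar>\<P>(a in S. a \<in> S1 \<bar> a \<in> S2) - measure S S1\<bar> * measure S S2 \<le> alpha_um S c r * measure S S2"
    by (rule mult_right_mono) simp
  moreover have "{a \<in> space S. a \<in> S1 \<and> a \<in> S2} = S1 \<inter> S2" "{a \<in> space S. a \<in> S2} = S2"
    using sets.sets_into_space[OF sets(1)] sets.sets_into_space[OF sets(2)] by auto
  moreover from this have "\<P>(a in S. a \<in> S1 \<bar> a \<in> S2) = measure S (S1 \<inter> S2) / measure S S2" by (simp add: cond_prob_def)
  moreover have "\<bar>x / y - z\<bar> * y = \<bar>x - z * y\<bar>" if "y > 0" for x y z :: real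
    using that by (auto simp: abs_if field_simps)
  ultimately show ?thesis using False measure_nonneg[of S S2] by (metis order_less_le)
qed

text \<open>Two layer cake arguments: over the levels of \<open>Y\<close> with the conditioning
  event fixed, then over the levels of \<open>X\<close>. Since the error for an event
  \<open>S2\<close> is proportional to its probability, the error for \<open>X\<close> is
  proportional to its mean, and \<open>L\<close> does not appear. \<open>X\<close> need only agree
  almost everywhere with a function measurable for the second index set, as is the case for
  exponentials of time integrals.\<close>

lemma mixing_covariance:
  assumes A: "A1 \<subseteq> {0..} \<times> UNIV" "A2 \<subseteq> {0..} \<times> UNIV" "A1 \<noteq> {}" "A2 \<noteq> {}" "r \<le> setdist A1 A2"
    and Y: "Y \<in> borel_measurable (field_alg A1)" and YM: "\<And>a. a \<in> space S \<Longrightarrow> \<bar>Y a\<bar> \<le> M"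
    and X: "X \<in> borel_measurable S" and XL: "\<And>a. a \<in> space S \<Longrightarrow> 0 \<le> X a \<and> X a \<le> L"
    and X': "X' \<in> borel_measurable (field_alg A2)" "AE a in S. X a = X' a"
  shows "\<bar>(LINT a|S. X a * Y a) - (LINT a|S. X a) * (LINT a|S. Y a)\<bar> \<le> 2 * M * alpha_um S c r * (LINT a|S. X a)"
proof -
  define \<alpha> where "\<alpha> = alpha_um S c r"
  note F1 = subalgebra_field_alg[OF A(1)] and F2 = subalgebra_field_alg[OF A(2)]
  have M0: "0 \<le> M" and L0: "0 \<le> L" using YM XL not_empty by force+
  note [measurable] = X
  have [measurable]: "Y \<in> borel_measurable S" "X' \<in> borel_measurable S"
    using measurable_from_subalg[OF F1 Y] measurable_from_subalg[OF F2 X'(1)] by auto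
  define EY where "EY = (LINT a|S. Y a)"
  have Yi: "integrable S Y" by (rule integrable_bounded[where C=M]) (use YM in auto)
  have Xi: "integrable S X" by (rule integrable_bounded[where C=L]) (use XL in auto)
  have EYM: "\<bar>EY\<bar> \<le> M"
  proof -
    have "\<bar>EY\<bar> \<le> (LINT a|S. \<bar>Y a\<bar>)" unfolding EY_def by (rule integral_abs_bound)
    also have "\<dots> \<le> (LINT a|S. M)" by (intro integral_mono integrable_abs Yi) (use YM in auto)
    finally show ?thesis by (simp add: prob_space)
  qed
  have set2: "\<bar>(LINT a|S. indicator S2 a * Y a) - measure S S2 * EY\<bar> \<le> 2 * M * \<alpha> * measure S S2" if S2: "S2 \<in> sets (field_alg A2)" for S2
  proof -
    have S2m[measurable]: "S2 \<in> sets S" using S2 F2 by (auto simp: subalgebra_def)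
    have S2i: "integrable S (indicat_real S2)" using S2m by (intro integrable_bounded[where C=1]) auto
    \<comment> \<open>The shift makes \<open>Y\<close> nonnegative with range \<open>2 * M\<close>,
      which is where the constant of the conclusion comes from. The sign \<open>\<sigma>\<close>
      below turns the one-sided layer cake bound into an absolute value.\<close>
    define W where "W a = Y a + M" for a
    have [measurable]: "W \<in> borel_measurable S" unfolding W_def by measurable
    have iY: "integrable S (\<lambda>a. indicator S2 a * Y a)"
      by (rule integrable_bounded[where C=M]) (use YM M0 in \<open>auto simp: indicator_def\<close>)
    have lc: "- (\<alpha> * measure S S2) * (2 * M) \<le> (LINT a|S. W a * (\<sigma> * (indicator S2 a - measure S S2)))" if \<sigma>: "\<sigma> = 1 \<or> \<sigma> = -1" for \<sigma>
    proof (rule layer_cake_lower_bound[where C=1])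
      fix u
      define S1 where "S1 = {a \<in> space S. u < W a}"
      have "{a \<in> space (field_alg A1). u - M < Y a} \<in> sets (field_alg A1)"
        using Y by measurable
      then have S1: "S1 \<in> sets (field_alg A1)" by (simp add: S1_def W_def algebra_simps)
      have S1m[measurable]: "S1 \<in> sets S" using S1 F1 by (auto simp: subalgebra_def)
      have "(LINT a|S. indicator {y. u < W y} a * (\<sigma> * (indicator S2 a - measure S S2)))
         = (LINT a|S. \<sigma> * (indicator (S1 \<inter> S2) a - measure S S2 * indicator S1 a))"
        by (rule Bochner_Integration.integral_cong) (auto simp: S1_def indicator_def)
      also have "\<dots> = \<sigma> * (measure S (S1 \<inter> S2) - measure S S2 * measure S S1)"
        using integrable_real_indicator[of "S1 \<inter> S2" S] integrable_real_indicator[of S1 S] S1m S2m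
        by (simp add: less_top[symmetric])
      finally have eq: "(LINT a|S. indicator {y. u < W y} a * (\<sigma> * (indicator S2 a - measure S S2)))
         = \<sigma> * (measure S (S1 \<inter> S2) - measure S S2 * measure S S1)" .
      show "- (\<alpha> * measure S S2) \<le> (LINT a|S. indicator {y. u < W y} a * (\<sigma> * (indicator S2 a - measure S S2)))"
        unfolding eq using alpha_um_bound[OF A, of S1 S2] S1 S2 \<sigma> 
        by (auto simp: sets_field_alg \<alpha>_def abs_le_iff mult_ac)
    next
      show "\<bar>\<sigma> * (indicator S2 x - measure S S2)\<bar> \<le> 1" for x
        using \<sigma> prob_le_1[of S2] by (auto simp: indicator_def abs_mult)
      show "0 \<le> W x \<and> W x \<le> 2 * M" if "x \<in> space S" for x
        using YM[OF that] by (auto simp: W_def abs_le_iff)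
    qed (use M0 in auto)
    have "(LINT a|S. W a * (\<sigma> * (indicator S2 a - measure S S2))) = \<sigma> * ((LINT a|S. indicator S2 a * Y a) - measure S S2 * EY)" for \<sigma> :: real
    proof -
      have "(LINT a|S. W a * (\<sigma> * (indicator S2 a - measure S S2)))
        = (LINT a|S. \<sigma> * ((indicator S2 a * Y a - measure S S2 * Y a) + (M * indicator S2 a - M * measure S S2)))"
        by (rule Bochner_Integration.integral_cong) (auto simp: W_def algebra_simps)
      also have "\<dots> = \<sigma> * ((LINT a|S. indicator S2 a * Y a) - measure S S2 * EY)"
        using iY Yi S2i S2m by (simp add: EY_def prob_space)
      finally show ?thesis .
    qed
    from lc[of 1, unfolded this] lc[of "-1", unfolded this]
    show ?thesis by (auto simp: abs_le_iff algebra_simps)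
  qed
  \<comment> \<open>Clamping the version \<open>X'\<close> gives a function that is measurable for
    the second index set, within the range everywhere, and still almost everywhere equal to
    \<open>X\<close>.\<close>
  define X1 where "X1 a = max 0 (min L (X' a))" for a
  have [measurable]: "X1 \<in> borel_measurable S" unfolding X1_def by measurable
  have X1: "X1 \<in> borel_measurable (field_alg A2)" unfolding X1_def using X'(1) by measurable
  have X1X: "AE a in S. X a = X1 a" using X'(2) AE_space
  proof eventually_elim
    case (elim a)
    with XL[of a] show ?case by (simp add: X1_def)
  qed
  have XYi: "integrable S (\<lambda>a. X a * Y a)"
    by (rule integrable_bounded[where C="L * M"])
       (measurable, unfold abs_mult, rule mult_mono, use XL YM L0 in auto)
  \<comment> \<open>With \<open>2 * M * \<alpha>\<close> added to the integrand, its integral over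
    every level set is nonnegative by \<open>set2\<close>. The layer cake bound applies with
    \<open>k = 0\<close>, and \<open>L\<close> drops out.\<close>
  have fin: "0 \<le> (LINT a|S. X a * (\<sigma> * (Y a - EY) + 2 * M * \<alpha>))" if \<sigma>: "\<sigma> = 1 \<or> \<sigma> = -1" for \<sigma>
  proof -
    have "- 0 * L \<le> (LINT a|S. X1 a * (\<sigma> * (Y a - EY) + 2 * M * \<alpha>))"
    proof (rule layer_cake_lower_bound[where C="2 * M + \<bar>2 * M * \<alpha>\<bar>"])
      fix u
      define S2 where "S2 = {a \<in> space S. u < X1 a}"
      have "{a \<in> space (field_alg A2). u < X1 a} \<in> sets (field_alg A2)"
        using X1 by measurable
      then have S2: "S2 \<in> sets (field_alg A2)" by (simp add: S2_def)
      have S2m[measurable]: "S2 \<in> sets S" using S2 F2 by (auto simp: subalgebra_def)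
      have S2i: "integrable S (indicat_real S2)" using S2m by (intro integrable_bounded[where C=1]) auto
      have iY: "integrable S (\<lambda>a. indicator S2 a * Y a)"
        by (rule integrable_bounded[where C=M]) (use YM M0 in \<open>auto simp: indicator_def\<close>)
      have "(LINT a|S. indicator {y. u < X1 y} a * (\<sigma> * (Y a - EY) + 2 * M * \<alpha>))
         = (LINT a|S. \<sigma> * (indicator S2 a * Y a - indicator S2 a * EY) + 2 * M * \<alpha> * indicator S2 a)"
        by (rule Bochner_Integration.integral_cong) (auto simp: S2_def indicator_def)
      also have "\<dots> = \<sigma> * ((LINT a|S. indicator S2 a * Y a) - measure S S2 * EY) + 2 * M * \<alpha> * measure S S2"
        using iY S2i S2m by simp
      finally have eq: "(LINT a|S. indicator {y. u < X1 y} a * (\<sigma> * (Y a - EY) + 2 * M * \<alpha>)) =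
         \<sigma> * ((LINT a|S. indicator S2 a * Y a) - measure S S2 * EY) + 2 * M * \<alpha> * measure S S2" .
      show "- 0 \<le> (LINT a|S. indicator {y. u < X1 y} a * (\<sigma> * (Y a - EY) + 2 * M * \<alpha>))"
        unfolding eq using set2[OF S2] \<sigma> by auto
    next
      show "\<bar>\<sigma> * (Y x - EY) + 2 * M * \<alpha>\<bar> \<le> 2 * M + \<bar>2 * M * \<alpha>\<bar>" if "x \<in> space S" for x
        using YM[OF that] EYM \<sigma> by auto
      show "0 \<le> X1 x \<and> X1 x \<le> L" for x using L0 by (auto simp: X1_def)
    qed (use L0 in auto)
    also have "(LINT a|S. X1 a * (\<sigma> * (Y a - EY) + 2 * M * \<alpha>)) = (LINT a|S. X a * (\<sigma> * (Y a - EY) + 2 * M * \<alpha>))"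
      by (rule integral_cong_AE) (measurable, use X1X in eventually_elim, simp)
    finally show ?thesis by simp
  qed
  have "(LINT a|S. X a * (\<sigma> * (Y a - EY) + 2 * M * \<alpha>)) = \<sigma> * ((LINT a|S. X a * Y a) - (LINT a|S. X a) * EY) + 2 * M * \<alpha> * (LINT a|S. X a)" for \<sigma> :: real
  proof -
    have "(LINT a|S. X a * (\<sigma> * (Y a - EY) + 2 * M * \<alpha>)) = (LINT a|S. \<sigma> * (X a * Y a - X a * EY) + 2 * M * \<alpha> * X a)"
      by (rule Bochner_Integration.integral_cong) (auto simp: algebra_simps)
    also have "\<dots> = \<sigma> * ((LINT a|S. X a * Y a) - (LINT a|S. X a) * EY) + 2 * M * \<alpha> * (LINT a|S. X a)"
      using XYi Xi by simp
    finally show ?thesis .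
  qed
  from fin[of 1, unfolded this] fin[of "-1", unfolded this]
  show ?thesis unfolding EY_def[symmetric] \<alpha>_def[symmetric] by (auto simp: abs_le_iff algebra_simps)
qed

end

locale decorrelating_field = mixing_field +
  fixes C \<delta> :: real
  assumes stat: "stationary_field S c"
    and C: "0 < C" and \<delta>: "0 < \<delta>"
    and rate: "\<And>r. 0 \<le> r \<Longrightarrow> alpha_um S c r \<le> C * (1 + r) powr (-(2 + \<delta>))"
    and cov_int: "integrable (lborel \<Otimes>\<^sub>M lborel) (\<lambda>(t, x). field_cov S c t x)"
begin

definition mix :: "real \<Rightarrow> real" where "mix r = C * (1 + r) powr (-(2 + \<delta>))"

abbreviation "\<Phi> \<equiv> field_cov S c"

lemma mix_nonneg: "0 \<le> mix r"
  using C by (simp add: mix_def)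

lemma mix_measurable[measurable]: "mix \<in> borel_measurable borel"
  unfolding mix_def by measurable

lemma cov_measurable[measurable]: "(\<lambda>(t, x). \<Phi> t x) \<in> borel_measurable (borel \<Otimes>\<^sub>M borel)"
  using borel_measurable_integrable[OF cov_int] by simp

lemma cp_cov:
  assumes "0 \<le> r" "r \<le> s"
  shows "(LINT a|S. cp s y a * cp r z a) = \<Phi> (s - r) (y - z)"
  using field_cov_eq[OF c_meas stat assms(1), of "s - r" "y - z" z] assms
  by (simp add: cp_eq mult.commute)

lemma cp_integrable[simp, intro]: "integrable S (cp t x)"
  by (rule integrable_bounded[where C=K]) (use cp_bound in auto)

text \<open>The weight \<open>c 0 0 + K\<close> is nonnegative with mean \<open>K\<close>, and the
  shift leaves the covariance unchanged because \<open>c t x\<close> has mean zero. The distance is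
  measured in time alone, hence uniformity in x.\<close>

lemma cov_bound:
  assumes t: "0 \<le> t" shows "\<bar>\<Phi> t x\<bar> \<le> 2 * K\<^sup>2 * mix t"
proof -
  have A: "{(t, x)} \<subseteq> {0..} \<times> UNIV" "{(0, 0)} \<subseteq> {0::real..} \<times> (UNIV::real set)"
    "{(t, x)} \<noteq> {}" "{(0::real, 0::real)} \<noteq> {}" "t \<le> setdist {(t, x)} {(0, 0)}"
    using t dist_fst_le[of "(t, x)" "(0, 0)"] by (auto simp: dist_real_def)
  have 1: "c t x \<in> borel_measurable (field_alg {(t, x)})" "c 0 0 \<in> borel_measurable (field_alg {(0, 0)})"
    using measurable_field_alg[of "(t, x)" "{(t, x)}"] measurable_field_alg[of "(0, 0)" "{(0, 0)}"] by auto
  have 2: "(\<lambda>a. c 0 0 a + K) \<in> borel_measurable (field_alg {(0, 0)})" using 1(2) by measurable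
  have i: "integrable S (c t x)" "integrable S (c 0 0)" using cp_integrable[of t x] cp_integrable[of 0 0] t
    by (simp_all add: cp_def[abs_def] max_def)
  have ip: "integrable S (\<lambda>a. c 0 0 a * c t x a)"
  proof (rule integrable_bounded[where C="K * K"])
    show "(\<lambda>a. c 0 0 a * c t x a) \<in> borel_measurable S" using i by measurable
    show "\<bar>c 0 0 a * c t x a\<bar> \<le> K * K" if "a \<in> space S" for a
      unfolding abs_mult using c_bound[OF t that] c_bound[OF _ that, of 0] K_nonneg by (intro mult_mono) auto
  qed
  have "\<bar>(LINT a|S. (c 0 0 a + K) * c t x a) - (LINT a|S. c 0 0 a + K) * (LINT a|S. c t x a)\<bar>
     \<le> 2 * K * alpha_um S c t * (LINT a|S. c 0 0 a + K)"
  proof (rule mixing_covariance[OF A 1(1) _ _ _ 2, where L="2 * K"])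
    show "(\<lambda>a. c 0 0 a + K) \<in> borel_measurable S" using i by measurable
    show "0 \<le> c 0 0 a + K \<and> c 0 0 a + K \<le> 2 * K" if "a \<in> space S" for a
      using c_bound[OF order_refl that, of 0] by (auto simp: abs_le_iff)
    show "AE a in S. c 0 0 a + K = c 0 0 a + K" by simp
  qed (use c_bound[OF t] in auto)
  also have "(LINT a|S. c t x a) = 0" by (rule c_mean[OF t])
  also have "(LINT a|S. c 0 0 a + K) = K" using i c_mean[of 0 0] by (simp add: prob_space)
  also have "(LINT a|S. (c 0 0 a + K) * c t x a) = (LINT a|S. c 0 0 a * c t x a) + K * (LINT a|S. c t x a)"
    using i ip by (simp add: distrib_right)
  also have "(LINT a|S. c t x a) = 0" by (rule c_mean[OF t])
  also have "(LINT a|S. c 0 0 a * c t x a) = \<Phi> t x" using field_cov_eq[OF c_meas stat, of 0 t x 0] t by simp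
  finally have "\<bar>\<Phi> t x\<bar> \<le> 2 * K * alpha_um S c t * K" by simp
  also have "\<dots> = 2 * K\<^sup>2 * alpha_um S c t" by (simp add: power2_eq_square)
  also have "\<dots> \<le> 2 * K\<^sup>2 * mix t" using rate[OF t] by (intro mult_left_mono) (auto simp: mix_def)
  finally show ?thesis .
qed

text \<open>The abstract expansion with rate \<open>1 / \<epsilon>\<close>, delay
  \<open>\<epsilon>\<^sup>2 * h\<close> and field bound \<open>N * K\<close>. The paths are
  arbitrary deterministic Borel functions: their regularity does not matter because the
  decorrelation comes from the time coordinate. Brownian paths are inserted only afterwards.\<close>

lemma along_paths_expansion:
  fixes X :: "'i \<Rightarrow> real \<Rightarrow> real" and I :: "'i set" and \<epsilon> h t :: real
  defines "f \<equiv> \<lambda>s a. \<Sum>i\<in>I. cp (s / \<epsilon>\<^sup>2) (X i s / \<epsilon>) a"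
  defines "N \<equiv> real (card I)"
  defines "G \<equiv> exp (2 * (1 / \<epsilon>) * (N * K) * (\<epsilon>\<^sup>2 * h))"
  assumes I: "finite I" "I \<noteq> {}" and X[measurable]: "\<And>i. X i \<in> borel_measurable borel"
    and pos: "0 < \<epsilon>" "0 \<le> h" "0 \<le> t"
  shows "\<bar>ln (LINT a|S. exp (1 / \<epsilon> * (LINT s:{0..t}|lborel. f s a))) -
      (1 / \<epsilon>)\<^sup>2 * (LINT s:{0..t}|lborel. (LINT r:{max 0 (s - \<epsilon>\<^sup>2 * h)..s}|lborel.
        (\<Sum>i\<in>I. \<Sum>j\<in>I. \<Phi> ((s - r) / \<epsilon>\<^sup>2) ((X i s - X j r) / \<epsilon>))))\<bar>
    \<le> (1 / \<epsilon> * (2 * (N * K) * mix h) * G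
        + (1 / \<epsilon>)\<^sup>2 * (\<epsilon>\<^sup>2 * h) * ((2 * (N * K)\<^sup>2 * mix h) * G + 3 * (N * K)\<^sup>2 * (G - 1))) * t"
proof -
  define \<eta> where "\<eta> = \<epsilon>\<^sup>2 * h"
  have \<eta>: "0 \<le> \<eta>" using pos by (simp add: \<eta>_def)
  have NK: "0 \<le> N * K" using K_nonneg by (simp add: N_def)
  have f_m[measurable]: "(\<lambda>(u, a). f u a) \<in> borel_measurable (borel \<Otimes>\<^sub>M S)"
    unfolding f_def by measurable
  have f_b: "\<bar>f u a\<bar> \<le> N * K" if "a \<in> space S" for u a
  proof -
    have "\<bar>f u a\<bar> \<le> (\<Sum>i\<in>I. \<bar>cp (u / \<epsilon>\<^sup>2) (X i u / \<epsilon>) a\<bar>)" unfolding f_def by (rule sum_abs)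
    also have "\<dots> \<le> (\<Sum>i\<in>I. K)" by (intro sum_mono cp_bound that)
    finally show ?thesis by (simp add: N_def)
  qed
  have f_mean: "(LINT a|S. f u a) = 0" for u
    unfolding f_def by (simp add: cp_mean)
  define F where "F s a = (LINT u:{0..s}|lborel. f u a)" for s a
  define Z where "Z s a = exp (1 / \<epsilon> * F s a)" for s a
  have fa: "(\<lambda>u. f u a) \<in> borel_measurable borel" if "a \<in> space S" for a using that by measurable
  have F_alt: "F s a = (LINT u|lborel. (if 0 \<le> u \<and> u \<le> s then 1 else 0) * f u a)" for s a
    unfolding F_def set_lebesgue_integral_def by (intro Bochner_Integration.integral_cong) (auto simp: indicator_def)
  have Fm[measurable]: "F s \<in> borel_measurable S" for s
    unfolding F_alt by measurable
  have Zm[measurable]: "Z s \<in> borel_measurable S" for s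
    unfolding Z_def by measurable
  have F_b: "\<bar>F s a\<bar> \<le> N * K * s" if "a \<in> space S" "0 \<le> s" for s a
    using set_integral_Icc_bound[OF fa[OF that(1)] f_b[OF that(1)] that(2)] by (simp add: F_def)
  have Z0: "Z 0 a = 1" if "a \<in> space S" for a using F_b[OF that, of 0] by (simp add: Z_def)
  have Z_nonneg: "0 \<le> (LINT a|S. Z T a)" for T by (simp add: Z_def)
  \<comment> \<open>The space-time points that the rescaled paths visit at the times in
    \<open>U\<close>; they index the subalgebras for past and present.\<close>
  define pts where "pts U = {(u / \<epsilon>\<^sup>2, X i u / \<epsilon>) | i u. i \<in> I \<and> u \<in> U}" for U
  have f_alg: "f u \<in> borel_measurable (field_alg (pts U))" if "u \<in> U" "0 \<le> u" for u U
  proof -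
    have "cp (u / \<epsilon>\<^sup>2) (X i u / \<epsilon>) \<in> borel_measurable (field_alg (pts U))" if "i \<in> I" for i
    proof -
      have "(u / \<epsilon>\<^sup>2, X i u / \<epsilon>) \<in> pts U" using that \<open>u \<in> U\<close> by (auto simp: pts_def)
      from measurable_field_alg[OF this] have "c (u / \<epsilon>\<^sup>2) (X i u / \<epsilon>) \<in> borel_measurable (field_alg (pts U))" by simp
      moreover have "cp (u / \<epsilon>\<^sup>2) (X i u / \<epsilon>) = c (u / \<epsilon>\<^sup>2) (X i u / \<epsilon>)" using \<open>0 \<le> u\<close> by (auto simp: cp_eq fun_eq_iff)
      ultimately show ?thesis by simp
    qed
    then show ?thesis unfolding f_def by (intro borel_measurable_sum)
  qed
  have mixZ: "\<bar>(LINT a|S. Z T a * Y a) - (LINT a|S. Z T a) * (LINT a|S. Y a)\<bar> \<le> 2 * M * mix h * (LINT a|S. Z T a)"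
    if T: "0 \<le> T" and U: "U \<subseteq> {T + \<eta>..}" "U \<noteq> {}" and Y: "Y \<in> borel_measurable (field_alg (pts U))"
      and YM: "\<And>a. a \<in> space S \<Longrightarrow> \<bar>Y a\<bar> \<le> M" for T U Y M
  proof -
    have U0: "u \<ge> 0" if "u \<in> U" for u using U that T \<eta> by force
    have A: "pts U \<subseteq> {0..} \<times> UNIV" "pts {0..T} \<subseteq> {0..} \<times> UNIV" "pts U \<noteq> {}" "pts {0..T} \<noteq> {}"
      using U0 U(2) I T by (auto simp: pts_def)
    \<comment> \<open>The time coordinates are already separated by
      \<open>\<eta> / \<epsilon>\<^sup>2 = h\<close>, whatever the positions of the paths.\<close>
    have dist: "h \<le> setdist (pts U) (pts {0..T})"
    proof (rule le_setdistI)
      fix p q assume "p \<in> pts U" "q \<in> pts {0..T}"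
      then obtain i j u v where p: "p = (u / \<epsilon>\<^sup>2, X i u / \<epsilon>)" "q = (v / \<epsilon>\<^sup>2, X j v / \<epsilon>)" "u \<in> U" "v \<le> T"
        by (auto simp: pts_def)
      have "h = \<eta> / \<epsilon>\<^sup>2" using pos by (simp add: \<eta>_def)
      also have "\<dots> \<le> (u - v) / \<epsilon>\<^sup>2" using U(1) p by (intro divide_right_mono) force+
      also have "\<dots> \<le> dist (fst p) (fst q)" using p by (simp add: dist_real_def diff_divide_distrib)
      also have "\<dots> \<le> dist p q" by (rule dist_fst_le)
      finally show "h \<le> dist p q" .
    qed (use A in auto)
    \<comment> \<open>The time integral is measurable for the past only up to a null set; the
      covariance inequality accepts such a version.\<close>
    obtain J where J: "J \<in> borel_measurable (field_alg (pts {0..T}))" "AE a in S. F T a = J a"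
      unfolding F_def
      by (rule integral_Icc_AE_subalgebra[OF f_m f_b subalgebra_field_alg[OF A(2)] f_alg T]) auto
    have "\<bar>(LINT a|S. Z T a * Y a) - (LINT a|S. Z T a) * (LINT a|S. Y a)\<bar> \<le> 2 * M * alpha_um S c h * (LINT a|S. Z T a)"
    proof (rule mixing_covariance[OF A dist Y YM])
      show "0 \<le> Z T a \<and> Z T a \<le> exp (1 / \<epsilon> * (N * K * T))" if "a \<in> space S" for a
        using F_b[OF that T] pos(1) by (auto simp: Z_def divide_right_mono)
      show "(\<lambda>a. exp (1 / \<epsilon> * J a)) \<in> borel_measurable (field_alg (pts {0..T}))" using J(1) by measurable
      show "AE a in S. Z T a = exp (1 / \<epsilon> * J a)" using J(2) by eventually_elim (simp add: Z_def)
    qed auto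
    also have "\<dots> \<le> 2 * M * mix h * (LINT a|S. Z T a)"
    proof -
      have "0 \<le> M" using YM not_empty by force
      then show ?thesis using rate[OF pos(2)] Z_nonneg by (intro mult_right_mono mult_left_mono) (auto simp: mix_def)
    qed
    finally show ?thesis .
  qed
  have ff: "(LINT a|S. f s a * f r a) = (\<Sum>i\<in>I. \<Sum>j\<in>I. \<Phi> ((s - r) / \<epsilon>\<^sup>2) ((X i s - X j r) / \<epsilon>))"
    if "0 \<le> r" "r \<le> s" for r s
  proof -
    have cc: "integrable S (\<lambda>a. cp s' y a * cp r' z a)" for s' r' y z
      by (rule integrable_bounded[where C="K * K"])
         (measurable, unfold abs_mult, intro mult_mono, use cp_bound K_nonneg in auto)
    have "(LINT a|S. f s a * f r a) = (\<Sum>i\<in>I. \<Sum>j\<in>I. (LINT a|S. cp (s / \<epsilon>\<^sup>2) (X i s / \<epsilon>) a * cp (r / \<epsilon>\<^sup>2) (X j r / \<epsilon>) a))"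
      unfolding f_def sum_product by (simp add: Bochner_Integration.integral_sum cc)
    also have "\<dots> = (\<Sum>i\<in>I. \<Sum>j\<in>I. \<Phi> ((s - r) / \<epsilon>\<^sup>2) ((X i s - X j r) / \<epsilon>))"
      using that pos by (intro sum.cong refl) (subst cp_cov, auto simp: divide_right_mono diff_divide_distrib)
    finally show ?thesis .
  qed
  have eq: "(LINT r:{max 0 (s - \<eta>)..s}|lborel. (LINT a|S. f s a * f r a))
     = (LINT r:{max 0 (s - \<eta>)..s}|lborel. (\<Sum>i\<in>I. \<Sum>j\<in>I. \<Phi> ((s - r) / \<epsilon>\<^sup>2) ((X i s - X j r) / \<epsilon>)))" for s
    unfolding set_lebesgue_integral_def by (intro Bochner_Integration.integral_cong refl) (auto simp: indicator_def ff)
  show ?thesis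
    unfolding \<eta>_def[symmetric] eq[symmetric] G_def
  proof (rule log_exponential_moment_expansion[OF f_m f_b])
    show "\<bar>LINT a|S. f s a * exp (1 / \<epsilon> * (LINT u:{0..max 0 (s - \<eta>)}|lborel. f u a))\<bar>
       \<le> (2 * (N * K) * mix h) * (LINT a|S. exp (1 / \<epsilon> * (LINT u:{0..max 0 (s - \<eta>)}|lborel. f u a)))" if "0 \<le> s" "s \<le> t" for s
    proof (cases "\<eta> \<le> s")
      case True
      then show ?thesis using mixZ[of "s - \<eta>" "{s}" "f s" "N * K"] f_alg[of s "{s}"] f_b f_mean that
        by (simp add: Z_def F_def mult.commute)
    next
      \<comment> \<open>The delayed time is clipped at 0, where the weight equals 1: the integral is
        the mean of \<open>f s\<close>, which vanishes.\<close>
      case False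
      then have m: "max 0 (s - \<eta>) = 0" by simp
      have "(LINT a|S. f s a * Z 0 a) = (LINT a|S. f s a)" "(LINT a|S. Z 0 a) = (LINT a|S. 1)"
        by (intro Bochner_Integration.integral_cong; simp add: Z0)+
      then show ?thesis unfolding F_def[symmetric] Z_def[symmetric] m
        using f_mean NK mix_nonneg[of h] by (simp add: prob_space)
    qed
    show "\<bar>(LINT a|S. f s a * f r a * exp (1 / \<epsilon> * (LINT u:{0..max 0 (r - \<eta>)}|lborel. f u a))) -
        (LINT a|S. f s a * f r a) * (LINT a|S. exp (1 / \<epsilon> * (LINT u:{0..max 0 (r - \<eta>)}|lborel. f u a)))\<bar>
       \<le> (2 * (N * K)\<^sup>2 * mix h) * (LINT a|S. exp (1 / \<epsilon> * (LINT u:{0..max 0 (r - \<eta>)}|lborel. f u a)))" 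
      if rs: "0 \<le> r" "r \<le> s" "s \<le> t" for r s
    proof (cases "\<eta> \<le> r")
      case True
      have Y: "(\<lambda>a. f s a * f r a) \<in> borel_measurable (field_alg (pts {r, s}))"
        using f_alg[of s "{r, s}"] f_alg[of r "{r, s}"] rs by (intro borel_measurable_times) auto
      have Yb: "\<bar>f s a * f r a\<bar> \<le> (N * K)\<^sup>2" if "a \<in> space S" for a
        unfolding abs_mult power2_eq_square using f_b[OF that] NK by (intro mult_mono) auto
      show ?thesis using mixZ[of "r - \<eta>" "{r, s}" "\<lambda>a. f s a * f r a" "(N * K)\<^sup>2"] True rs Y Yb
        by (simp add: Z_def F_def mult.commute)
    next
      case False
      then have m: "max 0 (r - \<eta>) = 0" by simp
      have "(LINT a|S. f s a * f r a * Z 0 a) = (LINT a|S. f s a * f r a)" "(LINT a|S. Z 0 a) = (LINT a|S. 1)"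
        by (intro Bochner_Integration.integral_cong; simp add: Z0)+
      then show ?thesis unfolding F_def[symmetric] Z_def[symmetric] m
        using mix_nonneg[of h] by (simp add: prob_space)
    qed
  qed (use pos \<eta> NK mix_nonneg[of h] in auto)
qed

end

subsection \<open>Brownian motion\<close>

locale brownian = prob_space \<Omega> for \<Omega> :: "'w measure" +
  fixes B :: "real \<Rightarrow> 'w \<Rightarrow> real"
  assumes bm: "standard_brownian_motion \<Omega> B"
begin

lemma B_measurable: "0 \<le> t \<Longrightarrow> B t \<in> borel_measurable \<Omega>"
  using bm by (simp add: standard_brownian_motion_def)

lemma B_0: "\<omega> \<in> space \<Omega> \<Longrightarrow> B 0 \<omega> = 0"
  using bm by (simp add: standard_brownian_motion_def)

text \<open>Stopping negative times at 0 gives paths that are continuous on the whole line, so that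
  joint measurability needs no restriction of the time axis.\<close>

definition BP :: "real \<Rightarrow> 'w \<Rightarrow> real" where "BP t \<omega> = B (max 0 t) \<omega>"

lemma BP_eq: "0 \<le> t \<Longrightarrow> BP t \<omega> = B t \<omega>"
  by (simp add: BP_def max_def)

lemma BP_measurable1[measurable]: "BP t \<in> borel_measurable \<Omega>"
  unfolding BP_def by (rule B_measurable) auto

lemma BP_continuous:
  assumes "\<omega> \<in> space \<Omega>" shows "continuous_on UNIV (\<lambda>t. BP t \<omega>)"
proof -
  have "continuous_on {0..} (\<lambda>t. B t \<omega>)" using bm assms by (simp add: standard_brownian_motion_def)
  then show ?thesis unfolding BP_def
    by (rule continuous_on_compose2) (auto intro: continuous_intros)
qed

text \<open>Path continuity allows t to be rounded down to a multiple of \<open>1 / (n + 1)\<close>.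
  Each rounded process involves countably many times only and is therefore jointly
  measurable.\<close>

lemma BP_measurable[measurable]: "(\<lambda>(t, \<omega>). BP t \<omega>) \<in> borel_measurable (borel \<Otimes>\<^sub>M \<Omega>)"
proof (rule borel_measurable_LIMSEQ_real)
  fix n :: nat
  have "(\<lambda>x. (\<lambda>k x. BP (real_of_int k / real (Suc n)) (snd x)) \<lfloor>real (Suc n) * fst x\<rfloor> x) \<in> borel_measurable (borel \<Otimes>\<^sub>M \<Omega>)"
    by (rule measurable_compose_countable) measurable
  then show "(\<lambda>x. BP (real_of_int \<lfloor>real (Suc n) * fst x\<rfloor> / real (Suc n)) (snd x)) \<in> borel_measurable (borel \<Otimes>\<^sub>M \<Omega>)" .
next
  fix x :: "real \<times> 'w" assume x: "x \<in> space (borel \<Otimes>\<^sub>M \<Omega>)"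
  obtain t \<omega> where x_eq: "x = (t, \<omega>)" "\<omega> \<in> space \<Omega>" using x by (cases x) (auto simp: space_pair_measure)
  have "(\<lambda>n. real_of_int \<lfloor>real (Suc n) * t\<rfloor> / real (Suc n)) \<longlonglongrightarrow> t"
  proof (rule real_tendsto_sandwich)
    show "\<forall>\<^sub>F n in sequentially. t - 1 / real (Suc n) \<le> real_of_int \<lfloor>real (Suc n) * t\<rfloor> / real (Suc n)"
    proof (intro always_eventually allI)
      fix n show "t - 1 / real (Suc n) \<le> real_of_int \<lfloor>real (Suc n) * t\<rfloor> / real (Suc n)"
      proof -
        have "t - 1 / real (Suc n) = (real (Suc n) * t - 1) / real (Suc n)" by (simp add: field_simps del: of_nat_Suc)
        also have "\<dots> \<le> real_of_int \<lfloor>real (Suc n) * t\<rfloor> / real (Suc n)"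
          using real_of_int_floor_add_one_ge[of "real (Suc n) * t"] by (intro divide_right_mono) linarith+
        finally show ?thesis .
      qed
    qed
    show "\<forall>\<^sub>F n in sequentially. real_of_int \<lfloor>real (Suc n) * t\<rfloor> / real (Suc n) \<le> t"
    proof (intro always_eventually allI)
      fix n show "real_of_int \<lfloor>real (Suc n) * t\<rfloor> / real (Suc n) \<le> t"
        using of_int_floor_le[of "real (Suc n) * t"] by (simp add: field_simps del: of_nat_Suc)
    qed
    have "(\<lambda>n. t - 1 / real (Suc n)) \<longlonglongrightarrow> t - 0"
      by (intro tendsto_diff tendsto_const) (use LIMSEQ_inverse_real_of_nat in \<open>simp add: inverse_eq_divide\<close>)
    then show "(\<lambda>n. t - 1 / real (Suc n)) \<longlonglongrightarrow> t" by simp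
  qed simp
  then have "(\<lambda>n. BP (real_of_int \<lfloor>real (Suc n) * t\<rfloor> / real (Suc n)) \<omega>) \<longlonglongrightarrow> BP t \<omega>"
    using BP_continuous[OF x_eq(2)] continuous_on_tendsto_compose[of UNIV "\<lambda>t. BP t \<omega>"] by auto
  then show "(\<lambda>n. BP (real_of_int \<lfloor>real (Suc n) * fst x\<rfloor> / real (Suc n)) (snd x)) \<longlonglongrightarrow> (case x of (t, \<omega>) \<Rightarrow> BP t \<omega>)"
    by (simp add: x_eq)
qed

lemma BP_measurable'[measurable (raw)]:
  assumes "f \<in> borel_measurable N" "g \<in> N \<rightarrow>\<^sub>M \<Omega>"
  shows "(\<lambda>x. BP (f x) (g x)) \<in> borel_measurable N"
proof -
  have "(\<lambda>x. (f x, g x)) \<in> N \<rightarrow>\<^sub>M (borel \<Otimes>\<^sub>M \<Omega>)" using assms by measurable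
  from measurable_compose[OF this BP_measurable] show ?thesis by simp
qed

lemma inc_distributed:
  assumes "0 \<le> r" "r < s"
  shows "distributed \<Omega> lborel (\<lambda>\<omega>. BP s \<omega> - BP r \<omega>) (normal_density 0 (sqrt (s - r)))"
  using bm assms by (auto simp: standard_brownian_motion_def BP_eq)

lemma BP_distributed:
  assumes "0 < s"
  shows "distributed \<Omega> lborel (BP s) (normal_density 0 (sqrt s))"
proof -
  have "distributed \<Omega> lborel (\<lambda>\<omega>. BP s \<omega> - BP 0 \<omega>) (normal_density 0 (sqrt (s - 0)))"
    by (rule inc_distributed) (use assms in auto)
  moreover have "BP 0 \<omega> = 0" if "\<omega> \<in> space \<Omega>" for \<omega> using B_0[OF that] by (simp add: BP_def)
  ultimately show ?thesis
    unfolding distributed_def by (auto cong: distr_cong)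
qed

text \<open>Both sides integrate \<open>\<psi>\<close> against the normal density of variance
  \<open>(s - r) / \<epsilon>\<^sup>2\<close>. The case \<open>r = s\<close> is treated apart
  because the degenerate law has no density.\<close>

lemma inc_scaling:
  assumes \<psi>[measurable]: "\<psi> \<in> borel_measurable borel" and "0 < \<epsilon>" "0 \<le> r" "r \<le> s"
  shows "(LINT \<omega>|\<Omega>. (\<psi> ((BP s \<omega> - BP r \<omega>) / \<epsilon>) :: real)) = (LINT \<omega>|\<Omega>. \<psi> (BP ((s - r) / \<epsilon>\<^sup>2) \<omega>))"
proof (cases "r = s")
  case True
  have "(LINT \<omega>|\<Omega>. \<psi> 0) = (LINT \<omega>|\<Omega>. \<psi> (BP 0 \<omega>))"
    by (rule Bochner_Integration.integral_cong) (auto simp: BP_def B_0)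
  then show ?thesis using True by simp
next
  case False
  then have "r < s" using assms by simp
  have "distributed \<Omega> lborel (\<lambda>\<omega>. 0 + (1 / \<epsilon>) * (BP s \<omega> - BP r \<omega>)) (normal_density (0 + (1 / \<epsilon>) * 0) (\<bar>1 / \<epsilon>\<bar> * sqrt (s - r)))"
    by (rule normal_density_affine[OF inc_distributed]) (use assms \<open>r < s\<close> in auto)
  moreover have "\<bar>1 / \<epsilon>\<bar> * sqrt (s - r) = sqrt ((s - r) / \<epsilon>\<^sup>2)" using assms by (simp add: real_sqrt_divide)
  ultimately have D: "distributed \<Omega> lborel (\<lambda>\<omega>. (BP s \<omega> - BP r \<omega>) / \<epsilon>) (normal_density 0 (sqrt ((s - r) / \<epsilon>\<^sup>2)))"
    by simp
  have D2: "distributed \<Omega> lborel (BP ((s - r) / \<epsilon>\<^sup>2)) (normal_density 0 (sqrt ((s - r) / \<epsilon>\<^sup>2)))"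
    by (rule BP_distributed) (use assms \<open>r < s\<close> in auto)
  show ?thesis
    using distributed_integral[OF D, of \<psi>] distributed_integral[OF D2, of \<psi>] by simp
qed

lemma inc_indep:
  assumes \<psi>: "\<psi> \<in> borel_measurable borel" "\<psi>' \<in> borel_measurable borel"
    and b: "\<And>x. \<bar>\<psi> x\<bar> \<le> C" "\<And>x. \<bar>\<psi>' x\<bar> \<le> C"
    and t: "0 \<le> r" "r \<le> s" "s \<le> r'" "r' \<le> s'"
  shows "(LINT \<omega>|\<Omega>. (\<psi> (BP s \<omega> - BP r \<omega>) * \<psi>' (BP s' \<omega> - BP r' \<omega>) :: real))
     = (LINT \<omega>|\<Omega>. \<psi> (BP s \<omega> - BP r \<omega>)) * (LINT \<omega>|\<Omega>. \<psi>' (BP s' \<omega> - BP r' \<omega>))"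
proof -
  \<comment> \<open>Four times give three increments; the middle one bridges the gap from s to r'
    and is dropped by restricting to the indices 0 and 2.\<close>
  define \<tau> :: "nat \<Rightarrow> real" where "\<tau> i = [r, s, r', s'] ! i" for i
  have "mono_on {..3} \<tau>"
  proof (rule mono_onI)
    fix i j :: nat assume "i \<in> {..3}" "j \<in> {..3}" "i \<le> j"
    then have "i = 0 \<or> i = 1 \<or> i = 2 \<or> i = 3" "j = 0 \<or> j = 1 \<or> j = 2 \<or> j = 3" by auto
    with \<open>i \<le> j\<close> show "\<tau> i \<le> \<tau> j" using t by (elim disjE) (auto simp: \<tau>_def numeral_2_eq_2 numeral_3_eq_3)
  qed
  then have iv: "indep_vars (\<lambda>_. borel) (\<lambda>i \<omega>. B (\<tau> (Suc i)) \<omega> - B (\<tau> i) \<omega>) {..<3}"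
  proof -
    have "0 \<le> \<tau> 0" using t by (simp add: \<tau>_def)
    with bm \<open>mono_on {..3} \<tau>\<close> show ?thesis unfolding standard_brownian_motion_def by blast
  qed
  define \<Psi> where "\<Psi> i = (if i = 0 then \<psi> else \<psi>')" for i :: nat
  have "indep_vars (\<lambda>_. borel) (\<lambda>i \<omega>. \<Psi> i (B (\<tau> (Suc i)) \<omega> - B (\<tau> i) \<omega>)) {0, 2}"
    by (rule indep_vars_compose2[OF indep_vars_subset[OF iv]]) (use \<psi> in \<open>auto simp: \<Psi>_def\<close>)
  then have "(LINT \<omega>|\<Omega>. (\<Prod>i\<in>{0, 2}. \<Psi> i (B (\<tau> (Suc i)) \<omega> - B (\<tau> i) \<omega>)))
     = (\<Prod>i\<in>{0, 2}. LINT \<omega>|\<Omega>. \<Psi> i (B (\<tau> (Suc i)) \<omega> - B (\<tau> i) \<omega>))"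
  proof (rule indep_vars_lebesgue_integral[rotated])
    fix i :: nat assume "i \<in> {0, 2}"
    have [measurable]: "\<Psi> i \<in> borel_measurable borel" "B (\<tau> (Suc i)) \<in> borel_measurable \<Omega>" "B (\<tau> i) \<in> borel_measurable \<Omega>"
      using \<psi> t \<open>i \<in> {0, 2}\<close> by (auto simp: \<Psi>_def \<tau>_def numeral_2_eq_2 intro!: B_measurable)
    show "integrable \<Omega> (\<lambda>\<omega>. \<Psi> i (B (\<tau> (Suc i)) \<omega> - B (\<tau> i) \<omega>))"
      by (rule integrable_bounded[where C=C]) (measurable, use b in \<open>auto simp: \<Psi>_def\<close>)
  qed auto
  then show ?thesis
    using t by (simp add: \<tau>_def \<Psi>_def BP_eq numeral_2_eq_2)
qed

text \<open>The Gaussian density is replaced by its maximum. This trades a Brownian expectation for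
  a Lebesgue integral, and is how both the spatial integrability of the covariance and the square
  integrability of the initial value are exploited.\<close>

lemma BP_density_bound:
  fixes \<psi> :: "real \<Rightarrow> ennreal"
  assumes [measurable]: "\<psi> \<in> borel_measurable borel" and s: "0 < s"
  shows "(\<integral>\<^sup>+\<omega>. \<psi> (BP s \<omega>) \<partial>\<Omega>) \<le> ennreal (1 / sqrt (2 * pi * s)) * (\<integral>\<^sup>+z. \<psi> z \<partial>lborel)"
proof -
  have "(\<integral>\<^sup>+\<omega>. \<psi> (BP s \<omega>) \<partial>\<Omega>) = (\<integral>\<^sup>+z. ennreal (normal_density 0 (sqrt s) z) * \<psi> z \<partial>lborel)"
    using distributed_nn_integral[OF BP_distributed[OF s], of \<psi>] by simp
  also have "\<dots> \<le> (\<integral>\<^sup>+z. ennreal (1 / sqrt (2 * pi * s)) * \<psi> z \<partial>lborel)"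
    using s by (intro nn_integral_mono mult_right_mono ennreal_leI) (auto simp: normal_density_def divide_right_mono)
  also have "\<dots> = ennreal (1 / sqrt (2 * pi * s)) * (\<integral>\<^sup>+z. \<psi> z \<partial>lborel)"
    by (rule nn_integral_cmult) simp
  finally show ?thesis .
qed

end

subsection \<open>Covariance along Brownian paths\<close>

locale random_environment =
  env?: decorrelating_field S c K C \<delta> + bm?: brownian \<Omega> B
  for S :: "'s measure" and c K C \<delta> and \<Omega> :: "'w measure" and B
begin

lemma cov_measurable'[measurable (raw)]:
  assumes "f \<in> borel_measurable N" "g \<in> borel_measurable N"
  shows "(\<lambda>x. \<Phi> (f x) (g x)) \<in> borel_measurable N"
proof -
  have "(\<lambda>x. (f x, g x)) \<in> N \<rightarrow>\<^sub>M (borel \<Otimes>\<^sub>M borel)" using assms by measurable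
  from measurable_compose[OF this cov_measurable] show ?thesis by simp
qed

lemma mix_le: "0 \<le> r \<Longrightarrow> mix r \<le> C"
proof -
  assume "0 \<le> r"
  with \<delta> have "(1 + r) powr (-(2 + \<delta>)) \<le> 1" using powr_mono[of "-(2 + \<delta>)" 0 "1 + r"] by simp
  then show ?thesis using C by (simp add: mix_def mult_left_le)
qed

text \<open>The exponent exceeds 2, so \<open>1 / (1 + r\<^sup>2)\<close> is a majorant up to the
  factor \<open>C\<close>.\<close>

lemma mix_integrable: "set_integrable lborel {0..} mix"
  unfolding set_integrable_def
proof (rule Bochner_Integration.integrable_bound)
  have "einterval (-\<infinity>) \<infinity> = UNIV" by (auto simp: einterval_def)
  then show "integrable lborel (\<lambda>r::real. C * inverse (1 + r\<^sup>2))"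
    using integrable_inverse_1_plus_square by (simp add: set_integrable_def)
  show "AE r in lborel. norm (indicat_real {0..} r *\<^sub>R mix r) \<le> norm (C * inverse (1 + r\<^sup>2))"
  proof (rule AE_I2)
    fix r :: real
    consider "r < 0" | "0 \<le> r" by linarith
    then show "norm (indicat_real {0..} r *\<^sub>R mix r) \<le> norm (C * inverse (1 + r\<^sup>2))"
    proof cases
      case 2
      have "(1 + r) powr (-(2 + \<delta>)) \<le> (1 + r) powr (-2)" using 2 \<delta> by (intro powr_mono) auto
      also have "\<dots> = inverse ((1 + r)\<^sup>2)" using 2 by (simp add: powr_minus)
      also have "\<dots> \<le> inverse (1 + r\<^sup>2)" using 2 by (intro le_imp_inverse_le) (auto simp: power2_eq_square algebra_simps add_pos_nonneg)
      finally show ?thesis using 2 C by (simp add: mix_def)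
    qed simp
  qed
qed simp

text \<open>By \<open>cov_bound\<close>, an upper bound per unit of time for the covariance
  accumulated along any pair of paths, and hence for the absolute value of
  \<open>\<Sigma>\<close>.\<close>

definition cov_mass :: real where "cov_mass = 2 * K\<^sup>2 * (LINT r:{0..}|lborel. mix r)"

lemma cov_mass_nonneg: "0 \<le> cov_mass"
  unfolding cov_mass_def set_lebesgue_integral_def
  by (intro mult_nonneg_nonneg Bochner_Integration.integral_nonneg) (auto simp: mix_nonneg)

definition mean_cov :: "real \<Rightarrow> real" where "mean_cov r = (LINT \<omega>|\<Omega>. \<Phi> r (BP r \<omega>))"

lemma mean_cov_measurable[measurable]: "mean_cov \<in> borel_measurable borel"
  unfolding mean_cov_def by measurable

lemma cov_integrable: "0 \<le> r \<Longrightarrow> X \<in> borel_measurable \<Omega> \<Longrightarrow> integrable \<Omega> (\<lambda>\<omega>. \<Phi> r (X \<omega>))"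
  by (rule bm.integrable_bounded[where C="2 * K\<^sup>2 * mix r"]) (auto simp: cov_bound)

lemma mean_cov_bound: assumes "0 \<le> r" shows "\<bar>mean_cov r\<bar> \<le> 2 * K\<^sup>2 * mix r"
proof -
  have "\<bar>mean_cov r\<bar> \<le> (LINT \<omega>|\<Omega>. \<bar>\<Phi> r (BP r \<omega>)\<bar>)" unfolding mean_cov_def by (rule integral_abs_bound)
  also have "\<dots> \<le> (LINT \<omega>|\<Omega>. 2 * K\<^sup>2 * mix r)"
    using assms by (intro integral_mono integrable_abs cov_integrable) (auto simp: cov_bound)
  finally show ?thesis by (simp add: bm.prob_space)
qed

lemma mean_cov_integrable: "set_integrable lborel {0..} mean_cov"
  by (rule set_integrable_bound[OF set_integrable_mult_right[where a="2 * K\<^sup>2", OF mix_integrable]])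
     (use mean_cov_bound mix_nonneg in \<open>auto simp: set_borel_measurable_def abs_mult\<close>)

definition \<Sigma> :: real where "\<Sigma> = (LINT r:{0..}|lborel. mean_cov r)"

lemma mix_integral_le: "2 * K\<^sup>2 * (LINT \<rho>:{0..R}|lborel. mix \<rho>) \<le> cov_mass"
  unfolding cov_mass_def
proof (intro mult_left_mono)
  show "(LINT \<rho>:{0..R}|lborel. mix \<rho>) \<le> (LINT r:{0..}|lborel. mix r)"
    unfolding set_lebesgue_integral_def
  proof (rule integral_mono)
    show "integrable lborel (\<lambda>x. indicat_real {0..R} x *\<^sub>R mix x)"
      using set_integrable_subset[OF mix_integrable, of "{0..R}"] by (auto simp: set_integrable_def)
    show "integrable lborel (\<lambda>x. indicat_real {0..} x *\<^sub>R mix x)" 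
      using mix_integrable by (simp add: set_integrable_def)
  qed (auto simp: indicator_def mix_nonneg)
qed simp

lemma \<Sigma>_bound: "\<bar>\<Sigma>\<bar> \<le> cov_mass"
proof -
  have "\<bar>\<Sigma>\<bar> \<le> (LINT r:{0..}|lborel. \<bar>mean_cov r\<bar>)" unfolding \<Sigma>_def
    using set_integral_norm_bound[OF mean_cov_integrable] by simp
  also have "\<dots> \<le> (LINT r:{0..}|lborel. 2 * K\<^sup>2 * mix r)"
    by (rule set_integral_mono) (use mean_cov_integrable mean_cov_bound mix_integrable in \<open>auto intro!: set_integrable_mult_right set_integrable_abs\<close>)
  finally show ?thesis by (simp add: cov_mass_def)
qed

lemma time_substitution:
  fixes \<psi> :: "real \<Rightarrow> real"
  assumes "0 < \<epsilon>"
  shows "(1 / \<epsilon>)\<^sup>2 * (LINT r:{s0..s}|lborel. \<psi> ((s - r) / \<epsilon>\<^sup>2)) = (LINT \<rho>:{0..(s - s0) / \<epsilon>\<^sup>2}|lborel. \<psi> \<rho>)"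
proof -
  have "(LINT r:{s0..s}|lborel. \<psi> ((s - r) / \<epsilon>\<^sup>2))
    = \<bar>- \<epsilon>\<^sup>2\<bar> *\<^sub>R (LINT \<rho>|lborel. indicator {s0..s} (s + - \<epsilon>\<^sup>2 * \<rho>) *\<^sub>R \<psi> ((s - (s + - \<epsilon>\<^sup>2 * \<rho>)) / \<epsilon>\<^sup>2))"
    unfolding set_lebesgue_integral_def by (rule lborel_integral_real_affine) (use assms in simp)
  also have "(\<lambda>\<rho>. indicat_real {s0..s} (s + - \<epsilon>\<^sup>2 * \<rho>) *\<^sub>R \<psi> ((s - (s + - \<epsilon>\<^sup>2 * \<rho>)) / \<epsilon>\<^sup>2))
     = (\<lambda>\<rho>. indicator {0..(s - s0) / \<epsilon>\<^sup>2} \<rho> *\<^sub>R \<psi> \<rho>)"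
    using assms by (auto simp: fun_eq_iff indicator_def field_simps zero_le_mult_iff)
  finally show ?thesis using assms by (simp add: set_lebesgue_integral_def power_divide)
qed

text \<open>The substitution \<rho> = (s - r) / \<epsilon>^2 absorbs the prefactor, so the bound
  does not depend on \<epsilon>, on the length of the window or on the path.\<close>

lemma inner_bound:
  assumes F[measurable]: "F \<in> borel_measurable borel" and e: "0 < \<epsilon>"
    and b: "\<And>r. r \<in> {s0..s} \<Longrightarrow> \<bar>F r\<bar> \<le> 2 * K\<^sup>2 * mix ((s - r) / \<epsilon>\<^sup>2)"
  shows "\<bar>(1 / \<epsilon>)\<^sup>2 * (LINT r:{s0..s}|lborel. F r)\<bar> \<le> cov_mass"
proof -
  have mi: "set_integrable lborel {s0..s} (\<lambda>r. 2 * K\<^sup>2 * mix ((s - r) / \<epsilon>\<^sup>2))"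
  proof (rule set_integrable_bounded_Icc[where K="2 * K\<^sup>2 * C"])
    show "\<bar>2 * K\<^sup>2 * mix ((s - r) / \<epsilon>\<^sup>2)\<bar> \<le> 2 * K\<^sup>2 * C" if "r \<in> {s0..s}" for r
      using that by (auto simp: abs_mult mix_nonneg intro!: mult_left_mono mix_le)
  qed measurable
  have Fi: "set_integrable lborel {s0..s} F"
  proof (rule set_integrable_bounded_Icc[where K="2 * K\<^sup>2 * C"])
    show "\<bar>F r\<bar> \<le> 2 * K\<^sup>2 * C" if "r \<in> {s0..s}" for r
      using that mult_left_mono[OF mix_le[of "(s - r) / \<epsilon>\<^sup>2"], of "2 * K\<^sup>2"] by (intro order_trans[OF b]) auto
  qed measurable
  have "\<bar>LINT r:{s0..s}|lborel. F r\<bar> \<le> (LINT r:{s0..s}|lborel. \<bar>F r\<bar>)"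
    using set_integral_norm_bound[OF Fi] by simp
  also have "\<dots> \<le> (LINT r:{s0..s}|lborel. 2 * K\<^sup>2 * mix ((s - r) / \<epsilon>\<^sup>2))"
    by (rule set_integral_mono) (use Fi mi b in \<open>auto intro!: set_integrable_abs\<close>)
  finally have "\<bar>(1 / \<epsilon>)\<^sup>2 * (LINT r:{s0..s}|lborel. F r)\<bar> \<le> (1 / \<epsilon>)\<^sup>2 * (LINT r:{s0..s}|lborel. 2 * K\<^sup>2 * mix ((s - r) / \<epsilon>\<^sup>2))"
    unfolding abs_mult by (intro mult_mono) auto
  also have "\<dots> = 2 * K\<^sup>2 * (LINT \<rho>:{0..(s - s0) / \<epsilon>\<^sup>2}|lborel. mix \<rho>)"
    using time_substitution[OF e, of s0 s "\<lambda>\<rho>. 2 * K\<^sup>2 * mix \<rho>"] by simp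
  also have "\<dots> \<le> cov_mass" by (rule mix_integral_le)
  finally show ?thesis .
qed

section \<open>Integrated covariances and their fluctuations along one path\<close>

definition V_inner :: "real \<Rightarrow> real \<Rightarrow> real \<Rightarrow> 'w \<Rightarrow> 'w \<Rightarrow> real" where
  "V_inner \<epsilon> h s \<omega> \<omega>' = (1 / \<epsilon>)\<^sup>2 *
    (LINT r:{max 0 (s - \<epsilon>\<^sup>2 * h)..s}|lborel. \<Phi> ((s - r) / \<epsilon>\<^sup>2) ((BP s \<omega> - BP r \<omega>') / \<epsilon>))"

text \<open>The integrated covariance of the field along \<open>\<omega>\<close> with the field along \<open>\<omega>'\<close>, over time
  lags between \<open>0\<close> and \<open>\<epsilon>\<^sup>2 h\<close>.\<close>

definition V :: "real \<Rightarrow> real \<Rightarrow> real \<Rightarrow> 'w \<Rightarrow> 'w \<Rightarrow> real" where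
  "V \<epsilon> h t \<omega> \<omega>' = (LINT s:{0..t}|lborel. V_inner \<epsilon> h s \<omega> \<omega>')"

lemma V_inner_alt: "V_inner \<epsilon> h s \<omega> \<omega>' = (1 / \<epsilon>)\<^sup>2 *
    (LINT r|lborel. (if max 0 (s - \<epsilon>\<^sup>2 * h) \<le> r \<and> r \<le> s then 1 else 0) * \<Phi> ((s - r) / \<epsilon>\<^sup>2) ((BP s \<omega> - BP r \<omega>') / \<epsilon>))"
  unfolding V_inner_def set_lebesgue_integral_def
  by (intro arg_cong2[where f="(*)"] Bochner_Integration.integral_cong refl) (auto simp: indicator_def)

lemma V_inner_measurable[measurable]:
  "(\<lambda>(s, \<omega>, \<omega>'). V_inner \<epsilon> h s \<omega> \<omega>') \<in> borel_measurable (borel \<Otimes>\<^sub>M \<Omega> \<Otimes>\<^sub>M \<Omega>)"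
  unfolding V_inner_alt by measurable

lemma V_inner_measurable'[measurable (raw)]:
  assumes "f \<in> borel_measurable N" "g \<in> N \<rightarrow>\<^sub>M \<Omega>" "g' \<in> N \<rightarrow>\<^sub>M \<Omega>"
  shows "(\<lambda>x. V_inner \<epsilon> h (f x) (g x) (g' x)) \<in> borel_measurable N"
proof -
  have "(\<lambda>x. (f x, g x, g' x)) \<in> N \<rightarrow>\<^sub>M (borel \<Otimes>\<^sub>M \<Omega> \<Otimes>\<^sub>M \<Omega>)" using assms by measurable
  from measurable_compose[OF this V_inner_measurable] show ?thesis by simp
qed

lemma V_measurable[measurable]: "(\<lambda>(\<omega>, \<omega>'). V \<epsilon> h t \<omega> \<omega>') \<in> borel_measurable (\<Omega> \<Otimes>\<^sub>M \<Omega>)"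
  unfolding V_def set_lebesgue_integral_def by measurable

lemma V_measurable1[measurable]: "(\<lambda>\<omega>. V \<epsilon> h t \<omega> \<omega>) \<in> borel_measurable \<Omega>"
  unfolding V_def set_lebesgue_integral_def by measurable

lemma V_inner_bound:
  assumes "0 < \<epsilon>" "\<omega> \<in> space \<Omega>" "\<omega>' \<in> space \<Omega>"
  shows "\<bar>V_inner \<epsilon> h s \<omega> \<omega>'\<bar> \<le> cov_mass"
  unfolding V_inner_def
  by (rule inner_bound) (use assms in \<open>auto intro!: cov_bound\<close>)

lemma V_bound:
  assumes "0 < \<epsilon>" "0 \<le> t" "\<omega> \<in> space \<Omega>" "\<omega>' \<in> space \<Omega>"
  shows "\<bar>V \<epsilon> h t \<omega> \<omega>'\<bar> \<le> cov_mass * t"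
proof -
  have "(\<lambda>s. V_inner \<epsilon> h s \<omega> \<omega>') \<in> borel_measurable borel" using assms by measurable
  then show ?thesis
    using set_integral_Icc_bound[of "\<lambda>s. V_inner \<epsilon> h s \<omega> \<omega>'" 0 t cov_mass] V_inner_bound assms by (simp add: V_def)
qed

text \<open>For positive \<epsilon> this is the mean of \<open>V_inner\<close> along a single path,
  written after Brownian scaling and the time substitution. The upper limit equals \<open>h\<close>
  once \<open>\<epsilon>\<^sup>2 * h \<le> s\<close>, and \<epsilon> then no longer appears.\<close>

definition V_inner_mean :: "real \<Rightarrow> real \<Rightarrow> real \<Rightarrow> real" where
  "V_inner_mean \<epsilon> h s = (LINT \<rho>:{0..(s - max 0 (s - \<epsilon>\<^sup>2 * h)) / \<epsilon>\<^sup>2}|lborel. mean_cov \<rho>)"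

lemma V_inner_mean_eq: "0 < \<epsilon> \<Longrightarrow> V_inner_mean \<epsilon> h s = (1 / \<epsilon>)\<^sup>2 * (LINT r:{max 0 (s - \<epsilon>\<^sup>2 * h)..s}|lborel. mean_cov ((s - r) / \<epsilon>\<^sup>2))"
  unfolding V_inner_mean_def by (rule time_substitution[symmetric])

lemma V_inner_mean_measurable[measurable]: "V_inner_mean \<epsilon> h \<in> borel_measurable borel"
proof -
  have "V_inner_mean \<epsilon> h s = (LINT \<rho>|lborel. (if 0 \<le> \<rho> \<and> \<rho> \<le> (s - max 0 (s - \<epsilon>\<^sup>2 * h)) / \<epsilon>\<^sup>2 then 1 else 0) * mean_cov \<rho>)" for s
    unfolding V_inner_mean_def set_lebesgue_integral_def
    by (intro Bochner_Integration.integral_cong refl) (auto simp: indicator_def)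
  then have "V_inner_mean \<epsilon> h = (\<lambda>s. LINT \<rho>|lborel. (if 0 \<le> \<rho> \<and> \<rho> \<le> (s - max 0 (s - \<epsilon>\<^sup>2 * h)) / \<epsilon>\<^sup>2 then 1 else 0) * mean_cov \<rho>)" by auto
  then show ?thesis by simp
qed

lemma V_inner_mean_bound: "0 < \<epsilon> \<Longrightarrow> \<bar>V_inner_mean \<epsilon> h s\<bar> \<le> cov_mass"
  by (subst V_inner_mean_eq) (auto intro!: inner_bound mean_cov_bound)

definition V_inner_dev :: "real \<Rightarrow> real \<Rightarrow> real \<Rightarrow> 'w \<Rightarrow> real" where
  "V_inner_dev \<epsilon> h s \<omega> = V_inner \<epsilon> h s \<omega> \<omega> - V_inner_mean \<epsilon> h s"

lemma V_inner_dev_measurable[measurable]: "(\<lambda>(s, \<omega>). V_inner_dev \<epsilon> h s \<omega>) \<in> borel_measurable (borel \<Otimes>\<^sub>M \<Omega>)"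
  unfolding V_inner_dev_def by measurable

lemma V_inner_dev_bound: "0 < \<epsilon> \<Longrightarrow> \<omega> \<in> space \<Omega> \<Longrightarrow> \<bar>V_inner_dev \<epsilon> h s \<omega>\<bar> \<le> 2 * cov_mass"
  using V_inner_bound[of \<epsilon> \<omega> \<omega> h s] V_inner_mean_bound[of \<epsilon> h s] by (simp add: V_inner_dev_def)

definition cov_dev :: "real \<Rightarrow> real \<Rightarrow> real \<Rightarrow> 'w \<Rightarrow> real" where
  "cov_dev \<epsilon> s r \<omega> = \<Phi> ((s - r) / \<epsilon>\<^sup>2) ((BP s \<omega> - BP r \<omega>) / \<epsilon>) - mean_cov ((s - r) / \<epsilon>\<^sup>2)"

lemma cov_dev_measurable[measurable (raw)]:
  assumes "f \<in> borel_measurable N" "f' \<in> borel_measurable N" "g \<in> N \<rightarrow>\<^sub>M \<Omega>"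
  shows "(\<lambda>x. cov_dev \<epsilon> (f x) (f' x) (g x)) \<in> borel_measurable N"
  using assms unfolding cov_dev_def by measurable

lemma cov_dev_bound: "0 < \<epsilon> \<Longrightarrow> r \<le> s \<Longrightarrow> \<bar>cov_dev \<epsilon> s r \<omega>\<bar> \<le> 4 * K\<^sup>2 * C"
proof -
  assume e: "0 < \<epsilon>" "r \<le> s"
  have "2 * K\<^sup>2 * mix ((s - r) / \<epsilon>\<^sup>2) \<le> 2 * K\<^sup>2 * C" using e by (intro mult_left_mono mix_le) auto
  then show ?thesis
    using cov_bound[of "(s - r) / \<epsilon>\<^sup>2" "(BP s \<omega> - BP r \<omega>) / \<epsilon>"] mean_cov_bound[of "(s - r) / \<epsilon>\<^sup>2"] e
    by (simp add: cov_dev_def)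
qed

lemma V_inner_dev_eq:
  assumes "0 < \<epsilon>" "\<omega> \<in> space \<Omega>"
  shows "V_inner_dev \<epsilon> h s \<omega> = (1 / \<epsilon>)\<^sup>2 * (LINT r:{max 0 (s - \<epsilon>\<^sup>2 * h)..s}|lborel. cov_dev \<epsilon> s r \<omega>)"
proof -
  have b: "2 * K\<^sup>2 * mix ((s - r) / \<epsilon>\<^sup>2) \<le> 2 * K\<^sup>2 * C" if "r \<le> s" for r 
    using assms that by (intro mult_left_mono mix_le) auto
  have "(\<lambda>r. \<Phi> ((s - r) / \<epsilon>\<^sup>2) ((BP s \<omega> - BP r \<omega>) / \<epsilon>)) \<in> borel_measurable borel" using assms by measurable
  then have 1: "set_integrable lborel {max 0 (s - \<epsilon>\<^sup>2 * h)..s} (\<lambda>r. \<Phi> ((s - r) / \<epsilon>\<^sup>2) ((BP s \<omega> - BP r \<omega>) / \<epsilon>))"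
    by (rule set_integrable_bounded_Icc[where K="2 * K\<^sup>2 * C"]) (use assms in \<open>auto intro!: order_trans[OF cov_bound b]\<close>)
  have 2: "set_integrable lborel {max 0 (s - \<epsilon>\<^sup>2 * h)..s} (\<lambda>r. mean_cov ((s - r) / \<epsilon>\<^sup>2))"
    by (rule set_integrable_bounded_Icc[where K="2 * K\<^sup>2 * C"]) (use assms in \<open>auto intro!: order_trans[OF mean_cov_bound b]\<close>)
  show ?thesis
    unfolding V_inner_dev_def V_inner_mean_eq[OF assms(1)] V_inner_def cov_dev_def
    by (subst set_integral_diff(2)[OF 1 2]) (simp add: right_diff_distrib)
qed

text \<open>Increments over successive intervals are independent, so the expectation factors; the
  first factor has mean zero by \<open>inc_scaling\<close>.\<close>

lemma cov_dev_uncorrelated: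
  assumes "0 < \<epsilon>" "0 \<le> r" "r \<le> s" "s \<le> r'" "r' \<le> s'"
  shows "(LINT \<omega>|\<Omega>. cov_dev \<epsilon> s r \<omega> * cov_dev \<epsilon> s' r' \<omega>) = 0"
proof -
  define \<psi> where "\<psi> \<rho> z = \<Phi> \<rho> (z / \<epsilon>) - mean_cov \<rho>" for \<rho> z
  have [measurable]: "\<psi> \<rho> \<in> borel_measurable borel" for \<rho> unfolding \<psi>_def by measurable
  have b: "\<bar>\<psi> \<rho> z\<bar> \<le> 4 * K\<^sup>2 * C" if "0 \<le> \<rho>" for \<rho> z
  proof -
    have "2 * K\<^sup>2 * mix \<rho> \<le> 2 * K\<^sup>2 * C" using that by (intro mult_left_mono mix_le) auto
    then show ?thesis using cov_bound[OF that, of "z / \<epsilon>"] mean_cov_bound[OF that] by (simp add: \<psi>_def)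
  qed
  have "(LINT \<omega>|\<Omega>. cov_dev \<epsilon> s r \<omega> * cov_dev \<epsilon> s' r' \<omega>)
    = (LINT \<omega>|\<Omega>. \<psi> ((s - r) / \<epsilon>\<^sup>2) (BP s \<omega> - BP r \<omega>) * \<psi> ((s' - r') / \<epsilon>\<^sup>2) (BP s' \<omega> - BP r' \<omega>))"
    by (simp add: cov_dev_def \<psi>_def)
  also have "\<dots> = (LINT \<omega>|\<Omega>. \<psi> ((s - r) / \<epsilon>\<^sup>2) (BP s \<omega> - BP r \<omega>)) * (LINT \<omega>|\<Omega>. \<psi> ((s' - r') / \<epsilon>\<^sup>2) (BP s' \<omega> - BP r' \<omega>))"
    by (rule inc_indep[where C="4 * K\<^sup>2 * C"]) (use assms b in auto)
  also have "(LINT \<omega>|\<Omega>. \<psi> ((s - r) / \<epsilon>\<^sup>2) (BP s \<omega> - BP r \<omega>)) = 0"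
  proof -
    have "integrable \<Omega> (\<lambda>\<omega>. \<Phi> ((s - r) / \<epsilon>\<^sup>2) ((BP s \<omega> - BP r \<omega>) / \<epsilon>))"
      by (rule cov_integrable) (use assms in auto)
    moreover have "(LINT \<omega>|\<Omega>. \<Phi> ((s - r) / \<epsilon>\<^sup>2) ((BP s \<omega> - BP r \<omega>) / \<epsilon>)) = mean_cov ((s - r) / \<epsilon>\<^sup>2)"
      unfolding mean_cov_def using assms by (subst inc_scaling) auto
    ultimately show ?thesis by (simp add: \<psi>_def bm.prob_space)
  qed
  finally show ?thesis by simp
qed

text \<open>The deviation at s depends on increments inside the window of length
  \<open>\<epsilon>\<^sup>2 * h\<close> that ends at s. At this separation the two windows do not
  overlap, and applying Fubini in each window reduces the claim to single increments.\<close>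

lemma V_inner_dev_uncorrelated:
  assumes e: "0 < \<epsilon>" and s: "0 \<le> s" "s \<le> s' - \<epsilon>\<^sup>2 * h"
  shows "(LINT \<omega>|\<Omega>. V_inner_dev \<epsilon> h s \<omega> * V_inner_dev \<epsilon> h s' \<omega>) = 0"
proof -
  define a where "a = max 0 (s - \<epsilon>\<^sup>2 * h)"
  define a' where "a' = max 0 (s' - \<epsilon>\<^sup>2 * h)"
  have a': "s \<le> a'" using s by (simp add: a'_def)
  have K4: "0 \<le> 4 * K\<^sup>2 * C" using C by simp
  have WW: "(LINT \<omega>|\<Omega>. cov_dev \<epsilon> s r \<omega> * V_inner_dev \<epsilon> h s' \<omega>) = 0" if r: "r \<in> {a..s}" for r
  proof -
    have "(LINT \<omega>|\<Omega>. cov_dev \<epsilon> s r \<omega> * V_inner_dev \<epsilon> h s' \<omega>) = (LINT \<omega>|\<Omega>. (1 / \<epsilon>)\<^sup>2 * (LINT r':{a'..s'}|lborel. cov_dev \<epsilon> s r \<omega> * cov_dev \<epsilon> s' r' \<omega>))"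
      by (intro Bochner_Integration.integral_cong refl) (simp add: V_inner_dev_eq[OF e] a'_def)
    also have "\<dots> = (1 / \<epsilon>)\<^sup>2 * (LINT r':{a'..s'}|lborel. LINT \<omega>|\<Omega>. cov_dev \<epsilon> s r \<omega> * cov_dev \<epsilon> s' r' \<omega>)"
      unfolding integral_mult_right_zero
      by (subst bm.Fubini_Icc[where G="\<lambda>_. (4 * K\<^sup>2 * C) * (4 * K\<^sup>2 * C)"])
         (measurable, use r cov_dev_bound[OF e] K4 in \<open>auto simp only: abs_mult intro!: mult_mono\<close>, auto)
    also have "(LINT r':{a'..s'}|lborel. LINT \<omega>|\<Omega>. cov_dev \<epsilon> s r \<omega> * cov_dev \<epsilon> s' r' \<omega>) = 0"
      unfolding set_lebesgue_integral_def
      by (rule Bochner_Integration.integral_eq_zero_AE) (use r e a' in \<open>auto simp: indicator_def a_def intro!: cov_dev_uncorrelated\<close>)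
    finally show ?thesis by simp
  qed
  have "(LINT \<omega>|\<Omega>. V_inner_dev \<epsilon> h s \<omega> * V_inner_dev \<epsilon> h s' \<omega>) = (LINT \<omega>|\<Omega>. (1 / \<epsilon>)\<^sup>2 * (LINT r:{a..s}|lborel. cov_dev \<epsilon> s r \<omega> * V_inner_dev \<epsilon> h s' \<omega>))"
    by (intro Bochner_Integration.integral_cong refl) (simp add: V_inner_dev_eq[OF e, of _ h s] a_def)
  also have "\<dots> = (1 / \<epsilon>)\<^sup>2 * (LINT r:{a..s}|lborel. LINT \<omega>|\<Omega>. cov_dev \<epsilon> s r \<omega> * V_inner_dev \<epsilon> h s' \<omega>)"
    unfolding integral_mult_right_zero
    by (subst bm.Fubini_Icc[where G="\<lambda>_. (4 * K\<^sup>2 * C) * (2 * cov_mass)"])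
       (measurable, use cov_dev_bound[OF e] V_inner_dev_bound[OF e] K4 in \<open>auto simp only: abs_mult intro!: mult_mono\<close>, auto)
  also have "(LINT r:{a..s}|lborel. LINT \<omega>|\<Omega>. cov_dev \<epsilon> s r \<omega> * V_inner_dev \<epsilon> h s' \<omega>) = 0"
    unfolding set_lebesgue_integral_def
    by (rule Bochner_Integration.integral_eq_zero_AE) (use WW in \<open>auto simp: indicator_def\<close>)
  finally show ?thesis by simp
qed

text \<open>The correlation \<open>R s s'\<close> is at most \<open>4 * cov_mass\<^sup>2\<close> and
  vanishes outside the band of width \<open>2 * \<eta>\<close> around the diagonal; integrating over
  the band gives the constant 8.\<close>

lemma variance_bound:
  assumes e: "0 < \<epsilon>" and h: "0 \<le> h" and t: "0 \<le> t"
  shows "(LINT \<omega>|\<Omega>. (LINT s:{0..t}|lborel. V_inner_dev \<epsilon> h s \<omega>)\<^sup>2) \<le> 8 * cov_mass\<^sup>2 * (\<epsilon>\<^sup>2 * h) * t"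
proof -
  define \<eta> where "\<eta> = \<epsilon>\<^sup>2 * h"
  have \<eta>: "0 \<le> \<eta>" using h by (simp add: \<eta>_def)
  define R where "R s s' = (LINT \<omega>|\<Omega>. V_inner_dev \<epsilon> h s \<omega> * V_inner_dev \<epsilon> h s' \<omega>)" for s s'
  have Dm: "(\<lambda>s. V_inner_dev \<epsilon> h s \<omega>) \<in> borel_measurable borel" if "\<omega> \<in> space \<Omega>" for \<omega> using that by measurable
  have ID_b: "\<bar>LINT s:{0..t}|lborel. V_inner_dev \<epsilon> h s \<omega>\<bar> \<le> 2 * cov_mass * t" if "\<omega> \<in> space \<Omega>" for \<omega>
    using set_integral_Icc_bound[OF Dm[OF that], of 0 t "2 * cov_mass"] V_inner_dev_bound[OF e that] t by simp
  have [measurable]: "(\<lambda>\<omega>. LINT s:{0..t}|lborel. V_inner_dev \<epsilon> h s \<omega>) \<in> borel_measurable \<Omega>"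
    unfolding set_lebesgue_integral_def by measurable
  have [measurable]: "(\<lambda>(s, s'). R s s') \<in> borel_measurable (borel \<Otimes>\<^sub>M borel)"
    unfolding R_def by measurable
  have DD: "\<bar>V_inner_dev \<epsilon> h s \<omega> * V_inner_dev \<epsilon> h s' \<omega>\<bar> \<le> 2 * cov_mass * (2 * cov_mass)" if "\<omega> \<in> space \<Omega>" for s s' \<omega>
    unfolding abs_mult using V_inner_dev_bound[OF e that] cov_mass_nonneg by (intro mult_mono) auto
  have R_b: "\<bar>R s s'\<bar> \<le> 4 * cov_mass\<^sup>2" for s s'
  proof -
    have "\<bar>R s s'\<bar> \<le> (LINT \<omega>|\<Omega>. \<bar>V_inner_dev \<epsilon> h s \<omega> * V_inner_dev \<epsilon> h s' \<omega>\<bar>)" unfolding R_def by (rule integral_abs_bound)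
    also have "\<dots> \<le> (LINT \<omega>|\<Omega>. 2 * cov_mass * (2 * cov_mass))"
      by (intro integral_mono integrable_abs bm.integrable_bounded[where C="2 * cov_mass * (2 * cov_mass)"]) (use DD in auto)
    finally show ?thesis by (simp add: bm.prob_space power2_eq_square)
  qed
  have R_0: "R s s' = 0" if "0 \<le> s" "0 \<le> s'" "\<eta> \<le> \<bar>s - s'\<bar>" for s s'
  proof (cases "s \<le> s'")
    case True then show ?thesis using V_inner_dev_uncorrelated[OF e, of s s' h] that by (simp add: R_def \<eta>_def)
  next
    case False then show ?thesis using V_inner_dev_uncorrelated[OF e, of s' s h] that by (simp add: R_def \<eta>_def mult.commute)
  qed
  have IR: "\<bar>LINT s':{0..t}|lborel. R s s'\<bar> \<le> 8 * cov_mass\<^sup>2 * \<eta>" if s: "s \<in> {0..t}" for s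
  proof -
    have "\<bar>LINT s':{0..t}|lborel. R s s'\<bar> \<le> (LINT s':{0..t}|lborel. \<bar>R s s'\<bar>)"
      using set_integral_norm_bound[OF set_integrable_bounded_Icc[of "R s" 0 t "4 * cov_mass\<^sup>2"]] R_b by simp
    also have "\<dots> \<le> (LINT s':{s - \<eta>..s + \<eta>}|lborel. 4 * cov_mass\<^sup>2)"
      unfolding set_lebesgue_integral_def
    proof (rule integral_mono)
      show "integrable lborel (\<lambda>x. indicat_real {0..t} x *\<^sub>R \<bar>R s x\<bar>)"
        using set_integrable_bounded_Icc[of "\<lambda>x. \<bar>R s x\<bar>" 0 t "4 * cov_mass\<^sup>2"] R_b by (simp add: set_integrable_def)
      show "integrable lborel (\<lambda>x. indicat_real {s - \<eta>..s + \<eta>} x *\<^sub>R (4 * cov_mass\<^sup>2))"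
        using set_integrable_bounded_Icc[of "\<lambda>x. 4 * cov_mass\<^sup>2" "s - \<eta>" "s + \<eta>" "4 * cov_mass\<^sup>2"] by (simp add: set_integrable_def)
      show "indicat_real {0..t} x *\<^sub>R \<bar>R s x\<bar> \<le> indicat_real {s - \<eta>..s + \<eta>} x *\<^sub>R (4 * cov_mass\<^sup>2)" for x
        using R_0[of s x] R_b[of s x] s by (auto simp: indicator_def)
    qed
    also have "\<dots> = 8 * cov_mass\<^sup>2 * \<eta>" using \<eta> by (simp add: set_lebesgue_integral_def)
    finally show ?thesis .
  qed
  define I where "I \<omega> = (LINT s:{0..t}|lborel. V_inner_dev \<epsilon> h s \<omega>)" for \<omega>
  have [measurable]: "I \<in> borel_measurable \<Omega>" unfolding I_def set_lebesgue_integral_def by measurable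
  \<comment> \<open>The square is opened one factor at a time, so that exchanging a single time
    integral with the expectation is enough at each stage.\<close>
  have "(LINT \<omega>|\<Omega>. (I \<omega>)\<^sup>2) = (LINT \<omega>|\<Omega>. (LINT s:{0..t}|lborel. V_inner_dev \<epsilon> h s \<omega> * I \<omega>))"
    by (simp add: power2_eq_square I_def)
  also have "\<dots> = (LINT s:{0..t}|lborel. LINT \<omega>|\<Omega>. V_inner_dev \<epsilon> h s \<omega> * I \<omega>)"
  proof (rule bm.Fubini_Icc)
    show "(\<lambda>(s, \<omega>). V_inner_dev \<epsilon> h s \<omega> * I \<omega>) \<in> borel_measurable (borel \<Otimes>\<^sub>M \<Omega>)" by measurable
    show "\<bar>V_inner_dev \<epsilon> h s \<omega> * I \<omega>\<bar> \<le> 2 * cov_mass * (2 * cov_mass * t)" if "\<omega> \<in> space \<Omega>" for s \<omega>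
      unfolding abs_mult using ID_b[OF that] V_inner_dev_bound[OF e that] cov_mass_nonneg by (intro mult_mono) (auto simp: I_def)
  qed simp
  also have "\<dots> = (LINT s:{0..t}|lborel. LINT \<omega>|\<Omega>. (LINT s':{0..t}|lborel. V_inner_dev \<epsilon> h s \<omega> * V_inner_dev \<epsilon> h s' \<omega>))"
    by (simp add: I_def)
  also have "\<dots> = (LINT s:{0..t}|lborel. (LINT s':{0..t}|lborel. R s s'))"
    unfolding R_def
    by (subst bm.Fubini_Icc[where G="\<lambda>_. 2 * cov_mass * (2 * cov_mass)"]) (use DD in auto)
  also have "\<dots> \<le> 8 * cov_mass\<^sup>2 * \<eta> * (t - 0)"
  proof -
    have "(\<lambda>s. LINT s':{0..t}|lborel. R s s') \<in> borel_measurable borel"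
      unfolding set_lebesgue_integral_def by measurable
    from set_integral_Icc_bound[OF this IR t] show ?thesis by simp
  qed
  finally show ?thesis by (simp add: \<eta>_def I_def)
qed

definition mean_cov_tail :: "real \<Rightarrow> real" where "mean_cov_tail R = \<bar>(LINT \<rho>:{0..R}|lborel. mean_cov \<rho>) - \<Sigma>\<bar>"

lemma mean_cov_tail_tendsto: "(mean_cov_tail \<longlongrightarrow> 0) at_top"
proof -
  have "integrable lborel (\<lambda>r. indicator {0..} r *\<^sub>R mean_cov r)" using mean_cov_integrable by (simp add: set_integrable_def)
  then have "((\<lambda>y. LINT x|lborel. indicator {.. y} x *\<^sub>R (indicator {0..} x *\<^sub>R mean_cov x)) \<longlongrightarrow> \<Sigma>) at_top"
    unfolding \<Sigma>_def set_lebesgue_integral_def by (intro tendsto_integral_at_top) auto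
  moreover have "(LINT x|lborel. indicator {.. y} x *\<^sub>R (indicator {0..} x *\<^sub>R mean_cov x)) = (LINT \<rho>:{0..y}|lborel. mean_cov \<rho>)" for y
    unfolding set_lebesgue_integral_def by (intro Bochner_Integration.integral_cong refl) (auto simp: indicator_def)
  ultimately have "((\<lambda>y. LINT \<rho>:{0..y}|lborel. mean_cov \<rho>) \<longlongrightarrow> \<Sigma>) at_top" by simp
  from tendsto_rabs_zero[OF this[THEN LIM_zero]] show ?thesis by (simp add: mean_cov_tail_def[abs_def])
qed

text \<open>For s beyond \<open>\<epsilon>\<^sup>2 * h\<close> the window is complete and the error
  is exactly the tail of the integral defining \<open>\<Sigma>\<close>. The initial layer is short,
  and the crude bound \<open>2 * cov_mass\<close> suffices there.\<close>

lemma V_inner_mean_integral: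
  assumes e: "0 < \<epsilon>" and h: "0 \<le> h" and t: "0 \<le> t"
  shows "\<bar>(LINT s:{0..t}|lborel. V_inner_mean \<epsilon> h s) - t * \<Sigma>\<bar> \<le> 2 * cov_mass * (\<epsilon>\<^sup>2 * h) + mean_cov_tail h * t"
proof -
  define \<eta> where "\<eta> = \<epsilon>\<^sup>2 * h"
  have \<eta>: "0 \<le> \<eta>" using h by (simp add: \<eta>_def)
  have b: "\<bar>V_inner_mean \<epsilon> h s - \<Sigma>\<bar> \<le> 2 * cov_mass" for s using V_inner_mean_bound[OF e, of h s] \<Sigma>_bound by simp
  have tl: "\<bar>V_inner_mean \<epsilon> h s - \<Sigma>\<bar> = mean_cov_tail h" if "\<eta> \<le> s" for s
  proof -
    have "(s - max 0 (s - \<epsilon>\<^sup>2 * h)) / \<epsilon>\<^sup>2 = h" using e that by (simp add: \<eta>_def)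
    then show ?thesis by (simp only: V_inner_mean_def mean_cov_tail_def)
  qed
  have Ti: "set_integrable lborel {0..t} (V_inner_mean \<epsilon> h)" by (rule set_integrable_bounded_Icc[where K=cov_mass]) (use V_inner_mean_bound[OF e] in auto)
  have ci: "set_integrable lborel {0..u} (\<lambda>_. k::real)" for k and u :: real by (rule set_integrable_bounded_Icc[where K="\<bar>k\<bar>"]) auto
  have Di: "set_integrable lborel {0..t} (\<lambda>s. \<bar>V_inner_mean \<epsilon> h s - \<Sigma>\<bar>)" 
    by (rule set_integrable_bounded_Icc[where K="2 * cov_mass"]) (use b in auto)
  have eq: "(LINT s:{0..t}|lborel. V_inner_mean \<epsilon> h s) - t * \<Sigma> = (LINT s:{0..t}|lborel. V_inner_mean \<epsilon> h s - \<Sigma>)"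
    by (subst set_integral_diff(2)[OF Ti ci]) (use t in \<open>simp add: set_lebesgue_integral_def\<close>)
  have "\<bar>(LINT s:{0..t}|lborel. V_inner_mean \<epsilon> h s) - t * \<Sigma>\<bar> \<le> (LINT s:{0..t}|lborel. \<bar>V_inner_mean \<epsilon> h s - \<Sigma>\<bar>)"
    unfolding eq using set_integral_norm_bound[OF set_integral_diff(1)[OF Ti ci]] by simp
  also have "\<dots> \<le> (LINT s|lborel. indicator {0..\<eta>} s *\<^sub>R (2 * cov_mass) + indicator {0..t} s *\<^sub>R mean_cov_tail h)"
    unfolding set_lebesgue_integral_def
  proof (rule integral_mono)
    show "integrable lborel (\<lambda>s. indicator {0..\<eta>} s *\<^sub>R (2 * cov_mass) + indicator {0..t} s *\<^sub>R mean_cov_tail h)"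
      using ci[of \<eta> "2 * cov_mass"] ci[of t "mean_cov_tail h"] by (simp add: set_integrable_def)
    show "integrable lborel (\<lambda>x. indicat_real {0..t} x *\<^sub>R \<bar>V_inner_mean \<epsilon> h x - \<Sigma>\<bar>)" using Di by (simp add: set_integrable_def)
    fix s :: real
    have "0 \<le> mean_cov_tail h" by (simp add: mean_cov_tail_def)
    then show "indicat_real {0..t} s *\<^sub>R \<bar>V_inner_mean \<epsilon> h s - \<Sigma>\<bar> \<le> indicator {0..\<eta>} s *\<^sub>R (2 * cov_mass) + indicator {0..t} s *\<^sub>R mean_cov_tail h"
      using b[of s] tl[of s] cov_mass_nonneg by (auto simp: indicator_def)
  qed
  also have "\<dots> = 2 * cov_mass * \<eta> + mean_cov_tail h * t"
    using ci[of \<eta> "2 * cov_mass"] ci[of t "mean_cov_tail h"] \<eta> t by (simp add: set_integrable_def)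
  finally show ?thesis by (simp add: \<eta>_def)
qed

lemma V_L2_bound:
  assumes e: "0 < \<epsilon>" and h: "0 \<le> h" and t: "0 \<le> t"
  shows "(LINT \<omega>|\<Omega>. (V \<epsilon> h t \<omega> \<omega> - t * \<Sigma>)\<^sup>2)
    \<le> 16 * cov_mass\<^sup>2 * (\<epsilon>\<^sup>2 * h) * t + 2 * (2 * cov_mass * (\<epsilon>\<^sup>2 * h) + mean_cov_tail h * t)\<^sup>2"
proof -
  define b where "b = 2 * cov_mass * (\<epsilon>\<^sup>2 * h) + mean_cov_tail h * t"
  have Dm: "(\<lambda>s. V_inner_dev \<epsilon> h s \<omega>) \<in> borel_measurable borel" if "\<omega> \<in> space \<Omega>" for \<omega> using that by measurable
  define I where "I \<omega> = (LINT s:{0..t}|lborel. V_inner_dev \<epsilon> h s \<omega>)" for \<omega>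
  have [measurable]: "I \<in> borel_measurable \<Omega>" unfolding I_def set_lebesgue_integral_def by measurable
  have I_b: "\<bar>I \<omega>\<bar> \<le> 2 * cov_mass * t" if "\<omega> \<in> space \<Omega>" for \<omega>
    using set_integral_Icc_bound[OF Dm[OF that], of 0 t "2 * cov_mass"] V_inner_dev_bound[OF e that] t by (simp add: I_def)
  have I2: "integrable \<Omega> (\<lambda>\<omega>. (I \<omega>)\<^sup>2)"
    by (rule bm.integrable_bounded[where C="(2 * cov_mass * t)\<^sup>2"]) (auto simp: abs_le_square_iff[symmetric] intro: order_trans[OF I_b abs_ge_self])
  have pw: "(V \<epsilon> h t \<omega> \<omega> - t * \<Sigma>)\<^sup>2 \<le> 2 * (I \<omega>)\<^sup>2 + 2 * b\<^sup>2" if \<omega>: "\<omega> \<in> space \<Omega>" for \<omega>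
  proof -
    have "set_integrable lborel {0..t} (\<lambda>s. V_inner_dev \<epsilon> h s \<omega>)" 
      by (rule set_integrable_bounded_Icc[where K="2 * cov_mass"]) (use Dm[OF \<omega>] V_inner_dev_bound[OF e \<omega>] in auto)
    moreover have "set_integrable lborel {0..t} (V_inner_mean \<epsilon> h)" by (rule set_integrable_bounded_Icc[where K=cov_mass]) (use V_inner_mean_bound[OF e] in auto)
    ultimately have "(LINT s:{0..t}|lborel. V_inner_dev \<epsilon> h s \<omega> + V_inner_mean \<epsilon> h s) = I \<omega> + (LINT s:{0..t}|lborel. V_inner_mean \<epsilon> h s)"
      by (simp add: set_integral_add(2) I_def)
    then have "V \<epsilon> h t \<omega> \<omega> = I \<omega> + (LINT s:{0..t}|lborel. V_inner_mean \<epsilon> h s)" by (simp add: V_inner_dev_def V_def)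
    then have "V \<epsilon> h t \<omega> \<omega> - t * \<Sigma> = I \<omega> + ((LINT s:{0..t}|lborel. V_inner_mean \<epsilon> h s) - t * \<Sigma>)" (is "_ = _ + ?d") by simp
    moreover have "?d\<^sup>2 \<le> b\<^sup>2" using V_inner_mean_integral[OF e h t] by (intro abs_le_square_iff[THEN iffD1]) (simp add: b_def)
    moreover have "(x + y)\<^sup>2 \<le> 2 * x\<^sup>2 + 2 * y\<^sup>2" for x y :: real
      using sum_squares_bound[of x y] by (simp add: power2_eq_square algebra_simps)
    ultimately show ?thesis by (smt (verit))
  qed
  have "(LINT \<omega>|\<Omega>. (V \<epsilon> h t \<omega> \<omega> - t * \<Sigma>)\<^sup>2) \<le> (LINT \<omega>|\<Omega>. 2 * (I \<omega>)\<^sup>2 + 2 * b\<^sup>2)"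
  proof (rule integral_mono)
    show "integrable \<Omega> (\<lambda>\<omega>. (V \<epsilon> h t \<omega> \<omega> - t * \<Sigma>)\<^sup>2)"
    proof (rule Bochner_Integration.integrable_bound)
      show "integrable \<Omega> (\<lambda>\<omega>. 2 * (I \<omega>)\<^sup>2 + 2 * b\<^sup>2)" using I2 by simp
    qed (measurable, rule AE_I2, use pw in auto)
  qed (use I2 pw in auto)
  also have "\<dots> = 2 * (LINT \<omega>|\<Omega>. (I \<omega>)\<^sup>2) + 2 * b\<^sup>2" using I2 by (simp add: bm.prob_space)
  also have "\<dots> \<le> 16 * cov_mass\<^sup>2 * (\<epsilon>\<^sup>2 * h) * t + 2 * b\<^sup>2"
    using variance_bound[OF e h t] unfolding I_def by linarith
  finally show ?thesis by (simp add: b_def)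
qed

end

section \<open>The cross term of two independent paths\<close>

lemma ennreal_abs_integral_le:
  fixes f :: "'a \<Rightarrow> real"
  shows "ennreal \<bar>LINT x|M. f x\<bar> \<le> (\<integral>\<^sup>+x. ennreal \<bar>f x\<bar> \<partial>M)"
proof (cases "integrable M f")
  case True
  then show ?thesis using integral_norm_bound_ennreal[OF True] by simp
\<comment> \<open>The integral of a function that is not integrable is 0 by convention, so the
  inequality holds without hypotheses.\<close>
qed (simp add: not_integrable_integral_eq)

context random_environment
begin

definition cov_L1 :: real where
  "cov_L1 = (LINT p|(lborel \<Otimes>\<^sub>M lborel). \<bar>case p of (t, x) \<Rightarrow> \<Phi> t x\<bar>)"

lemma cov_L1_nonneg: "0 \<le> cov_L1"
  unfolding cov_L1_def by (rule Bochner_Integration.integral_nonneg) auto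

text \<open>Averaging over the first path at time s replaces the spatial profile of the covariance
  by its integral, at the price \<open>\<epsilon> / sqrt s\<close>. The integral over time lags then
  yields the full norm \<open>cov_L1\<close>, and the singularity at \<open>s = 0\<close> integrates
  to \<open>2 * sqrt t\<close>. Working with nonnegative integrals makes every exchange of integrals
  available from measurability alone.\<close>

lemma cross_term_nn:
  assumes e: "0 < \<epsilon>" and t: "0 \<le> t"
  shows "(\<integral>\<^sup>+p. ennreal \<bar>V \<epsilon> h t (fst p) (snd p)\<bar> \<partial>(\<Omega> \<Otimes>\<^sub>M \<Omega>))
    \<le> ennreal (\<epsilon> * cov_L1 * (2 * sqrt t))"
proof -
  interpret P: pair_sigma_finite \<Omega> \<Omega> ..
  interpret PP: prob_space "\<Omega> \<Otimes>\<^sub>M \<Omega>" by (intro prob_space_pair bm.prob_space_axioms)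
  interpret PL: pair_sigma_finite lborel "\<Omega> \<Otimes>\<^sub>M \<Omega>" ..
  define \<psi> where "\<psi> \<rho> = (\<integral>\<^sup>+z. ennreal \<bar>\<Phi> \<rho> z\<bar> \<partial>lborel)" for \<rho>
  have [measurable]: "\<psi> \<in> borel_measurable borel" unfolding \<psi>_def by measurable
  have cov_L1: "(\<integral>\<^sup>+\<rho>. \<psi> \<rho> \<partial>lborel) = ennreal cov_L1"
  proof -
    have "(\<integral>\<^sup>+\<rho>. \<psi> \<rho> \<partial>lborel) = (\<integral>\<^sup>+p. ennreal \<bar>case p of (t, x) \<Rightarrow> \<Phi> t x\<bar> \<partial>(lborel \<Otimes>\<^sub>M lborel))"
      unfolding \<psi>_def by (subst lborel.nn_integral_fst[symmetric]) (auto simp: split_beta')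
    also have "\<dots> = ennreal cov_L1" unfolding cov_L1_def
      using integrable_abs[OF cov_int] by (intro nn_integral_eq_integral) (auto simp: split_beta')
    finally show ?thesis .
  qed
  note J0 = cov_L1_nonneg
  define Q where "Q s r p = ennreal \<bar>\<Phi> ((s - r) / \<epsilon>\<^sup>2) ((BP s (fst p) - BP r (snd p)) / \<epsilon>)\<bar>" for s r and p :: "'w \<times> 'w"
  have Q_m[measurable]: "(\<lambda>x. Q (f x) (g x) (k x)) \<in> borel_measurable N"
    if "f \<in> borel_measurable N" "g \<in> borel_measurable N" "k \<in> N \<rightarrow>\<^sub>M \<Omega> \<Otimes>\<^sub>M \<Omega>" for f g k and N :: "'x measure"
    using that unfolding Q_def by measurable
  have Q_le: "(\<integral>\<^sup>+p. Q s r p \<partial>(\<Omega> \<Otimes>\<^sub>M \<Omega>)) \<le> ennreal (1 / sqrt s) * (ennreal \<epsilon> * \<psi> ((s - r) / \<epsilon>\<^sup>2))" if s: "0 < s" for s r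
  proof -
    have "(\<integral>\<^sup>+p. Q s r p \<partial>(\<Omega> \<Otimes>\<^sub>M \<Omega>)) = (\<integral>\<^sup>+\<omega>'. (\<integral>\<^sup>+\<omega>. Q s r (\<omega>, \<omega>') \<partial>\<Omega>) \<partial>\<Omega>)"
      by (rule P.nn_integral_snd[symmetric]) measurable
    also have "\<dots> \<le> (\<integral>\<^sup>+\<omega>'. ennreal (1 / sqrt s) * (ennreal \<epsilon> * \<psi> ((s - r) / \<epsilon>\<^sup>2)) \<partial>\<Omega>)"
    proof (rule nn_integral_mono)
      fix \<omega>' assume "\<omega>' \<in> space \<Omega>"
      \<comment> \<open>With the second path fixed, only the density of the first one at time s
        matters. The change of variable in space contributes the factor \<epsilon>.\<close>
      define y where "y = BP r \<omega>'"
      define F where "F z = ennreal \<bar>\<Phi> ((s - r) / \<epsilon>\<^sup>2) ((z - y) / \<epsilon>)\<bar>" for z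
      have [measurable]: "F \<in> borel_measurable borel" unfolding F_def by measurable
      have "(\<integral>\<^sup>+\<omega>. Q s r (\<omega>, \<omega>') \<partial>\<Omega>) = (\<integral>\<^sup>+\<omega>. F (BP s \<omega>) \<partial>\<Omega>)" by (simp add: Q_def F_def y_def)
      also have "\<dots> \<le> ennreal (1 / sqrt (2 * pi * s)) * (\<integral>\<^sup>+z. F z \<partial>lborel)"
        by (rule BP_density_bound) (use s in auto)
      also have "(\<integral>\<^sup>+z. F z \<partial>lborel) = ennreal \<bar>\<epsilon>\<bar> * (\<integral>\<^sup>+z. F (y + \<epsilon> * z) \<partial>lborel)"
        by (rule nn_integral_real_affine) (use e in auto)
      also have "\<dots> = ennreal \<epsilon> * \<psi> ((s - r) / \<epsilon>\<^sup>2)" using e by (simp add: F_def \<psi>_def)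
      also have "ennreal (1 / sqrt (2 * pi * s)) * \<dots> \<le> ennreal (1 / sqrt s) * \<dots>"
      proof (intro mult_right_mono ennreal_leI)
        have "1 * s \<le> 2 * pi * s" using s pi_gt3 by (intro mult_right_mono) auto
        then show "1 / sqrt (2 * pi * s) \<le> 1 / sqrt s" using s by (intro divide_left_mono) auto
      qed auto
      finally show "(\<integral>\<^sup>+\<omega>. Q s r (\<omega>, \<omega>') \<partial>\<Omega>) \<le> ennreal (1 / sqrt s) * (ennreal \<epsilon> * \<psi> ((s - r) / \<epsilon>\<^sup>2))" .
    qed
    also have "\<dots> = ennreal (1 / sqrt s) * (ennreal \<epsilon> * \<psi> ((s - r) / \<epsilon>\<^sup>2))" by (simp add: bm.emeasure_space_1)
    finally show ?thesis .
  qed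
  have sub: "(\<integral>\<^sup>+r. \<psi> ((s - r) / \<epsilon>\<^sup>2) \<partial>lborel) = ennreal (\<epsilon>\<^sup>2) * ennreal cov_L1" for s
  proof -
    have "(\<integral>\<^sup>+r. \<psi> ((s - r) / \<epsilon>\<^sup>2) \<partial>lborel) = ennreal \<bar>- (\<epsilon>\<^sup>2)\<bar> * (\<integral>\<^sup>+\<rho>. \<psi> ((s - (s + - (\<epsilon>\<^sup>2) * \<rho>)) / \<epsilon>\<^sup>2) \<partial>lborel)"
      by (rule nn_integral_real_affine) (use e in auto)
    also have "(\<lambda>\<rho>. \<psi> ((s - (s + - (\<epsilon>\<^sup>2) * \<rho>)) / \<epsilon>\<^sup>2)) = \<psi>" using e by auto
    finally show ?thesis by (simp add: cov_L1)
  qed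
  \<comment> \<open>The delay window is dropped: with absolute values the lag may run over the whole
    line. Lags of both signs then occur, matching the norm of the covariance on the plane.\<close>
  have V_le: "ennreal \<bar>V \<epsilon> h t (fst p) (snd p)\<bar> \<le> (\<integral>\<^sup>+s. indicator {0..t} s * (\<integral>\<^sup>+r. ennreal ((1 / \<epsilon>)\<^sup>2) * Q s r p \<partial>lborel) \<partial>lborel)" if p: "p \<in> space (\<Omega> \<Otimes>\<^sub>M \<Omega>)" for p
  proof -
    have inner: "ennreal \<bar>V_inner \<epsilon> h s (fst p) (snd p)\<bar> \<le> (\<integral>\<^sup>+r. ennreal ((1 / \<epsilon>)\<^sup>2) * Q s r p \<partial>lborel)" for s
    proof -
      have "ennreal \<bar>V_inner \<epsilon> h s (fst p) (snd p)\<bar> = ennreal ((1 / \<epsilon>)\<^sup>2) *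
          ennreal \<bar>LINT r:{max 0 (s - \<epsilon>\<^sup>2 * h)..s}|lborel. \<Phi> ((s - r) / \<epsilon>\<^sup>2) ((BP s (fst p) - BP r (snd p)) / \<epsilon>)\<bar>"
        unfolding V_inner_def by (subst ennreal_mult[symmetric]) (auto simp: abs_mult)
      also have "\<dots> \<le> ennreal ((1 / \<epsilon>)\<^sup>2) * (\<integral>\<^sup>+r. Q s r p \<partial>lborel)"
        unfolding set_lebesgue_integral_def
        by (intro mult_left_mono order_trans[OF ennreal_abs_integral_le] nn_integral_mono) (auto simp: Q_def indicator_def)
      also have "\<dots> = (\<integral>\<^sup>+r. ennreal ((1 / \<epsilon>)\<^sup>2) * Q s r p \<partial>lborel)"
        using p by (intro nn_integral_cmult[symmetric]) measurable
      finally show ?thesis .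
    qed
    have "ennreal \<bar>V \<epsilon> h t (fst p) (snd p)\<bar> \<le> (\<integral>\<^sup>+s. ennreal \<bar>indicat_real {0..t} s *\<^sub>R V_inner \<epsilon> h s (fst p) (snd p)\<bar> \<partial>lborel)"
      unfolding V_def set_lebesgue_integral_def by (rule ennreal_abs_integral_le)
    also have "\<dots> \<le> (\<integral>\<^sup>+s. indicator {0..t} s * (\<integral>\<^sup>+r. ennreal ((1 / \<epsilon>)\<^sup>2) * Q s r p \<partial>lborel) \<partial>lborel)"
      by (intro nn_integral_mono) (use inner in \<open>auto simp: indicator_def\<close>)
    finally show ?thesis .
  qed
  have "(\<integral>\<^sup>+p. ennreal \<bar>V \<epsilon> h t (fst p) (snd p)\<bar> \<partial>(\<Omega> \<Otimes>\<^sub>M \<Omega>))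
     \<le> (\<integral>\<^sup>+p. (\<integral>\<^sup>+s. indicator {0..t} s * (\<integral>\<^sup>+r. ennreal ((1 / \<epsilon>)\<^sup>2) * Q s r p \<partial>lborel) \<partial>lborel) \<partial>(\<Omega> \<Otimes>\<^sub>M \<Omega>))"
    by (rule nn_integral_mono) (rule V_le)
  also have "\<dots> = (\<integral>\<^sup>+s. (\<integral>\<^sup>+p. indicator {0..t} s * (\<integral>\<^sup>+r. ennreal ((1 / \<epsilon>)\<^sup>2) * Q s r p \<partial>lborel) \<partial>(\<Omega> \<Otimes>\<^sub>M \<Omega>)) \<partial>lborel)"
    by (rule PL.Fubini') measurable
  also have "\<dots> \<le> (\<integral>\<^sup>+s. ennreal (s powr (-1/2)) * indicator {0..t} s * (ennreal \<epsilon> * ennreal cov_L1) \<partial>lborel)"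
  proof (rule nn_integral_mono_AE)
    \<comment> \<open>At \<open>s = 0\<close> the path has no density; this single time is
      negligible.\<close>
    have "AE s in lborel. s \<noteq> (0::real)" by (rule AE_lborel_singleton)
    then show "AE s in lborel. (\<integral>\<^sup>+p. indicator {0..t} s * (\<integral>\<^sup>+r. ennreal ((1 / \<epsilon>)\<^sup>2) * Q s r p \<partial>lborel) \<partial>(\<Omega> \<Otimes>\<^sub>M \<Omega>))
       \<le> ennreal (s powr (-1/2)) * indicator {0..t} s * (ennreal \<epsilon> * ennreal cov_L1)"
    proof eventually_elim
      case (elim s)
      show ?case
      proof (cases "s \<in> {0..t}")
        case True
        then have s: "0 < s" using elim by auto
        have "(\<integral>\<^sup>+p. (\<integral>\<^sup>+r. ennreal ((1 / \<epsilon>)\<^sup>2) * Q s r p \<partial>lborel) \<partial>(\<Omega> \<Otimes>\<^sub>M \<Omega>))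
          = (\<integral>\<^sup>+r. (\<integral>\<^sup>+p. ennreal ((1 / \<epsilon>)\<^sup>2) * Q s r p \<partial>(\<Omega> \<Otimes>\<^sub>M \<Omega>)) \<partial>lborel)"
          by (rule PL.Fubini') measurable
        also have "\<dots> = (\<integral>\<^sup>+r. ennreal ((1 / \<epsilon>)\<^sup>2) * (\<integral>\<^sup>+p. Q s r p \<partial>(\<Omega> \<Otimes>\<^sub>M \<Omega>)) \<partial>lborel)"
          by (intro nn_integral_cong nn_integral_cmult) measurable
        also have "\<dots> \<le> (\<integral>\<^sup>+r. ennreal ((1 / \<epsilon>)\<^sup>2) * (ennreal (1 / sqrt s) * (ennreal \<epsilon> * \<psi> ((s - r) / \<epsilon>\<^sup>2))) \<partial>lborel)"
          by (intro nn_integral_mono mult_left_mono Q_le s) auto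
        also have "\<dots> = ennreal ((1 / \<epsilon>)\<^sup>2) * (ennreal (1 / sqrt s) * (ennreal \<epsilon> * (ennreal (\<epsilon>\<^sup>2) * ennreal cov_L1)))"
          by (simp add: nn_integral_cmult sub)
        also have "\<dots> = ennreal (1 / sqrt s * (\<epsilon> * cov_L1))"
          using e s J0 by (simp add: ennreal_mult[symmetric] power2_eq_square)
        also have "\<dots> = ennreal (s powr (-1/2)) * (ennreal \<epsilon> * ennreal cov_L1)"
          using e s J0 by (simp add: ennreal_mult[symmetric] powr_minus powr_half_sqrt inverse_eq_divide)
        finally show ?thesis using True by simp
      qed simp
    qed
  qed
  also have "\<dots> = (\<integral>\<^sup>+s. ennreal (s powr (-1/2)) * indicator {0..t} s \<partial>lborel) * (ennreal \<epsilon> * ennreal cov_L1)"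
    by (rule nn_integral_multc) measurable
  also have "(\<integral>\<^sup>+s. ennreal (s powr (-1/2)) * indicator {0..t} s \<partial>lborel) = ennreal (t powr (-1/2+1) / (-1/2+1))"
    by (rule nn_integral_has_integral_lebesgue'[OF _ has_integral_powr_from_0]) (use t in auto)
  also have "t powr (-1/2+1) / (-1/2+1) = 2 * sqrt t" using t by (simp add: powr_half_sqrt)
  also have "ennreal (2 * sqrt t) * (ennreal \<epsilon> * ennreal cov_L1) = ennreal (\<epsilon> * cov_L1 * (2 * sqrt t))"
    using e t J0 by (simp add: ennreal_mult[symmetric] mult_ac)
  finally show ?thesis by (simp add: cov_L1_def)
qed

lemma cross_term_bound:
  assumes e: "0 < \<epsilon>" and t: "0 \<le> t"
  shows "(LINT p|(\<Omega> \<Otimes>\<^sub>M \<Omega>). \<bar>V \<epsilon> h t (fst p) (snd p)\<bar>)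
    \<le> \<epsilon> * cov_L1 * (2 * sqrt t)"
proof -
  interpret P: prob_space "\<Omega> \<Otimes>\<^sub>M \<Omega>" by (intro prob_space_pair bm.prob_space_axioms)
  have "integrable (\<Omega> \<Otimes>\<^sub>M \<Omega>) (\<lambda>p. \<bar>V \<epsilon> h t (fst p) (snd p)\<bar>)"
  proof (rule P.integrable_bounded[where C="cov_mass * t"])
    show "(\<lambda>p. \<bar>V \<epsilon> h t (fst p) (snd p)\<bar>) \<in> borel_measurable (\<Omega> \<Otimes>\<^sub>M \<Omega>)"
      using V_measurable[of \<epsilon> h t] by (simp add: split_beta')
  qed (use V_bound[OF e t] in \<open>auto simp: space_pair_measure\<close>)
  from nn_integral_eq_integral[OF this] cross_term_nn[OF e t, of h]
  have "ennreal (LINT p|(\<Omega> \<Otimes>\<^sub>M \<Omega>). \<bar>V \<epsilon> h t (fst p) (snd p)\<bar>) \<le> ennreal (\<epsilon> * cov_L1 * (2 * sqrt t))"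
    by simp
  moreover have "0 \<le> \<epsilon> * cov_L1 * (2 * sqrt t)"
    using e t by (intro mult_nonneg_nonneg cov_L1_nonneg) auto
  ultimately show ?thesis by (simp add: ennreal_le_iff)
qed

end

subsection \<open>Second moments of the Feynman--Kac formula\<close>

lemma abs_exp_diff_le:
  fixes x y R :: real
  assumes "\<bar>x\<bar> \<le> R" "\<bar>y\<bar> \<le> R"
  shows "\<bar>exp x - exp y\<bar> \<le> exp R * \<bar>x - y\<bar>"
proof -
  have *: "exp a - exp b \<le> exp R * \<bar>a - b\<bar>" if "a \<le> R" for a b :: real
  proof -
    have "exp a - exp b = exp a * (1 - exp (b - a))" by (simp add: exp_diff right_diff_distrib)
    also have "\<dots> \<le> exp a * \<bar>a - b\<bar>" using exp_ge_add_one_self[of "b - a"] by (intro mult_left_mono) (linarith, simp)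
    also have "\<dots> \<le> exp R * \<bar>a - b\<bar>" using that by (intro mult_right_mono) auto
    finally show ?thesis .
  qed
  show ?thesis using *[of x y] *[of y x] assms by (auto simp: abs_minus_commute abs_le_iff)
qed

lemma (in prob_space) integral_product_square:
  fixes f :: "'a \<Rightarrow> real"
  assumes f: "integrable M f"
  shows "integrable (M \<Otimes>\<^sub>M M) (\<lambda>p. f (fst p) * f (snd p))"
    and "(LINT p|(M \<Otimes>\<^sub>M M). f (fst p) * f (snd p)) = (LINT x|M. f x)\<^sup>2"
proof -
  interpret P: pair_sigma_finite M M ..
  have [measurable]: "f \<in> borel_measurable M" using f by auto
  show i: "integrable (M \<Otimes>\<^sub>M M) (\<lambda>p. f (fst p) * f (snd p))"
    by (rule P.Fubini_integrable) (use f in \<open>auto simp: abs_mult\<close>)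
  have "(LINT p|(M \<Otimes>\<^sub>M M). f (fst p) * f (snd p)) = (LINT x|M. LINT y|M. f x * f y)"
    using P.integral_fst'[OF i] by simp
  then show "(LINT p|(M \<Otimes>\<^sub>M M). f (fst p) * f (snd p)) = (LINT x|M. f x)\<^sup>2"
    by (simp add: power2_eq_square)
qed

lemma (in prob_space) integral_pair_marginals:
  fixes f :: "'a \<Rightarrow> real"
  assumes f: "integrable M f"
  shows "integrable (M \<Otimes>\<^sub>M M) (\<lambda>p. f (fst p))" "(LINT p|(M \<Otimes>\<^sub>M M). f (fst p)) = (LINT x|M. f x)"
    "integrable (M \<Otimes>\<^sub>M M) (\<lambda>p. f (snd p))" "(LINT p|(M \<Otimes>\<^sub>M M). f (snd p)) = (LINT x|M. f x)"
proof -
  interpret P: pair_sigma_finite M M ..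
  have [measurable]: "f \<in> borel_measurable M" using f by auto
  show i: "integrable (M \<Otimes>\<^sub>M M) (\<lambda>p. f (fst p))" "integrable (M \<Otimes>\<^sub>M M) (\<lambda>p. f (snd p))"
    by (rule P.Fubini_integrable; use f in auto)+
  show "(LINT p|(M \<Otimes>\<^sub>M M). f (fst p)) = (LINT x|M. f x)" "(LINT p|(M \<Otimes>\<^sub>M M). f (snd p)) = (LINT x|M. f x)"
    using P.integral_fst'[OF i(1)] P.integral_fst'[OF i(2)] by (simp_all add: prob_space)
qed

context random_environment
begin

definition fk_weight :: "real \<Rightarrow> real \<Rightarrow> real \<Rightarrow> 'w \<Rightarrow> 's \<Rightarrow> real" where
  "fk_weight \<epsilon> t x \<omega> a = exp (1 / \<epsilon> * (LINT s:{0..t}|lborel. cp (s / \<epsilon>\<^sup>2) ((x + BP s \<omega>) / \<epsilon>) a))"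

lemma fk_weight_measurable[measurable (raw)]:
  assumes "f \<in> N \<rightarrow>\<^sub>M \<Omega>" "k \<in> N \<rightarrow>\<^sub>M S"
  shows "(\<lambda>y. fk_weight \<epsilon> t x (f y) (k y)) \<in> borel_measurable N"
  unfolding fk_weight_def set_lebesgue_integral_def using assms by measurable

lemma cp_path_measurable:
  "\<omega> \<in> space \<Omega> \<Longrightarrow> a \<in> space S \<Longrightarrow> (\<lambda>s. cp (s / \<epsilon>\<^sup>2) ((x + BP s \<omega>) / \<epsilon>) a) \<in> borel_measurable borel"
  by measurable

lemma fk_weight_bounds:
  assumes "0 < \<epsilon>" "0 \<le> t" "\<omega> \<in> space \<Omega>" "a \<in> space S"
  shows "fk_weight \<epsilon> t x \<omega> a \<le> exp (1 / \<epsilon> * (K * t))" "exp (- (1 / \<epsilon> * (K * t))) \<le> fk_weight \<epsilon> t x \<omega> a"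
proof -
  have "\<bar>LINT s:{0..t}|lborel. cp (s / \<epsilon>\<^sup>2) ((x + BP s \<omega>) / \<epsilon>) a\<bar> \<le> K * (t - 0)"
    by (rule set_integral_Icc_bound[OF cp_path_measurable]) (use assms in \<open>auto intro: cp_bound\<close>)
  then have "\<bar>1 / \<epsilon> * (LINT s:{0..t}|lborel. cp (s / \<epsilon>\<^sup>2) ((x + BP s \<omega>) / \<epsilon>) a)\<bar> \<le> 1 / \<epsilon> * (K * t)"
    using assms(1) unfolding abs_mult by (intro mult_mono) auto
  then show "fk_weight \<epsilon> t x \<omega> a \<le> exp (1 / \<epsilon> * (K * t))" "exp (- (1 / \<epsilon> * (K * t))) \<le> fk_weight \<epsilon> t x \<omega> a"
    unfolding fk_weight_def exp_le_cancel_iff by linarith+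
qed

lemma fk_weight_pos: "0 < fk_weight \<epsilon> t x \<omega> a" by (simp add: fk_weight_def)

lemma fk_weight_integrable:
  assumes "0 < \<epsilon>" "0 \<le> t" "\<omega> \<in> space \<Omega>"
  shows "integrable S (fk_weight \<epsilon> t x \<omega>)"
  by (rule env.integrable_bounded[where C="exp (1 / \<epsilon> * (K * t))"])
     (use assms fk_weight_bounds fk_weight_pos in \<open>auto simp: less_imp_le\<close>)

lemma ZZ_integrable:
  assumes "0 < \<epsilon>" "0 \<le> t" "\<omega> \<in> space \<Omega>" "\<omega>' \<in> space \<Omega>"
  shows "integrable S (\<lambda>a. fk_weight \<epsilon> t x \<omega> a * fk_weight \<epsilon> t x \<omega>' a)"
  by (rule env.integrable_bounded[where C="exp (1 / \<epsilon> * (K * t)) * exp (1 / \<epsilon> * (K * t))"])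
     (use assms fk_weight_bounds fk_weight_pos in \<open>auto simp: less_imp_le abs_mult intro!: mult_mono\<close>)

definition m1 :: "real \<Rightarrow> real \<Rightarrow> real \<Rightarrow> 'w \<Rightarrow> real" where
  "m1 \<epsilon> t x \<omega> = (LINT a|S. fk_weight \<epsilon> t x \<omega> a)"

definition m2 :: "real \<Rightarrow> real \<Rightarrow> real \<Rightarrow> 'w \<Rightarrow> 'w \<Rightarrow> real" where
  "m2 \<epsilon> t x \<omega> \<omega>' = (LINT a|S. fk_weight \<epsilon> t x \<omega> a * fk_weight \<epsilon> t x \<omega>' a)"

lemma m_pos:
  assumes "0 < \<epsilon>" "0 \<le> t" "\<omega> \<in> space \<Omega>" "\<omega>' \<in> space \<Omega>"
  shows "0 < m1 \<epsilon> t x \<omega>" "0 < m2 \<epsilon> t x \<omega> \<omega>'"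
proof -
  have "(LINT a|S. exp (- (1 / \<epsilon> * (K * t)))) \<le> m1 \<epsilon> t x \<omega>" unfolding m1_def
    by (intro integral_mono fk_weight_integrable) (use assms fk_weight_bounds in auto)
  then show "0 < m1 \<epsilon> t x \<omega>" by (simp add: env.prob_space) (meson exp_gt_zero less_le_trans)
  have "(LINT a|S. exp (- (1 / \<epsilon> * (K * t))) * exp (- (1 / \<epsilon> * (K * t)))) \<le> m2 \<epsilon> t x \<omega> \<omega>'" unfolding m2_def
    by (intro integral_mono ZZ_integrable mult_mono) (use assms fk_weight_bounds fk_weight_pos in \<open>auto simp: less_imp_le\<close>)
  then have "exp (- (1 / \<epsilon> * (K * t))) * exp (- (1 / \<epsilon> * (K * t))) \<le> m2 \<epsilon> t x \<omega> \<omega>'" by (simp add: env.prob_space)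
  moreover have "0 < exp (- (1 / \<epsilon> * (K * t))) * exp (- (1 / \<epsilon> * (K * t)))" by simp
  ultimately show "0 < m2 \<epsilon> t x \<omega> \<omega>'" by (rule less_le_trans[rotated])
qed

text \<open>The error of \<open>along_paths_expansion\<close> per unit of time, for \<open>N\<close>
  paths; \<open>N\<close> is 1 for first moments and 2 for joint moments of two weights.\<close>

definition err :: "real \<Rightarrow> real \<Rightarrow> real \<Rightarrow> real" where
  "err N \<epsilon> h = (1 / \<epsilon> * (2 * (N * K) * mix h) * exp (2 * (1 / \<epsilon>) * (N * K) * (\<epsilon>\<^sup>2 * h))
    + (1 / \<epsilon>)\<^sup>2 * (\<epsilon>\<^sup>2 * h) * ((2 * (N * K)\<^sup>2 * mix h) * exp (2 * (1 / \<epsilon>) * (N * K) * (\<epsilon>\<^sup>2 * h))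
      + 3 * (N * K)\<^sup>2 * (exp (2 * (1 / \<epsilon>) * (N * K) * (\<epsilon>\<^sup>2 * h)) - 1)))"

lemma V_eq: "V \<epsilon> h t \<omega> \<omega>' = (1 / \<epsilon>)\<^sup>2 * (LINT s:{0..t}|lborel.
   (LINT r:{max 0 (s - \<epsilon>\<^sup>2 * h)..s}|lborel. \<Phi> ((s - r) / \<epsilon>\<^sup>2) ((BP s \<omega> - BP r \<omega>') / \<epsilon>)))"
  by (simp only: V_def V_inner_def set_integral_mult_right)

lemma m1_expansion:
  assumes e: "0 < \<epsilon>" "0 \<le> h" "0 \<le> t" and \<omega>: "\<omega> \<in> space \<Omega>"
  shows "\<bar>ln (m1 \<epsilon> t x \<omega>) - V \<epsilon> h t \<omega> \<omega>\<bar> \<le> err 1 \<epsilon> h * t"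
proof -
  have X: "(\<lambda>s. x + BP s \<omega>) \<in> borel_measurable borel" using \<omega> by measurable
  show ?thesis
    using along_paths_expansion[of "{()}" "\<lambda>_ s. x + BP s \<omega>" \<epsilon> h t] X e
    by (simp only: V_eq) (simp add: m1_def fk_weight_def[abs_def] err_def)
qed

lemma m2_expansion:
  assumes e: "0 < \<epsilon>" "0 \<le> h" "0 \<le> t" and \<omega>: "\<omega> \<in> space \<Omega>" "\<omega>' \<in> space \<Omega>"
  shows "\<bar>ln (m2 \<epsilon> t x \<omega> \<omega>') - (V \<epsilon> h t \<omega> \<omega> + V \<epsilon> h t \<omega> \<omega>' + V \<epsilon> h t \<omega>' \<omega> + V \<epsilon> h t \<omega>' \<omega>')\<bar> \<le> err 2 \<epsilon> h * t"
proof -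
  \<comment> \<open>Booleans index the two paths. The product of the two weights is one exponential
    of the field summed over both, so the expansion for two paths yields the two diagonal and the
    two cross covariances.\<close>
  define X where "X b s = x + BP s (if b then \<omega> else \<omega>')" for b s
  have X: "X b \<in> borel_measurable borel" for b unfolding X_def using \<omega> by measurable
  have Zm: "exp (1 / \<epsilon> * (LINT s:{0..t}|lborel. (\<Sum>b\<in>UNIV. cp (s / \<epsilon>\<^sup>2) (X b s / \<epsilon>) a))) = fk_weight \<epsilon> t x \<omega> a * fk_weight \<epsilon> t x \<omega>' a"
    if a: "a \<in> space S" for a
  proof -
    have i: "set_integrable lborel {0..t} (\<lambda>s. cp (s / \<epsilon>\<^sup>2) (X b s / \<epsilon>) a)" for b
      unfolding X_def
      by (rule set_integrable_bounded_Icc[OF cp_path_measurable, where K=K]) (use a \<omega> cp_bound in auto)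
    show ?thesis
      using i[of True] i[of False]
      by (simp add: UNIV_bool fk_weight_def X_def set_integral_add(2) exp_add[symmetric] distrib_left[symmetric] add.commute add_divide_distrib)
  qed
  have m2: "m2 \<epsilon> t x \<omega> \<omega>' = (LINT a|S. exp (1 / \<epsilon> * (LINT s:{0..t}|lborel. (\<Sum>b\<in>UNIV. cp (s / \<epsilon>\<^sup>2) (X b s / \<epsilon>) a))))"
    unfolding m2_def by (intro Bochner_Integration.integral_cong refl Zm[symmetric])
  have in1: "set_integrable lborel {max 0 (s - \<epsilon>\<^sup>2 * h)..s} (\<lambda>r. \<Phi> ((s - r) / \<epsilon>\<^sup>2) ((BP s \<omega>1 - BP r \<omega>2) / \<epsilon>))"
    if "\<omega>1 \<in> space \<Omega>" "\<omega>2 \<in> space \<Omega>" for s \<omega>1 \<omega>2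
  proof (rule set_integrable_bounded_Icc[where K="2 * K\<^sup>2 * C"])
    show "(\<lambda>r. \<Phi> ((s - r) / \<epsilon>\<^sup>2) ((BP s \<omega>1 - BP r \<omega>2) / \<epsilon>)) \<in> borel_measurable borel" using that by measurable
    show "\<bar>\<Phi> ((s - r) / \<epsilon>\<^sup>2) ((BP s \<omega>1 - BP r \<omega>2) / \<epsilon>)\<bar> \<le> 2 * K\<^sup>2 * C" if "r \<in> {max 0 (s - \<epsilon>\<^sup>2 * h)..s}" for r
      using that by (intro order_trans[OF cov_bound] mult_left_mono mix_le) auto
  qed
  have Vi: "set_integrable lborel {0..t} (\<lambda>s. V_inner \<epsilon> h s \<omega>1 \<omega>2)" if "\<omega>1 \<in> space \<Omega>" "\<omega>2 \<in> space \<Omega>" for \<omega>1 \<omega>2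
  proof (rule set_integrable_bounded_Icc[where K=cov_mass])
    show "(\<lambda>s. V_inner \<epsilon> h s \<omega>1 \<omega>2) \<in> borel_measurable borel" using that by measurable
  qed (use that V_inner_bound e in auto)
  have inner: "(1 / \<epsilon>)\<^sup>2 * (LINT r:{max 0 (s - \<epsilon>\<^sup>2 * h)..s}|lborel. (\<Sum>i\<in>UNIV. \<Sum>j\<in>UNIV. \<Phi> ((s - r) / \<epsilon>\<^sup>2) ((X i s - X j r) / \<epsilon>)))
     = V_inner \<epsilon> h s \<omega> \<omega> + V_inner \<epsilon> h s \<omega> \<omega>' + V_inner \<epsilon> h s \<omega>' \<omega> + V_inner \<epsilon> h s \<omega>' \<omega>'" for s
    unfolding V_inner_def
    using in1[OF \<omega>(1) \<omega>(1), of s] in1[OF \<omega>(1) \<omega>(2), of s] in1[OF \<omega>(2) \<omega>(1), of s] in1[OF \<omega>(2) \<omega>(2), of s]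
    by (simp add: UNIV_bool X_def set_integral_add distrib_left)
  have VV: "(1 / \<epsilon>)\<^sup>2 * (LINT s:{0..t}|lborel. (LINT r:{max 0 (s - \<epsilon>\<^sup>2 * h)..s}|lborel. (\<Sum>i\<in>UNIV. \<Sum>j\<in>UNIV. \<Phi> ((s - r) / \<epsilon>\<^sup>2) ((X i s - X j r) / \<epsilon>))))
     = V \<epsilon> h t \<omega> \<omega> + V \<epsilon> h t \<omega> \<omega>' + V \<epsilon> h t \<omega>' \<omega> + V \<epsilon> h t \<omega>' \<omega>'"
  proof -
    let ?F = "\<lambda>s. LINT r:{max 0 (s - \<epsilon>\<^sup>2 * h)..s}|lborel. (\<Sum>i\<in>UNIV. \<Sum>j\<in>UNIV. \<Phi> ((s - r) / \<epsilon>\<^sup>2) ((X i s - X j r) / \<epsilon>))"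
    have "(1 / \<epsilon>)\<^sup>2 * (LINT s:{0..t}|lborel. ?F s) = (LINT s:{0..t}|lborel. (1 / \<epsilon>)\<^sup>2 * ?F s)"
      by (rule set_integral_mult_right[symmetric])
    also have "\<dots> = (LINT s:{0..t}|lborel. V_inner \<epsilon> h s \<omega> \<omega> + V_inner \<epsilon> h s \<omega> \<omega>' + V_inner \<epsilon> h s \<omega>' \<omega> + V_inner \<epsilon> h s \<omega>' \<omega>')"
      by (simp only: inner)
    finally show ?thesis unfolding V_def
      using Vi[OF \<omega>(1) \<omega>(1)] Vi[OF \<omega>(1) \<omega>(2)] Vi[OF \<omega>(2) \<omega>(1)] Vi[OF \<omega>(2) \<omega>(2)]
      by (simp add: set_integral_add)
  qed
  show ?thesis
    using along_paths_expansion[of "UNIV :: bool set" X \<epsilon> h t] X e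
    unfolding VV m2 err_def by simp
qed

text \<open>Equals \<open>E[(Z \<omega> - exp (t \<Sigma>)) (Z \<omega>' - exp (t \<Sigma>))]\<close>, see \<open>joint_dev_eq\<close>.\<close>

definition joint_dev :: "real \<Rightarrow> real \<Rightarrow> real \<Rightarrow> 'w \<Rightarrow> 'w \<Rightarrow> real" where
  "joint_dev \<epsilon> t x \<omega> \<omega>' = m2 \<epsilon> t x \<omega> \<omega>' - exp (t * \<Sigma>) * m1 \<epsilon> t x \<omega> - exp (t * \<Sigma>) * m1 \<epsilon> t x \<omega>' + (exp (t * \<Sigma>))\<^sup>2"

text \<open>Centring \<open>m2\<close> at the square of \<open>exp (t * \<Sigma>)\<close> and each
  \<open>m1\<close> at \<open>exp (t * \<Sigma>)\<close> cancels the deterministic parts exactly. A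
  diagonal deviation enters once through \<open>m2\<close> and once through \<open>m1\<close>, hence
  its coefficient 2.\<close>

lemma joint_dev_bound:
  assumes e: "0 < \<epsilon>" "0 \<le> h" "0 \<le> t" and \<omega>: "\<omega> \<in> space \<Omega>" "\<omega>' \<in> space \<Omega>"
    and small: "err 1 \<epsilon> h * t \<le> 1" "err 2 \<epsilon> h * t \<le> 1"
  shows "\<bar>joint_dev \<epsilon> t x \<omega> \<omega>'\<bar> \<le> exp (2 * (4 * cov_mass * t + 1)) *
     (2 * \<bar>V \<epsilon> h t \<omega> \<omega> - t * \<Sigma>\<bar> + 2 * \<bar>V \<epsilon> h t \<omega>' \<omega>' - t * \<Sigma>\<bar> + \<bar>V \<epsilon> h t \<omega> \<omega>'\<bar> + \<bar>V \<epsilon> h t \<omega>' \<omega>\<bar>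
      + (2 * (err 1 \<epsilon> h * t) + err 2 \<epsilon> h * t))"
proof -
  \<comment> \<open>Bounds every logarithm that occurs: at most four values of \<open>V\<close>,
    each at most \<open>cov_mass * t\<close>, plus an error of at most 1. On this range exp has
    Lipschitz constant \<open>exp R\<close>.\<close>
  define R where "R = 4 * cov_mass * t + 1"
  define \<kappa> where "\<kappa> = exp (t * \<Sigma>)"
  have At: "0 \<le> cov_mass * t" using cov_mass_nonneg e by simp
  have St: "\<bar>t * \<Sigma>\<bar> \<le> cov_mass * t" using mult_left_mono[OF \<Sigma>_bound e(3)] e(3) by (simp add: abs_mult mult.commute)
  have \<kappa>: "0 < \<kappa>" "\<kappa> \<le> exp R" "1 \<le> exp R" using St At by (auto simp: \<kappa>_def R_def)
  have m1: "\<bar>m1 \<epsilon> t x \<omega> - \<kappa>\<bar> \<le> exp R * (\<bar>V \<epsilon> h t \<omega> \<omega> - t * \<Sigma>\<bar> + err 1 \<epsilon> h * t)" if "\<omega> \<in> space \<Omega>" for \<omega>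
  proof -
    have l: "\<bar>ln (m1 \<epsilon> t x \<omega>) - V \<epsilon> h t \<omega> \<omega>\<bar> \<le> err 1 \<epsilon> h * t" by (rule m1_expansion[OF e that])
    have "\<bar>exp (ln (m1 \<epsilon> t x \<omega>)) - exp (t * \<Sigma>)\<bar> \<le> exp R * \<bar>ln (m1 \<epsilon> t x \<omega>) - t * \<Sigma>\<bar>"
      by (rule abs_exp_diff_le) (use l V_bound[OF e(1,3) that that, of h] small St At in \<open>auto simp: R_def\<close>)
    also have "\<dots> \<le> exp R * (\<bar>V \<epsilon> h t \<omega> \<omega> - t * \<Sigma>\<bar> + err 1 \<epsilon> h * t)"
      using l by (intro mult_left_mono) auto
    finally show ?thesis using m_pos(1)[OF e(1,3) that that, of x] by (simp add: \<kappa>_def)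
  qed
  have m2: "\<bar>m2 \<epsilon> t x \<omega> \<omega>' - \<kappa>\<^sup>2\<bar> \<le> exp R * (\<bar>V \<epsilon> h t \<omega> \<omega> - t * \<Sigma>\<bar> + \<bar>V \<epsilon> h t \<omega>' \<omega>' - t * \<Sigma>\<bar> + \<bar>V \<epsilon> h t \<omega> \<omega>'\<bar> + \<bar>V \<epsilon> h t \<omega>' \<omega>\<bar> + err 2 \<epsilon> h * t)"
  proof -
    have l: "\<bar>ln (m2 \<epsilon> t x \<omega> \<omega>') - (V \<epsilon> h t \<omega> \<omega> + V \<epsilon> h t \<omega> \<omega>' + V \<epsilon> h t \<omega>' \<omega> + V \<epsilon> h t \<omega>' \<omega>')\<bar> \<le> err 2 \<epsilon> h * t"
      by (rule m2_expansion[OF e \<omega>])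
    have "\<bar>exp (ln (m2 \<epsilon> t x \<omega> \<omega>')) - exp (2 * (t * \<Sigma>))\<bar> \<le> exp R * \<bar>ln (m2 \<epsilon> t x \<omega> \<omega>') - 2 * (t * \<Sigma>)\<bar>"
      by (rule abs_exp_diff_le) 
        (use l V_bound[OF e(1,3) \<omega>(1) \<omega>(1), of h] V_bound[OF e(1,3) \<omega>(1) \<omega>(2), of h] V_bound[OF e(1,3) \<omega>(2) \<omega>(1), of h]
           V_bound[OF e(1,3) \<omega>(2) \<omega>(2), of h] small St At in \<open>unfold R_def, linarith+\<close>)
    also have "\<dots> \<le> exp R * (\<bar>V \<epsilon> h t \<omega> \<omega> - t * \<Sigma>\<bar> + \<bar>V \<epsilon> h t \<omega>' \<omega>' - t * \<Sigma>\<bar> + \<bar>V \<epsilon> h t \<omega> \<omega>'\<bar> + \<bar>V \<epsilon> h t \<omega>' \<omega>\<bar> + err 2 \<epsilon> h * t)"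
      using l by (intro mult_left_mono) auto
    finally show ?thesis using m_pos(2)[OF e(1,3) \<omega>, of x] by (simp add: \<kappa>_def exp_double)
  qed
  have up: "y \<le> exp (2 * R) * z" if "y \<le> exp R * z" "0 \<le> z" for y z :: real
  proof -
    have "0 \<le> R" using At unfolding R_def by linarith
    then have "exp R * z \<le> exp (2 * R) * z" using that(2) by (intro mult_right_mono) auto
    with that show ?thesis by linarith
  qed
  have \<kappa>m1: "\<kappa> * \<bar>m1 \<epsilon> t x \<omega> - \<kappa>\<bar> \<le> exp (2 * R) * (\<bar>V \<epsilon> h t \<omega> \<omega> - t * \<Sigma>\<bar> + err 1 \<epsilon> h * t)" if "\<omega> \<in> space \<Omega>" for \<omega>
  proof -
    have "\<kappa> * \<bar>m1 \<epsilon> t x \<omega> - \<kappa>\<bar> \<le> exp R * (exp R * (\<bar>V \<epsilon> h t \<omega> \<omega> - t * \<Sigma>\<bar> + err 1 \<epsilon> h * t))"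
      using \<kappa> m1[OF that] by (intro mult_mono) auto
    then show ?thesis by (simp add: exp_double power2_eq_square mult.assoc)
  qed
  have e0: "0 \<le> err 2 \<epsilon> h * t" using m2_expansion[OF e \<omega>, of x] by linarith
  have "joint_dev \<epsilon> t x \<omega> \<omega>' = (m2 \<epsilon> t x \<omega> \<omega>' - \<kappa>\<^sup>2) - \<kappa> * (m1 \<epsilon> t x \<omega> - \<kappa>) - \<kappa> * (m1 \<epsilon> t x \<omega>' - \<kappa>)"
    by (simp add: joint_dev_def \<kappa>_def power2_eq_square algebra_simps)
  then have "\<bar>joint_dev \<epsilon> t x \<omega> \<omega>'\<bar> \<le> \<bar>m2 \<epsilon> t x \<omega> \<omega>' - \<kappa>\<^sup>2\<bar> + \<kappa> * \<bar>m1 \<epsilon> t x \<omega> - \<kappa>\<bar> + \<kappa> * \<bar>m1 \<epsilon> t x \<omega>' - \<kappa>\<bar>"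
    using \<kappa>(1) abs_mult[of \<kappa> "m1 \<epsilon> t x \<omega> - \<kappa>"] abs_mult[of \<kappa> "m1 \<epsilon> t x \<omega>' - \<kappa>"] by linarith
  also have "\<dots> \<le> exp (2 * R) * (\<bar>V \<epsilon> h t \<omega> \<omega> - t * \<Sigma>\<bar> + \<bar>V \<epsilon> h t \<omega>' \<omega>' - t * \<Sigma>\<bar> + \<bar>V \<epsilon> h t \<omega> \<omega>'\<bar> + \<bar>V \<epsilon> h t \<omega>' \<omega>\<bar> + err 2 \<epsilon> h * t)
     + exp (2 * R) * (\<bar>V \<epsilon> h t \<omega> \<omega> - t * \<Sigma>\<bar> + err 1 \<epsilon> h * t) + exp (2 * R) * (\<bar>V \<epsilon> h t \<omega>' \<omega>' - t * \<Sigma>\<bar> + err 1 \<epsilon> h * t)"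
    by (intro add_mono \<kappa>m1 \<omega> up[OF m2]) (use e0 in auto)
  also have "\<dots> = exp (2 * R) * (2 * \<bar>V \<epsilon> h t \<omega> \<omega> - t * \<Sigma>\<bar> + 2 * \<bar>V \<epsilon> h t \<omega>' \<omega>' - t * \<Sigma>\<bar> + \<bar>V \<epsilon> h t \<omega> \<omega>'\<bar> + \<bar>V \<epsilon> h t \<omega>' \<omega>\<bar>
      + (2 * (err 1 \<epsilon> h * t) + err 2 \<epsilon> h * t))"
    by (simp add: distrib_left)
  finally show ?thesis by (simp only: R_def)
qed

end

section \<open>The delay and the vanishing of all error terms\<close>

lemma tendsto_rate_terms:
  fixes a k \<delta> :: real
  assumes a: "0 < a" "a < 1/2" "0 < \<delta>" "1 < a * (2 + \<delta>)"
  defines "h \<equiv> \<lambda>\<epsilon>::real. \<epsilon> powr (-a)"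
  shows "((\<lambda>\<epsilon>. \<epsilon>\<^sup>2 * h \<epsilon>) \<longlongrightarrow> 0) (at_right 0)"
    and "filterlim h at_top (at_right 0)"
    and "((\<lambda>\<epsilon>. exp (k * (\<epsilon> * h \<epsilon>))) \<longlongrightarrow> 1) (at_right 0)"
    and "((\<lambda>\<epsilon>. h \<epsilon> * (exp (k * (\<epsilon> * h \<epsilon>)) - 1)) \<longlongrightarrow> 0) (at_right 0)"
    and "((\<lambda>\<epsilon>. 1 / \<epsilon> * (1 + h \<epsilon>) powr (-(2 + \<delta>))) \<longlongrightarrow> 0) (at_right 0)"
    and "((\<lambda>\<epsilon>. h \<epsilon> * (1 + h \<epsilon>) powr (-(2 + \<delta>))) \<longlongrightarrow> 0) (at_right 0)"
proof -
  show "((\<lambda>\<epsilon>. \<epsilon>\<^sup>2 * h \<epsilon>) \<longlongrightarrow> 0) (at_right 0)"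
    "filterlim h at_top (at_right 0)"
    "((\<lambda>\<epsilon>. exp (k * (\<epsilon> * h \<epsilon>))) \<longlongrightarrow> 1) (at_right 0)"
    "((\<lambda>\<epsilon>. h \<epsilon> * (exp (k * (\<epsilon> * h \<epsilon>)) - 1)) \<longlongrightarrow> 0) (at_right 0)"
    unfolding h_def using a(1,2) by real_asymp+
  \<comment> \<open>The power of \<epsilon> that remains when the mixing rate is set against
    \<open>1 / \<epsilon>\<close>; the last hypothesis makes it positive.\<close>
  define b where "b = a * (2 + \<delta>) - 1"
  have b: "b > 0" using a by (simp add: b_def)
  have le: "1 / \<epsilon> * (1 + h \<epsilon>) powr (-(2 + \<delta>)) \<le> \<epsilon> powr b" if "0 < \<epsilon>" for \<epsilon>
  proof -
    have "(1 + h \<epsilon>) powr (-(2 + \<delta>)) \<le> h \<epsilon> powr (-(2 + \<delta>))"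
      using that a by (intro powr_mono2') (auto simp: h_def)
    then have "1 / \<epsilon> * (1 + h \<epsilon>) powr (-(2 + \<delta>)) \<le> 1 / \<epsilon> * h \<epsilon> powr (-(2 + \<delta>))"
      using that by (intro mult_left_mono) auto
    also have "\<dots> = \<epsilon> powr b"
    proof -
      have "1 / \<epsilon> = \<epsilon> powr (-1)" using that by (simp add: powr_minus inverse_eq_divide)
      moreover have "h \<epsilon> powr (-(2 + \<delta>)) = \<epsilon> powr (a * (2 + \<delta>))" by (simp add: h_def powr_powr algebra_simps)
      ultimately show ?thesis by (simp only: powr_add[symmetric]) (simp add: b_def)
    qed
    finally show ?thesis .
  qed
  have lim: "((\<lambda>\<epsilon>. \<epsilon> powr b) \<longlongrightarrow> 0) (at_right (0::real))" using b by real_asymp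
  have pos: "eventually (\<lambda>\<epsilon>::real. 0 < \<epsilon>) (at_right 0)" by (rule eventually_at_right_less)
  show 1: "((\<lambda>\<epsilon>. 1 / \<epsilon> * (1 + h \<epsilon>) powr (-(2 + \<delta>))) \<longlongrightarrow> 0) (at_right 0)"
  proof (rule tendsto_sandwich[OF _ _ tendsto_const lim])
    show "eventually (\<lambda>\<epsilon>. 0 \<le> 1 / \<epsilon> * (1 + h \<epsilon>) powr (-(2 + \<delta>))) (at_right 0)"
      using pos by eventually_elim auto
    show "eventually (\<lambda>\<epsilon>. 1 / \<epsilon> * (1 + h \<epsilon>) powr (-(2 + \<delta>)) \<le> \<epsilon> powr b) (at_right 0)"
      using pos by eventually_elim (rule le)
  qed
  \<comment> \<open>The last limit is the preceding one multiplied by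
    \<open>\<epsilon> * h \<epsilon>\<close>, which itself tends to 0.\<close>
  have "((\<lambda>\<epsilon>. (\<epsilon> * h \<epsilon>) * (1 / \<epsilon> * (1 + h \<epsilon>) powr (-(2 + \<delta>)))) \<longlongrightarrow> 0 * 0) (at_right 0)"
  proof (rule tendsto_mult[OF _ 1])
    show "((\<lambda>\<epsilon>. \<epsilon> * h \<epsilon>) \<longlongrightarrow> 0) (at_right 0)" unfolding h_def using a(1,2) by real_asymp
  qed
  from this[unfolded mult_zero_left] show "((\<lambda>\<epsilon>. h \<epsilon> * (1 + h \<epsilon>) powr (-(2 + \<delta>))) \<longlongrightarrow> 0) (at_right 0)"
    by (rule Lim_transform_eventually) (use pos in eventually_elim, simp)
qed

context random_environment
begin

text \<open>The delay \<open>\<epsilon> powr -a\<close> needs \<open>a (2 + \<delta>) > 1\<close> for the mixing error \<open>mix h / \<epsilon>\<close> and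
  \<open>a < 1/2\<close> for the freezing error \<open>\<epsilon> h\<^sup>2\<close> to vanish; \<open>a = 2 / (4 + \<delta>)\<close> satisfies both.\<close>

definition delay :: "real \<Rightarrow> real" where "delay \<epsilon> = \<epsilon> powr (-(2 / (4 + \<delta>)))"

lemma delay_nonneg: "0 \<le> delay \<epsilon>" by (simp add: delay_def)

lemma delay_exponent: "0 < 2 / (4 + \<delta>)" "2 / (4 + \<delta>) < 1 / 2" "1 < 2 / (4 + \<delta>) * (2 + \<delta>)"
  using \<delta> by (auto simp: field_simps)

lemmas delay_limits = tendsto_rate_terms[OF delay_exponent(1,2) \<delta> delay_exponent(3), folded delay_def]

lemma err_tendsto: "((\<lambda>\<epsilon>. err N \<epsilon> (delay \<epsilon>)) \<longlongrightarrow> 0) (at_right 0)"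
proof -
  define k where "k = 2 * (N * K)"
  let ?G = "\<lambda>\<epsilon>. exp (k * (\<epsilon> * delay \<epsilon>))" and ?m = "\<lambda>\<epsilon>. (1 + delay \<epsilon>) powr (-(2 + \<delta>))"
  have "((\<lambda>\<epsilon>. k * C * (1 / \<epsilon> * ?m \<epsilon>) * ?G \<epsilon> + (k * (N * K) * C * (delay \<epsilon> * ?m \<epsilon>) * ?G \<epsilon> + 3 * (N * K)\<^sup>2 * (delay \<epsilon> * (?G \<epsilon> - 1))))
    \<longlongrightarrow> k * C * 0 * 1 + (k * (N * K) * C * 0 * 1 + 3 * (N * K)\<^sup>2 * 0)) (at_right 0)"
    by (intro tendsto_add tendsto_mult tendsto_const delay_limits)
  then have "((\<lambda>\<epsilon>. k * C * (1 / \<epsilon> * ?m \<epsilon>) * ?G \<epsilon> + (k * (N * K) * C * (delay \<epsilon> * ?m \<epsilon>) * ?G \<epsilon> + 3 * (N * K)\<^sup>2 * (delay \<epsilon> * (?G \<epsilon> - 1))))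
    \<longlongrightarrow> 0) (at_right 0)" by simp
  then show ?thesis
  proof (rule Lim_transform_eventually)
    have "eventually (\<lambda>\<epsilon>::real. 0 < \<epsilon>) (at_right 0)" by (rule eventually_at_right_less)
    then show "eventually (\<lambda>\<epsilon>. k * C * (1 / \<epsilon> * ?m \<epsilon>) * ?G \<epsilon> + (k * (N * K) * C * (delay \<epsilon> * ?m \<epsilon>) * ?G \<epsilon> + 3 * (N * K)\<^sup>2 * (delay \<epsilon> * (?G \<epsilon> - 1)))
       = err N \<epsilon> (delay \<epsilon>)) (at_right 0)"
    proof eventually_elim
      case (elim \<epsilon>)
      have 1: "2 * (1 / \<epsilon>) * (N * K) * (\<epsilon>\<^sup>2 * delay \<epsilon>) = k * (\<epsilon> * delay \<epsilon>)"
        using elim by (simp add: k_def power2_eq_square)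
      have 2: "(1 / \<epsilon>)\<^sup>2 * (\<epsilon>\<^sup>2 * delay \<epsilon>) = delay \<epsilon>" using elim by (simp add: power_divide)
      show ?case unfolding err_def 1 2 mix_def
        by (simp add: k_def power2_eq_square distrib_left mult_ac)
    qed
  qed
qed

lemma m1_measurable[measurable]: "m1 \<epsilon> t x \<in> borel_measurable \<Omega>"
  unfolding m1_def by measurable

lemma m2_measurable[measurable (raw)]:
  assumes "f \<in> N \<rightarrow>\<^sub>M \<Omega>" "k \<in> N \<rightarrow>\<^sub>M \<Omega>"
  shows "(\<lambda>y. m2 \<epsilon> t x (f y) (k y)) \<in> borel_measurable N"
  unfolding m2_def using assms by measurable

lemma V_measurable'[measurable (raw)]:
  assumes "f \<in> N \<rightarrow>\<^sub>M \<Omega>" "k \<in> N \<rightarrow>\<^sub>M \<Omega>"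
  shows "(\<lambda>y. V \<epsilon> h t (f y) (k y)) \<in> borel_measurable N"
  unfolding V_def set_lebesgue_integral_def using assms by measurable

lemma joint_dev_measurable[measurable (raw)]:
  assumes "f \<in> N \<rightarrow>\<^sub>M \<Omega>" "k \<in> N \<rightarrow>\<^sub>M \<Omega>"
  shows "(\<lambda>y. joint_dev \<epsilon> t x (f y) (k y)) \<in> borel_measurable N"
  unfolding joint_dev_def using assms by measurable

definition V_bound_L2 :: "real \<Rightarrow> real \<Rightarrow> real \<Rightarrow> real" where
  "V_bound_L2 \<epsilon> h t = 16 * cov_mass\<^sup>2 * (\<epsilon>\<^sup>2 * h) * t + 2 * (2 * cov_mass * (\<epsilon>\<^sup>2 * h) + mean_cov_tail h * t)\<^sup>2"

definition joint_dev_bound_L2 :: "real \<Rightarrow> real \<Rightarrow> real \<Rightarrow> real" where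
  "joint_dev_bound_L2 \<epsilon> h t = (exp (2 * (4 * cov_mass * t + 1)))\<^sup>2 * (5 * (8 * V_bound_L2 \<epsilon> h t
     + 2 * (cov_mass * t * (\<epsilon> * cov_L1 * (2 * sqrt t))) + (2 * (err 1 \<epsilon> h * t) + err 2 \<epsilon> h * t)\<^sup>2))"

text \<open>The diagonal deviations are small in mean square, the cross terms only in mean. The
  square of a cross term is therefore bounded by its uniform bound \<open>cov_mass * t\<close> times
  its absolute value. The factor 5 comes from squaring a sum of five terms.\<close>

lemma joint_dev_square_integral:
  assumes e: "0 < \<epsilon>" "0 \<le> h" "0 \<le> t"
    and small: "err 1 \<epsilon> h * t \<le> 1" "err 2 \<epsilon> h * t \<le> 1"
  shows "integrable (\<Omega> \<Otimes>\<^sub>M \<Omega>) (\<lambda>p. (joint_dev \<epsilon> t x (fst p) (snd p))\<^sup>2)"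
    and "(LINT p|(\<Omega> \<Otimes>\<^sub>M \<Omega>). (joint_dev \<epsilon> t x (fst p) (snd p))\<^sup>2) \<le> joint_dev_bound_L2 \<epsilon> h t"
proof -
  interpret P: prob_space "\<Omega> \<Otimes>\<^sub>M \<Omega>" by (intro prob_space_pair bm.prob_space_axioms)
  interpret PP: pair_sigma_finite \<Omega> \<Omega> ..
  define Q where "Q = exp (2 * (4 * cov_mass * t + 1))"
  define er where "er = 2 * (err 1 \<epsilon> h * t) + err 2 \<epsilon> h * t"
  define v where "v \<omega> = V \<epsilon> h t \<omega> \<omega> - t * \<Sigma>" for \<omega>
  have [measurable]: "v \<in> borel_measurable \<Omega>" unfolding v_def by measurable
  have At: "0 \<le> cov_mass * t" using cov_mass_nonneg e by simp
  have St: "\<bar>t * \<Sigma>\<bar> \<le> cov_mass * t" using mult_left_mono[OF \<Sigma>_bound e(3)] e(3) by (simp add: abs_mult mult.commute)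
  have vb: "\<bar>v \<omega>\<bar> \<le> 2 * (cov_mass * t)" if "\<omega> \<in> space \<Omega>" for \<omega>
    using V_bound[OF e(1,3) that that, of h] St by (simp add: v_def)
  have v2: "integrable \<Omega> (\<lambda>\<omega>. (v \<omega>)\<^sup>2)"
    by (rule bm.integrable_bounded[where C="(2 * (cov_mass * t))\<^sup>2"]) 
       (measurable, unfold abs_power2 abs_le_square_iff[symmetric], rule order_trans[OF vb abs_ge_self])
  note v2' = bm.integral_pair_marginals[OF v2]
  have Vi: "integrable (\<Omega> \<Otimes>\<^sub>M \<Omega>) (\<lambda>p. \<bar>V \<epsilon> h t (fst p) (snd p)\<bar>)"
    "integrable (\<Omega> \<Otimes>\<^sub>M \<Omega>) (\<lambda>p. \<bar>V \<epsilon> h t (snd p) (fst p)\<bar>)"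
    by (rule P.integrable_bounded[where C="cov_mass * t"]; use V_bound[OF e(1,3)] in \<open>auto simp: space_pair_measure\<close>)+
  have swap: "(LINT p|(\<Omega> \<Otimes>\<^sub>M \<Omega>). \<bar>V \<epsilon> h t (snd p) (fst p)\<bar>) = (LINT p|(\<Omega> \<Otimes>\<^sub>M \<Omega>). \<bar>V \<epsilon> h t (fst p) (snd p)\<bar>)"
    using PP.integral_product_swap[of "\<lambda>p. \<bar>V \<epsilon> h t (fst p) (snd p)\<bar>"] by (simp add: split_beta')
  define F where "F p = Q\<^sup>2 * (5 * (4 * (v (fst p))\<^sup>2 + 4 * (v (snd p))\<^sup>2 + cov_mass * t * \<bar>V \<epsilon> h t (fst p) (snd p)\<bar> + cov_mass * t * \<bar>V \<epsilon> h t (snd p) (fst p)\<bar> + er\<^sup>2))" for p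
  have Fi: "integrable (\<Omega> \<Otimes>\<^sub>M \<Omega>) F" unfolding F_def using v2' Vi by simp
  have XF: "(joint_dev \<epsilon> t x (fst p) (snd p))\<^sup>2 \<le> F p" if p: "p \<in> space (\<Omega> \<Otimes>\<^sub>M \<Omega>)" for p
  proof -
    have \<omega>: "fst p \<in> space \<Omega>" "snd p \<in> space \<Omega>" using p by (auto simp: space_pair_measure)
    let ?a = "\<bar>v (fst p)\<bar>" and ?a' = "\<bar>v (snd p)\<bar>" and ?b = "\<bar>V \<epsilon> h t (fst p) (snd p)\<bar>" and ?b' = "\<bar>V \<epsilon> h t (snd p) (fst p)\<bar>"
    have "\<bar>joint_dev \<epsilon> t x (fst p) (snd p)\<bar> \<le> Q * (2 * ?a + 2 * ?a' + ?b + ?b' + er)"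
      using joint_dev_bound[OF e \<omega> small, of x] by (simp add: Q_def er_def v_def)
    then have "(joint_dev \<epsilon> t x (fst p) (snd p))\<^sup>2 \<le> (Q * (2 * ?a + 2 * ?a' + ?b + ?b' + er))\<^sup>2"
      by (intro abs_le_square_iff[THEN iffD1]) (auto intro: order_trans)
    also have "\<dots> = Q\<^sup>2 * (2 * ?a + 2 * ?a' + ?b + ?b' + er)\<^sup>2" by (rule power_mult_distrib)
    also have "\<dots> \<le> Q\<^sup>2 * (5 * ((2 * ?a)\<^sup>2 + (2 * ?a')\<^sup>2 + ?b\<^sup>2 + ?b'\<^sup>2 + er\<^sup>2))"
    proof (intro mult_left_mono)
      have "(y1 + y2 + y3 + y4 + y5)\<^sup>2 \<le> 5 * (y1\<^sup>2 + y2\<^sup>2 + y3\<^sup>2 + y4\<^sup>2 + y5\<^sup>2)" for y1 y2 y3 y4 y5 :: real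
      proof -
        have "0 \<le> (y1-y2)\<^sup>2 + (y1-y3)\<^sup>2 + (y1-y4)\<^sup>2 + (y1-y5)\<^sup>2 + (y2-y3)\<^sup>2 + (y2-y4)\<^sup>2 + (y2-y5)\<^sup>2 + (y3-y4)\<^sup>2 + (y3-y5)\<^sup>2 + (y4-y5)\<^sup>2"
          by simp
        also have "\<dots> = 5 * (y1\<^sup>2 + y2\<^sup>2 + y3\<^sup>2 + y4\<^sup>2 + y5\<^sup>2) - (y1 + y2 + y3 + y4 + y5)\<^sup>2"
          by (simp add: power2_eq_square algebra_simps)
        finally show ?thesis by simp
      qed
      then show "(2 * ?a + 2 * ?a' + ?b + ?b' + er)\<^sup>2 \<le> 5 * ((2 * ?a)\<^sup>2 + (2 * ?a')\<^sup>2 + ?b\<^sup>2 + ?b'\<^sup>2 + er\<^sup>2)" .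
    qed simp
    also have "\<dots> \<le> F p" unfolding F_def
    proof (intro mult_left_mono add_mono)
      show "?b\<^sup>2 \<le> cov_mass * t * ?b" "?b'\<^sup>2 \<le> cov_mass * t * ?b'"
        using V_bound[OF e(1,3) \<omega>, of h] V_bound[OF e(1,3) \<omega>(2,1), of h] 
        unfolding power2_eq_square by (auto intro!: mult_right_mono simp del: abs_mult_self_eq)
    qed (auto simp: power_mult_distrib)
    finally show ?thesis .
  qed
  show "integrable (\<Omega> \<Otimes>\<^sub>M \<Omega>) (\<lambda>p. (joint_dev \<epsilon> t x (fst p) (snd p))\<^sup>2)"
    by (rule Bochner_Integration.integrable_bound[OF Fi]) (measurable, rule AE_I2, use XF in \<open>auto intro: order_trans[OF _ abs_ge_self]\<close>)
  then have "(LINT p|(\<Omega> \<Otimes>\<^sub>M \<Omega>). (joint_dev \<epsilon> t x (fst p) (snd p))\<^sup>2) \<le> (LINT p|(\<Omega> \<Otimes>\<^sub>M \<Omega>). F p)"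
    by (rule integral_mono[OF _ Fi]) (rule XF)
  also have "\<dots> = Q\<^sup>2 * (5 * (8 * (LINT \<omega>|\<Omega>. (v \<omega>)\<^sup>2) + 2 * (cov_mass * t * (LINT p|(\<Omega> \<Otimes>\<^sub>M \<Omega>). \<bar>V \<epsilon> h t (fst p) (snd p)\<bar>)) + er\<^sup>2))"
    unfolding F_def using v2' Vi swap by (simp add: P.prob_space)
  also have "\<dots> \<le> joint_dev_bound_L2 \<epsilon> h t"
    unfolding joint_dev_bound_L2_def Q_def[symmetric] er_def[symmetric]
    using V_L2_bound[OF e(1-3)] cross_term_bound[OF e(1,3), of h] At
    by (intro mult_left_mono add_mono order_refl) (auto simp: V_bound_L2_def v_def)
  finally show "(LINT p|(\<Omega> \<Otimes>\<^sub>M \<Omega>). (joint_dev \<epsilon> t x (fst p) (snd p))\<^sup>2) \<le> joint_dev_bound_L2 \<epsilon> h t" .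
qed

lemma joint_dev_bound_L2_tendsto: "((\<lambda>\<epsilon>. joint_dev_bound_L2 \<epsilon> (delay \<epsilon>) t) \<longlongrightarrow> 0) (at_right 0)"
proof -
  have tl: "((\<lambda>\<epsilon>. mean_cov_tail (delay \<epsilon>)) \<longlongrightarrow> 0) (at_right 0)"
    by (rule filterlim_compose[OF mean_cov_tail_tendsto delay_limits(2)])
  have e: "((\<lambda>\<epsilon>::real. \<epsilon>) \<longlongrightarrow> 0) (at_right 0)" by (rule tendsto_ident_at)
  have "((\<lambda>\<epsilon>. joint_dev_bound_L2 \<epsilon> (delay \<epsilon>) t) \<longlongrightarrow> (exp (2 * (4 * cov_mass * t + 1)))\<^sup>2 * (5 * (8 * (16 * cov_mass\<^sup>2 * 0 * t + 2 * (2 * cov_mass * 0 + 0 * t)\<^sup>2)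
     + 2 * (cov_mass * t * (0 * cov_L1 * (2 * sqrt t))) + (2 * (0 * t) + 0 * t)\<^sup>2))) (at_right 0)"
    unfolding joint_dev_bound_L2_def V_bound_L2_def
    by (intro tendsto_mult tendsto_add tendsto_const tendsto_power delay_limits(1) tl err_tendsto e)
  then show ?thesis by simp
qed

lemma joint_dev_eq:
  assumes e: "0 < \<epsilon>" "0 \<le> t" and \<omega>: "\<omega> \<in> space \<Omega>" "\<omega>' \<in> space \<Omega>"
  shows "joint_dev \<epsilon> t x \<omega> \<omega>' = (LINT a|S. (fk_weight \<epsilon> t x \<omega> a - exp (t * \<Sigma>)) * (fk_weight \<epsilon> t x \<omega>' a - exp (t * \<Sigma>)))"
proof -
  have "(LINT a|S. (fk_weight \<epsilon> t x \<omega> a - exp (t * \<Sigma>)) * (fk_weight \<epsilon> t x \<omega>' a - exp (t * \<Sigma>)))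
    = (LINT a|S. fk_weight \<epsilon> t x \<omega> a * fk_weight \<epsilon> t x \<omega>' a - exp (t * \<Sigma>) * fk_weight \<epsilon> t x \<omega> a - exp (t * \<Sigma>) * fk_weight \<epsilon> t x \<omega>' a + (exp (t * \<Sigma>))\<^sup>2)"
    by (intro Bochner_Integration.integral_cong refl) (simp add: algebra_simps power2_eq_square)
  also have "\<dots> = joint_dev \<epsilon> t x \<omega> \<omega>'"
    unfolding joint_dev_def m1_def m2_def using ZZ_integrable[OF e \<omega>] fk_weight_integrable[OF e \<omega>(1)] fk_weight_integrable[OF e \<omega>(2)]
    by (simp add: env.prob_space)
  finally show ?thesis by simp
qed

text \<open>The square of an expectation over paths is an expectation over two independent paths.
  Fubini then moves the average over the environment inside, where it acts on the weights alone and
  produces \<open>joint_dev\<close>.\<close>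

lemma second_moment_identity:
  assumes e: "0 < \<epsilon>" "0 \<le> t" and f: "integrable \<Omega> f"
  shows "(LINT a|S. ((LINT \<omega>|\<Omega>. f \<omega> * fk_weight \<epsilon> t x \<omega> a) - (LINT \<omega>|\<Omega>. f \<omega>) * exp (t * \<Sigma>))\<^sup>2)
    = (LINT p|(\<Omega> \<Otimes>\<^sub>M \<Omega>). f (fst p) * f (snd p) * joint_dev \<epsilon> t x (fst p) (snd p))"
proof -
  interpret P: prob_space "\<Omega> \<Otimes>\<^sub>M \<Omega>" by (intro prob_space_pair bm.prob_space_axioms)
  interpret SP: pair_sigma_finite S "\<Omega> \<Otimes>\<^sub>M \<Omega>" ..
  define \<kappa> where "\<kappa> = exp (t * \<Sigma>)"
  define L where "L = exp (1 / \<epsilon> * (K * t)) + \<kappa>"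
  define H where "H \<omega> a = f \<omega> * (fk_weight \<epsilon> t x \<omega> a - \<kappa>)" for \<omega> a
  have fm[measurable]: "f \<in> borel_measurable \<Omega>" using f by auto
  have Zk: "\<bar>fk_weight \<epsilon> t x \<omega> a - \<kappa>\<bar> \<le> L" if "\<omega> \<in> space \<Omega>" "a \<in> space S" for \<omega> a
    using fk_weight_bounds[OF e that, of x] fk_weight_pos[of \<epsilon> t x \<omega> a] exp_gt_zero[of "t * \<Sigma>"]
    unfolding L_def \<kappa>_def by linarith
  have L0: "0 \<le> L" by (simp add: L_def \<kappa>_def)
  have Hb: "\<bar>H \<omega> a\<bar> \<le> \<bar>f \<omega>\<bar> * L" if "\<omega> \<in> space \<Omega>" "a \<in> space S" for \<omega> a
    unfolding H_def abs_mult using Zk[OF that] by (intro mult_left_mono) auto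
  have Hi: "integrable \<Omega> (\<lambda>\<omega>. H \<omega> a)" if a: "a \<in> space S" for a
  proof (rule Bochner_Integration.integrable_bound)
    show "integrable \<Omega> (\<lambda>\<omega>. \<bar>f \<omega>\<bar> * L)" using f by simp
    show "(\<lambda>\<omega>. H \<omega> a) \<in> borel_measurable \<Omega>" unfolding H_def using a by measurable
  qed (rule AE_I2, use Hb a L0 in \<open>auto simp: abs_mult\<close>)
  have Zi: "integrable \<Omega> (\<lambda>\<omega>. f \<omega> * fk_weight \<epsilon> t x \<omega> a)" if a: "a \<in> space S" for a
  proof -
    have "integrable \<Omega> (\<lambda>\<omega>. H \<omega> a + f \<omega> * \<kappa>)" using Hi[OF a] f by simp
    then show ?thesis by (simp add: H_def algebra_simps)
  qed
  define G where "G p a = H (fst p) a * H (snd p) a" for p a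
  have [measurable]: "(\<lambda>(a, p). G p a) \<in> borel_measurable (S \<Otimes>\<^sub>M (\<Omega> \<Otimes>\<^sub>M \<Omega>))"
    unfolding G_def H_def by measurable
  \<comment> \<open>\<open>f\<close> is merely integrable, but the product of \<open>f\<close> along
    two independent paths is integrable too, and for fixed \<epsilon> the weights are bounded; this
    dominates \<open>G\<close> uniformly in the environment.\<close>
  have ff: "integrable (\<Omega> \<Otimes>\<^sub>M \<Omega>) (\<lambda>p. \<bar>f (fst p)\<bar> * \<bar>f (snd p)\<bar> * L\<^sup>2)"
    using bm.integral_product_square(1)[of "\<lambda>\<omega>. \<bar>f \<omega>\<bar>"] f by simp
  have Gb: "\<bar>G p a\<bar> \<le> \<bar>f (fst p)\<bar> * \<bar>f (snd p)\<bar> * L\<^sup>2" if "p \<in> space (\<Omega> \<Otimes>\<^sub>M \<Omega>)" "a \<in> space S" for p a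
  proof -
    have "\<bar>G p a\<bar> \<le> (\<bar>f (fst p)\<bar> * L) * (\<bar>f (snd p)\<bar> * L)"
      unfolding G_def abs_mult using that Hb L0 by (intro mult_mono) (auto simp: space_pair_measure)
    then show ?thesis by (simp add: power2_eq_square mult_ac)
  qed
  have Gi: "integrable (\<Omega> \<Otimes>\<^sub>M \<Omega>) (\<lambda>p. G p a)" "(LINT p|(\<Omega> \<Otimes>\<^sub>M \<Omega>). G p a) = (LINT \<omega>|\<Omega>. H \<omega> a)\<^sup>2" if "a \<in> space S" for a
    unfolding G_def using bm.integral_product_square[OF Hi[OF that]] by auto
  have "(LINT a|S. ((LINT \<omega>|\<Omega>. f \<omega> * fk_weight \<epsilon> t x \<omega> a) - (LINT \<omega>|\<Omega>. f \<omega>) * \<kappa>)\<^sup>2) = (LINT a|S. (LINT p|(\<Omega> \<Otimes>\<^sub>M \<Omega>). G p a))"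
  proof (intro Bochner_Integration.integral_cong refl)
    fix a assume a: "a \<in> space S"
    have "(LINT \<omega>|\<Omega>. f \<omega> * fk_weight \<epsilon> t x \<omega> a) - (LINT \<omega>|\<Omega>. f \<omega>) * \<kappa> = (LINT \<omega>|\<Omega>. H \<omega> a)"
      using Zi[OF a] f by (simp add: H_def right_diff_distrib)
    then show "((LINT \<omega>|\<Omega>. f \<omega> * fk_weight \<epsilon> t x \<omega> a) - (LINT \<omega>|\<Omega>. f \<omega>) * \<kappa>)\<^sup>2 = (LINT p|(\<Omega> \<Otimes>\<^sub>M \<Omega>). G p a)"
      by (simp add: Gi(2)[OF a])
  qed
  also have "\<dots> = (LINT p|(\<Omega> \<Otimes>\<^sub>M \<Omega>). (LINT a|S. G p a))"
  proof (rule SP.Fubini_integral[symmetric])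
    show "integrable (S \<Otimes>\<^sub>M (\<Omega> \<Otimes>\<^sub>M \<Omega>)) (\<lambda>(a, p). G p a)"
    proof (rule SP.Fubini_integrable)
      show "AE a in S. integrable (\<Omega> \<Otimes>\<^sub>M \<Omega>) (\<lambda>p. case (a, p) of (a, p) \<Rightarrow> G p a)"
        by (rule AE_I2) (simp add: Gi)
      show "integrable S (\<lambda>a. LINT p|(\<Omega> \<Otimes>\<^sub>M \<Omega>). norm (case (a, p) of (a, p) \<Rightarrow> G p a))"
      proof (rule env.integrable_bounded)
        fix a assume a: "a \<in> space S"
        have "(LINT p|(\<Omega> \<Otimes>\<^sub>M \<Omega>). \<bar>G p a\<bar>) \<le> (LINT p|(\<Omega> \<Otimes>\<^sub>M \<Omega>). \<bar>f (fst p)\<bar> * \<bar>f (snd p)\<bar> * L\<^sup>2)"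
          by (rule integral_mono) (use ff Gb a Gi in auto)
        moreover have "0 \<le> (LINT p|(\<Omega> \<Otimes>\<^sub>M \<Omega>). \<bar>G p a\<bar>)" by simp
        ultimately show "\<bar>LINT p|(\<Omega> \<Otimes>\<^sub>M \<Omega>). norm (case (a, p) of (a, p) \<Rightarrow> G p a)\<bar>
           \<le> (LINT p|(\<Omega> \<Otimes>\<^sub>M \<Omega>). \<bar>f (fst p)\<bar> * \<bar>f (snd p)\<bar> * L\<^sup>2)" by simp
      qed measurable
    qed measurable
  qed
  also have "\<dots> = (LINT p|(\<Omega> \<Otimes>\<^sub>M \<Omega>). f (fst p) * f (snd p) * joint_dev \<epsilon> t x (fst p) (snd p))"
  proof (intro Bochner_Integration.integral_cong refl)
    fix p assume "p \<in> space (\<Omega> \<Otimes>\<^sub>M \<Omega>)"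
    then have \<omega>: "fst p \<in> space \<Omega>" "snd p \<in> space \<Omega>" by (auto simp: space_pair_measure)
    have "(LINT a|S. G p a) = (LINT a|S. f (fst p) * f (snd p) * ((fk_weight \<epsilon> t x (fst p) a - \<kappa>) * (fk_weight \<epsilon> t x (snd p) a - \<kappa>)))"
      by (simp add: G_def H_def mult_ac)
    then show "(LINT a|S. G p a) = f (fst p) * f (snd p) * joint_dev \<epsilon> t x (fst p) (snd p)"
      by (simp add: joint_dev_eq[OF e \<omega>] \<kappa>_def)
  qed
  finally show ?thesis by (simp add: \<kappa>_def)
qed

text \<open>The Cauchy--Schwarz inequality in the form of Young's inequality with weight
  \<open>\<theta>\<close>. Square integrability of \<open>f\<close> suffices, since the second
  moment of the product along two independent paths is the square of that of
  \<open>f\<close>.\<close>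

lemma second_moment_bound:
  assumes e: "0 < \<epsilon>" "0 \<le> h" "0 \<le> t" and f: "integrable \<Omega> f" "integrable \<Omega> (\<lambda>\<omega>. (f \<omega>)\<^sup>2)"
    and small: "err 1 \<epsilon> h * t \<le> 1" "err 2 \<epsilon> h * t \<le> 1"
    and \<theta>: "0 < \<theta>" "joint_dev_bound_L2 \<epsilon> h t \<le> \<theta>\<^sup>2"
  shows "(LINT a|S. ((LINT \<omega>|\<Omega>. f \<omega> * fk_weight \<epsilon> t x \<omega> a) - (LINT \<omega>|\<Omega>. f \<omega>) * exp (t * \<Sigma>))\<^sup>2)
    \<le> \<theta> * (((LINT \<omega>|\<Omega>. (f \<omega>)\<^sup>2)\<^sup>2 + 1) / 2)"
proof -
  note X2 = joint_dev_square_integral[OF e small, of x]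
  have fm[measurable]: "f \<in> borel_measurable \<Omega>" using f by auto
  define G where "G p = f (fst p) * f (snd p)" for p :: "'w \<times> 'w"
  define Y where "Y p = joint_dev \<epsilon> t x (fst p) (snd p)" for p
  have [measurable]: "G \<in> borel_measurable (\<Omega> \<Otimes>\<^sub>M \<Omega>)" "Y \<in> borel_measurable (\<Omega> \<Otimes>\<^sub>M \<Omega>)" unfolding G_def Y_def by measurable
  have G2: "integrable (\<Omega> \<Otimes>\<^sub>M \<Omega>) (\<lambda>p. (G p)\<^sup>2)" "(LINT p|(\<Omega> \<Otimes>\<^sub>M \<Omega>). (G p)\<^sup>2) = (LINT \<omega>|\<Omega>. (f \<omega>)\<^sup>2)\<^sup>2"
    using bm.integral_product_square[OF f(2)] by (simp_all add: G_def power_mult_distrib)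
  have i: "integrable (\<Omega> \<Otimes>\<^sub>M \<Omega>) (\<lambda>p. (\<theta> * (G p)\<^sup>2 + (Y p)\<^sup>2 / \<theta>) / 2)" using G2 X2(1) by (simp add: Y_def)
  have le: "\<bar>G p * Y p\<bar> \<le> (\<theta> * (G p)\<^sup>2 + (Y p)\<^sup>2 / \<theta>) / 2" for p
  proof -
    have "0 \<le> (\<theta> * \<bar>G p\<bar> - \<bar>Y p\<bar>)\<^sup>2 / \<theta>" using \<theta>(1) by simp
    also have "\<dots> = \<theta> * (G p)\<^sup>2 + (Y p)\<^sup>2 / \<theta> - 2 * \<bar>G p * Y p\<bar>"
      using \<theta>(1) by (simp add: power2_eq_square field_simps abs_mult)
    finally show ?thesis by simp
  qed
  have GY: "integrable (\<Omega> \<Otimes>\<^sub>M \<Omega>) (\<lambda>p. G p * Y p)"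
    by (rule Bochner_Integration.integrable_bound[OF i]) (measurable, rule AE_I2, use le in \<open>auto intro: order_trans[OF _ abs_ge_self]\<close>)
  have "(LINT p|(\<Omega> \<Otimes>\<^sub>M \<Omega>). G p * Y p) \<le> (LINT p|(\<Omega> \<Otimes>\<^sub>M \<Omega>). (\<theta> * (G p)\<^sup>2 + (Y p)\<^sup>2 / \<theta>) / 2)"
    by (rule integral_mono[OF GY i]) (rule order_trans[OF abs_ge_self le])
  also have "\<dots> = (\<theta> * (LINT \<omega>|\<Omega>. (f \<omega>)\<^sup>2)\<^sup>2 + (LINT p|(\<Omega> \<Otimes>\<^sub>M \<Omega>). (Y p)\<^sup>2) / \<theta>) / 2"
    using G2 X2(1) by (simp add: Y_def)
  also have "\<dots> \<le> (\<theta> * (LINT \<omega>|\<Omega>. (f \<omega>)\<^sup>2)\<^sup>2 + \<theta>\<^sup>2 / \<theta>) / 2"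
    using X2(2) \<theta> by (intro divide_right_mono add_mono) (auto simp: Y_def)
  also have "\<dots> = \<theta> * (((LINT \<omega>|\<Omega>. (f \<omega>)\<^sup>2)\<^sup>2 + 1) / 2)" using \<theta>(1) by (simp add: power2_eq_square distrib_left)
  finally show ?thesis
    unfolding second_moment_identity[OF e(1,3) f(1)] by (simp add: G_def Y_def)
qed

section \<open>Mean square convergence of the Feynman--Kac formula\<close>

lemma u_eps_eq:
  assumes "0 < \<epsilon>" "0 \<le> t"
  shows "u_eps \<Omega> B c g \<epsilon> t x a = (LINT \<omega>|\<Omega>. g (x + BP t \<omega>) * fk_weight \<epsilon> t x \<omega> a)"
proof -
  have "(LINT s:{0..t}|lborel. c (s / \<epsilon>\<^sup>2) ((x + B s \<omega>) / \<epsilon>) a) = (LINT s:{0..t}|lborel. cp (s / \<epsilon>\<^sup>2) ((x + BP s \<omega>) / \<epsilon>) a)" for \<omega>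
    unfolding set_lebesgue_integral_def
    by (intro Bochner_Integration.integral_cong refl) (use assms in \<open>auto simp: indicator_def cp_eq BP_eq\<close>)
  then show ?thesis using assms by (simp add: u_eps_def fk_weight_def BP_eq)
qed

lemma Sigma_eff_eq: "Sigma_eff S \<Omega> B c = \<Sigma>"
  unfolding Sigma_eff_def \<Sigma>_def mean_cov_def set_lebesgue_integral_def
  by (intro Bochner_Integration.integral_cong refl) (auto simp: indicator_def BP_eq)

text \<open>For positive times the density bound compares with the Lebesgue norm of
  \<open>g\<close>; at time 0 the law is a point mass and the integrand is constant.\<close>

lemma g_path_square_integrable:
  fixes g :: "real \<Rightarrow> real"
  assumes [measurable]: "g \<in> borel_measurable borel" and g2: "integrable lborel (\<lambda>x. (g x)\<^sup>2)" and t: "0 \<le> t"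
  shows "integrable \<Omega> (\<lambda>\<omega>. (g (x + BP t \<omega>))\<^sup>2)" "integrable \<Omega> (\<lambda>\<omega>. g (x + BP t \<omega>))"
proof -
  show 1: "integrable \<Omega> (\<lambda>\<omega>. (g (x + BP t \<omega>))\<^sup>2)"
  proof (cases "t = 0")
    case True
    show ?thesis
      by (rule bm.integrable_bounded[where C="(g x)\<^sup>2"]) (measurable, use True B_0 in \<open>simp add: BP_def\<close>)
  next
    case False
    then have t: "0 < t" using t by simp
    show ?thesis
    proof (rule integrableI_bounded)
      have "(\<integral>\<^sup>+\<omega>. ennreal (norm ((g (x + BP t \<omega>))\<^sup>2)) \<partial>\<Omega>) \<le> ennreal (1 / sqrt (2 * pi * t)) * (\<integral>\<^sup>+z. ennreal ((g (x + z))\<^sup>2) \<partial>lborel)"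
        using BP_density_bound[of "\<lambda>z. ennreal ((g (x + z))\<^sup>2)" t] t by simp
      also have "(\<integral>\<^sup>+z. ennreal ((g (x + z))\<^sup>2) \<partial>lborel) = (\<integral>\<^sup>+z. ennreal ((g z)\<^sup>2) \<partial>lborel)"
        using nn_integral_real_affine[of "\<lambda>z. ennreal ((g z)\<^sup>2)" 1 x] by simp
      also have "\<dots> = ennreal (LINT z|lborel. (g z)\<^sup>2)" using g2 by (intro nn_integral_eq_integral) auto
      also have "ennreal (1 / sqrt (2 * pi * t)) * \<dots> < \<infinity>" by (simp add: ennreal_mult_less_top)
      finally show "(\<integral>\<^sup>+\<omega>. ennreal (norm ((g (x + BP t \<omega>))\<^sup>2)) \<partial>\<Omega>) < \<infinity>" .
    qed measurable
  qed
  show "integrable \<Omega> (\<lambda>\<omega>. g (x + BP t \<omega>))"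
    by (rule bm.square_integrable_imp_integrable[OF _ 1]) measurable
qed

lemma u_eps_converges:
  fixes g :: "real \<Rightarrow> real"
  assumes g[measurable]: "g \<in> borel_measurable borel" and g2: "integrable lborel (\<lambda>x. (g x)\<^sup>2)" and t: "0 \<le> t"
  shows "converges_in_L2 S (\<lambda>\<epsilon>. u_eps \<Omega> B c g \<epsilon> t x) (\<lambda>_. u_lim \<Omega> B g \<Sigma> t x) (at_right 0)"
proof -
  define f where "f \<omega> = g (x + BP t \<omega>)" for \<omega>
  have [measurable]: "f \<in> borel_measurable \<Omega>" unfolding f_def by measurable
  have f: "integrable \<Omega> f" "integrable \<Omega> (\<lambda>\<omega>. (f \<omega>)\<^sup>2)"
    unfolding f_def using g_path_square_integrable[OF g g2 t] by auto
  have u: "u_eps \<Omega> B c g \<epsilon> t x = (\<lambda>a. LINT \<omega>|\<Omega>. f \<omega> * fk_weight \<epsilon> t x \<omega> a)" if "0 < \<epsilon>" for \<epsilon>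
    using u_eps_eq[OF that t] by (auto simp: f_def)
  have ul: "u_lim \<Omega> B g \<Sigma> t x = (LINT \<omega>|\<Omega>. f \<omega>) * exp (t * \<Sigma>)"
    using t by (simp add: u_lim_def f_def BP_eq)
  have pos: "eventually (\<lambda>\<epsilon>::real. 0 < \<epsilon>) (at_right 0)" by (rule eventually_at_right_less)
  show ?thesis unfolding converges_in_L2_def
  proof (intro conjI)
    show "\<forall>\<^sub>F \<epsilon> in at_right 0. square_integrable S (u_eps \<Omega> B c g \<epsilon> t x)"
      using pos
    proof eventually_elim
      case (elim \<epsilon>)
      \<comment> \<open>Square integrability is claimed for each \<epsilon> separately, so the crude
        bound on the weight, which explodes as \<epsilon> tends to 0, is good enough here.\<close>
      define L where "L = exp (1 / \<epsilon> * (K * t))"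
      have m: "(\<lambda>a. LINT \<omega>|\<Omega>. f \<omega> * fk_weight \<epsilon> t x \<omega> a) \<in> borel_measurable S" by measurable
      have b: "\<bar>LINT \<omega>|\<Omega>. f \<omega> * fk_weight \<epsilon> t x \<omega> a\<bar> \<le> (LINT \<omega>|\<Omega>. \<bar>f \<omega>\<bar> * L)" if a: "a \<in> space S" for a
      proof -
        have le: "\<bar>f \<omega> * fk_weight \<epsilon> t x \<omega> a\<bar> \<le> \<bar>f \<omega>\<bar> * L" if "\<omega> \<in> space \<Omega>" for \<omega>
          unfolding abs_mult using fk_weight_bounds(1)[OF elim t that a, of x] fk_weight_pos[of \<epsilon> t x \<omega> a] 
          by (intro mult_left_mono) (auto simp: L_def)
        have i: "integrable \<Omega> (\<lambda>\<omega>. \<bar>f \<omega>\<bar> * L)" using f by simp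
        have "integrable \<Omega> (\<lambda>\<omega>. f \<omega> * fk_weight \<epsilon> t x \<omega> a)"
          by (rule Bochner_Integration.integrable_bound[OF i]) (use a le in \<open>auto intro: order_trans[OF _ abs_ge_self]\<close>)
        then have "(LINT \<omega>|\<Omega>. \<bar>f \<omega> * fk_weight \<epsilon> t x \<omega> a\<bar>) \<le> (LINT \<omega>|\<Omega>. \<bar>f \<omega>\<bar> * L)"
          by (intro integral_mono i integrable_abs) (use le in auto)
        then show ?thesis using integral_abs_bound[of \<Omega> "\<lambda>\<omega>. f \<omega> * fk_weight \<epsilon> t x \<omega> a"] by linarith
      qed
      have "integrable S (\<lambda>a. (LINT \<omega>|\<Omega>. f \<omega> * fk_weight \<epsilon> t x \<omega> a)\<^sup>2)"
        by (rule env.integrable_bounded[where C="(LINT \<omega>|\<Omega>. \<bar>f \<omega>\<bar> * L)\<^sup>2"])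
           (measurable, unfold abs_power2 abs_le_square_iff[symmetric], rule order_trans[OF b abs_ge_self])
      with m show ?case by (simp add: square_integrable_def u[OF elim])
    qed
    show "square_integrable S (\<lambda>_. u_lim \<Omega> B g \<Sigma> t x)" by (simp add: square_integrable_def)
    \<comment> \<open>The square root balances the two halves of Young's inequality; the added
      \<epsilon> keeps \<open>\<theta>\<close> positive.\<close>
    define \<theta> where "\<theta> \<epsilon> = sqrt (joint_dev_bound_L2 \<epsilon> (delay \<epsilon>) t + \<epsilon>)" for \<epsilon>
    have "((\<lambda>\<epsilon>. sqrt (joint_dev_bound_L2 \<epsilon> (delay \<epsilon>) t + \<epsilon>)) \<longlongrightarrow> sqrt (0 + 0)) (at_right 0)"
      by (intro tendsto_real_sqrt tendsto_add joint_dev_bound_L2_tendsto tendsto_ident_at)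
    then have \<theta>: "(\<theta> \<longlongrightarrow> 0) (at_right 0)" by (simp add: \<theta>_def[abs_def])
    have sm: "eventually (\<lambda>\<epsilon>. err N \<epsilon> (delay \<epsilon>) * t \<le> 1) (at_right 0)" for N
    proof -
      have "((\<lambda>\<epsilon>. err N \<epsilon> (delay \<epsilon>) * t) \<longlongrightarrow> 0 * t) (at_right 0)" by (intro tendsto_mult err_tendsto tendsto_const)
      then have "((\<lambda>\<epsilon>. err N \<epsilon> (delay \<epsilon>) * t) \<longlongrightarrow> 0) (at_right 0)" by simp
      from order_tendstoD(2)[OF this, of 1] show ?thesis by (auto elim: eventually_mono)
    qed
    \<comment> \<open>The bound is nonnegative because it dominates the integral of a square once
      the errors are small; this makes the square of \<open>\<theta>\<close> equal to the expression
      under the root.\<close>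
    have X0: "eventually (\<lambda>\<epsilon>. 0 \<le> joint_dev_bound_L2 \<epsilon> (delay \<epsilon>) t) (at_right 0)"
      using pos sm[of 1] sm[of 2]
    proof eventually_elim
      case (elim \<epsilon>)
      have "0 \<le> (LINT p|(\<Omega> \<Otimes>\<^sub>M \<Omega>). (joint_dev \<epsilon> t x (fst p) (snd p))\<^sup>2)" by simp
      then show ?case using joint_dev_square_integral(2)[OF elim(1) delay_nonneg t elim(2,3), of x] by linarith
    qed
    define M where "M = ((LINT \<omega>|\<Omega>. (f \<omega>)\<^sup>2)\<^sup>2 + 1) / 2"
    have "((\<lambda>\<epsilon>. \<theta> \<epsilon> * M) \<longlongrightarrow> 0 * M) (at_right 0)" by (intro tendsto_mult \<theta> tendsto_const)
    then have lim: "((\<lambda>\<epsilon>. \<theta> \<epsilon> * M) \<longlongrightarrow> 0) (at_right 0)" by simp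
    show "((\<lambda>\<epsilon>. LINT a|S. (u_eps \<Omega> B c g \<epsilon> t x a - u_lim \<Omega> B g \<Sigma> t x)\<^sup>2) \<longlongrightarrow> 0) (at_right 0)"
    proof (rule tendsto_sandwich[OF _ _ tendsto_const lim])
      show "eventually (\<lambda>\<epsilon>. (LINT a|S. (u_eps \<Omega> B c g \<epsilon> t x a - u_lim \<Omega> B g \<Sigma> t x)\<^sup>2) \<le> \<theta> \<epsilon> * M) (at_right 0)"
        using pos sm[of 1] sm[of 2] X0
      proof eventually_elim
        case (elim \<epsilon>)
        have "0 < \<theta> \<epsilon>" "joint_dev_bound_L2 \<epsilon> (delay \<epsilon>) t \<le> (\<theta> \<epsilon>)\<^sup>2" using elim by (auto simp: \<theta>_def)
        from second_moment_bound[OF elim(1) delay_nonneg t f elim(2,3) this, of x]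
        show ?case by (simp add: u[OF elim(1)] ul M_def)
      qed
    qed simp
  qed
qed

end

subsection \<open>The heat kernel with square integrable initial data\<close>

lemma has_real_derivative_integral:
  fixes F F' :: "real \<Rightarrow> 'a \<Rightarrow> real"
  assumes \<theta>: "\<theta> \<in> {a<..<b}"
    and F: "\<And>s. s \<in> {a<..<b} \<Longrightarrow> integrable M (F s)"
    and F': "\<And>s. s \<in> {a<..<b} \<Longrightarrow> F' s \<in> borel_measurable M"
    and D: "\<And>s y. s \<in> {a<..<b} \<Longrightarrow> y \<in> space M \<Longrightarrow> ((\<lambda>s. F s y) has_real_derivative F' s y) (at s)"
    and w: "integrable M w" and bound: "\<And>s y. s \<in> {a<..<b} \<Longrightarrow> y \<in> space M \<Longrightarrow> \<bar>F' s y\<bar> \<le> w y"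
  shows "((\<lambda>s. LINT y|M. F s y) has_real_derivative (LINT y|M. F' \<theta> y)) (at \<theta>)"
  unfolding has_field_derivative_iff tendsto_at_iff_sequentially
proof (intro allI impI)
  fix X :: "nat \<Rightarrow> real" assume X0: "\<forall>i. X i \<in> UNIV - {\<theta>}" and X: "X \<longlonglongrightarrow> \<theta>"
  have "eventually (\<lambda>n. X n \<in> {a<..<b}) sequentially"
    using topological_tendstoD[OF X open_greaterThanLessThan \<theta>] .
  then obtain N where N: "\<And>n. n \<ge> N \<Longrightarrow> X n \<in> {a<..<b}" by (auto simp: eventually_sequentially)
  \<comment> \<open>Dropping finitely many terms puts the whole sequence inside the interval on
    which the derivative is dominated.\<close>
  define Y where "Y n = X (n + N)" for n
  have Y: "Y n \<in> {a<..<b}" "Y n \<noteq> \<theta>" for n using N X0 by (auto simp: Y_def)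
  have YL: "Y \<longlonglongrightarrow> \<theta>" unfolding Y_def using X by (rule LIMSEQ_ignore_initial_segment)
  have "(\<lambda>n. LINT y|M. (F (Y n) y - F \<theta> y) / (Y n - \<theta>)) \<longlonglongrightarrow> (LINT y|M. F' \<theta> y)"
  proof (rule integral_dominated_convergence[where w=w])
    show "F' \<theta> \<in> borel_measurable M" by (rule F'[OF \<theta>])
    show "(\<lambda>y. (F (Y n) y - F \<theta> y) / (Y n - \<theta>)) \<in> borel_measurable M" for n
      using borel_measurable_integrable[OF F[OF \<theta>]] borel_measurable_integrable[OF F[OF Y(1)], of n] by measurable
    show "AE y in M. (\<lambda>n. (F (Y n) y - F \<theta> y) / (Y n - \<theta>)) \<longlonglongrightarrow> F' \<theta> y"
    proof (rule AE_I2)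
      fix y assume "y \<in> space M"
      from D[OF \<theta> this] have "((\<lambda>s. (F s y - F \<theta> y) / (s - \<theta>)) \<longlongrightarrow> F' \<theta> y) (at \<theta>)"
        by (simp add: has_field_derivative_iff)
      then show "(\<lambda>n. (F (Y n) y - F \<theta> y) / (Y n - \<theta>)) \<longlonglongrightarrow> F' \<theta> y"
        unfolding tendsto_at_iff_sequentially comp_def using Y YL by blast
    qed
    show "AE y in M. norm ((F (Y n) y - F \<theta> y) / (Y n - \<theta>)) \<le> w y" for n
    proof (rule AE_I2)
      fix y assume y: "y \<in> space M"
      \<comment> \<open>The mean value inequality turns the majorant of the derivative into one of
        the difference quotients.\<close>
      have "norm (F (Y n) y - F \<theta> y) \<le> w y * norm (Y n - \<theta>)"
        by (rule field_differentiable_bound[where S="{a<..<b}" and f'="\<lambda>s. F' s y"])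
           (use D[OF _ y] bound[OF _ y] Y \<theta> in \<open>auto intro: DERIV_subset\<close>)
      then show "norm ((F (Y n) y - F \<theta> y) / (Y n - \<theta>)) \<le> w y"
        using Y(2)[of n] by (simp add: abs_divide pos_divide_le_eq)
    qed
  qed fact
  moreover have eq: "(LINT y|M. (F (Y n) y - F \<theta> y) / (Y n - \<theta>)) = ((LINT y|M. F (Y n) y) - (LINT y|M. F \<theta> y)) / (Y n - \<theta>)" for n
    using F[OF \<theta>] F[OF Y(1)] by simp
  ultimately have "(\<lambda>n. ((LINT y|M. F (X (n + N)) y) - (LINT y|M. F \<theta> y)) / (X (n + N) - \<theta>)) \<longlonglongrightarrow> (LINT y|M. F' \<theta> y)"
    unfolding eq by (simp only: Y_def)
  then show "((\<lambda>y. (integral\<^sup>L M (F y) - integral\<^sup>L M (F \<theta>)) / (y - \<theta>)) \<circ> X) \<longlonglongrightarrow> integral\<^sup>L M (F' \<theta>)"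
    unfolding comp_def by (rule LIMSEQ_offset)
qed

lemma integrable_inverse_1_plus_shift: "integrable lborel (\<lambda>y::real. 1 / (1 + (y - x)\<^sup>2))"
proof -
  have "einterval (-\<infinity>) \<infinity> = UNIV" by (auto simp: einterval_def)
  then have "integrable lborel (\<lambda>y::real. inverse (1 + y\<^sup>2))"
    using integrable_inverse_1_plus_square by (simp add: set_integrable_def)
  from lborel_integrable_real_affine[OF this, of 1 "-x"] show ?thesis by (simp add: inverse_eq_divide)
qed

text \<open>With \<open>d\<close> the decaying factor,
  \<open>\<bar>g y\<bar> * d \<le> (g y)\<^sup>2 + d\<close> because \<open>d\<close> lies between 0
  and 1. A majorant that is both bounded and integrable is thus enough to pair with a square
  integrable function.\<close>

lemma integrable_L2_inverse_1_plus:
  fixes g :: "real \<Rightarrow> real"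
  assumes [measurable]: "g \<in> borel_measurable borel" and g2: "integrable lborel (\<lambda>x. (g x)\<^sup>2)"
  shows "integrable lborel (\<lambda>y. \<bar>g y\<bar> * (1 / (1 + (y - x)\<^sup>2)))"
proof (rule Bochner_Integration.integrable_bound)
  show "integrable lborel (\<lambda>y. (g y)\<^sup>2 + 1 / (1 + (y - x)\<^sup>2))"
    using g2 integrable_inverse_1_plus_shift by simp
  show "AE y in lborel. norm (\<bar>g y\<bar> * (1 / (1 + (y - x)\<^sup>2))) \<le> norm ((g y)\<^sup>2 + 1 / (1 + (y - x)\<^sup>2))"
  proof (rule AE_I2)
    fix y
    define d where "d = 1 / (1 + (y - x)\<^sup>2)"
    have "0 < 1 + (y - x)\<^sup>2" by (simp add: add_pos_nonneg)
    then have d: "0 \<le> d" "d \<le> 1" by (auto simp: d_def divide_le_eq_1)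
    have "0 \<le> (\<bar>g y\<bar> - d)\<^sup>2" "0 \<le> (g y)\<^sup>2" by auto
    then have "2 * (\<bar>g y\<bar> * d) \<le> (g y)\<^sup>2 + d\<^sup>2" by (simp add: power2_eq_square algebra_simps)
    moreover have "d\<^sup>2 \<le> d" using d by (simp add: power2_eq_square mult_left_le)
    ultimately have "\<bar>g y\<bar> * d \<le> (g y)\<^sup>2 + d" using \<open>0 \<le> (g y)\<^sup>2\<close> d mult_nonneg_nonneg[of "\<bar>g y\<bar>" d] by linarith
    then show "norm (\<bar>g y\<bar> * (1 / (1 + (y - x)\<^sup>2))) \<le> norm ((g y)\<^sup>2 + 1 / (1 + (y - x)\<^sup>2))"
      using d by (simp add: d_def[symmetric] abs_mult)
  qed
qed measurable

text \<open>Recentring at \<open>x0\<close> makes the majorant independent of x in a neighbourhood,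
  as dominated convergence requires.\<close>

lemma inverse_1_plus_shift_le:
  fixes x x0 y :: real
  assumes "\<bar>x - x0\<bar> \<le> 1"
  shows "1 / (1 + (y - x)\<^sup>2) \<le> 3 * (1 / (1 + (y - x0)\<^sup>2))"
proof -
  have "(x - x0)\<^sup>2 \<le> 1" using assms by (simp add: abs_square_le_1)
  moreover have "0 \<le> ((y - x) - (x - x0))\<^sup>2" by simp
  moreover have "(y - x0)\<^sup>2 + ((y - x) - (x - x0))\<^sup>2 = 2 * (y - x)\<^sup>2 + 2 * (x - x0)\<^sup>2"
    by (simp add: power2_eq_square algebra_simps)
  ultimately have "(y - x0)\<^sup>2 \<le> 2 * (y - x)\<^sup>2 + 2" by linarith
  moreover have "1 + p \<le> 3 * (1 + q)" if "p \<le> 2 * q + 2" "0 \<le> q" for p q :: real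
    using that by simp
  ultimately have "1 + (y - x0)\<^sup>2 \<le> 3 * (1 + (y - x)\<^sup>2)" using zero_le_power2 by blast
  then show ?thesis by (simp add: field_simps add_pos_nonneg)
qed

text \<open>A class containing the heat kernel and the derivatives used below. The decay
  \<open>1 / (1 + z\<^sup>2)\<close> is integrable and bounded, hence pairs with square integrable
  initial data; the bound is locally uniform in time away from 0.\<close>

definition dominated_kernel :: "(real \<Rightarrow> real \<Rightarrow> real) \<Rightarrow> bool" where
  "dominated_kernel J \<longleftrightarrow> continuous_on ({0<..} \<times> UNIV) (\<lambda>(t, z). J t z) \<and>
     (\<forall>lo hi. 0 < lo \<longrightarrow> lo \<le> hi \<longrightarrow> (\<exists>C\<ge>0. \<forall>t\<in>{lo..hi}. \<forall>z. \<bar>J t z\<bar> \<le> C * (1 / (1 + z\<^sup>2))))"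

lemma dominated_kernel_measurable:
  assumes "dominated_kernel J" "0 < t"
  shows "(\<lambda>y. J t (y - x)) \<in> borel_measurable borel"
proof -
  have "continuous_on UNIV (\<lambda>y. (\<lambda>(t, z). J t z) (t, y - x))"
    by (rule continuous_on_compose2[of "{0<..} \<times> UNIV" "\<lambda>(t, z). J t z" UNIV "\<lambda>y. (t, y - x)"])
       (use assms in \<open>auto simp: dominated_kernel_def intro!: continuous_intros\<close>)
  then show ?thesis by (simp add: borel_measurable_continuous_onI)
qed

locale L2_initial =
  fixes g :: "real \<Rightarrow> real"
  assumes g_cont: "continuous_on UNIV g" and g2: "integrable lborel (\<lambda>x. (g x)\<^sup>2)"
begin

lemma g_measurable[measurable]: "g \<in> borel_measurable borel"
  by (rule borel_measurable_continuous_onI[OF g_cont])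

text \<open>A single majorant for all t in a compact interval and all x near \<open>x0\<close>; it
  serves for the continuity of the kernel integral and for both of its derivatives.\<close>

lemma kernel_bound:
  assumes J: "dominated_kernel J" and "0 < lo" "lo \<le> hi"
  obtains w where "integrable lborel w"
    "\<And>t x y. t \<in> {lo..hi} \<Longrightarrow> \<bar>x - x0\<bar> \<le> 1 \<Longrightarrow> \<bar>g y * J t (y - x)\<bar> \<le> w y"
proof -
  obtain C where C: "C \<ge> 0" "\<And>t z. t \<in> {lo..hi} \<Longrightarrow> \<bar>J t z\<bar> \<le> C * (1 / (1 + z\<^sup>2))"
    using assms by (auto simp: dominated_kernel_def) (metis atLeastAtMost_iff)
  show ?thesis
  proof (rule that[of "\<lambda>y. 3 * C * (\<bar>g y\<bar> * (1 / (1 + (y - x0)\<^sup>2)))"])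
    show "integrable lborel (\<lambda>y. 3 * C * (\<bar>g y\<bar> * (1 / (1 + (y - x0)\<^sup>2))))"
      by (intro integrable_mult_right integrable_L2_inverse_1_plus g2) simp
    fix t x y assume tx: "t \<in> {lo..hi}" "\<bar>x - x0\<bar> \<le> 1"
    have "\<bar>J t (y - x)\<bar> \<le> C * (1 / (1 + (y - x)\<^sup>2))" by (rule C(2)[OF tx(1)])
    also have "\<dots> \<le> C * (3 * (1 / (1 + (y - x0)\<^sup>2)))" by (intro mult_left_mono inverse_1_plus_shift_le tx C)
    finally have "\<bar>g y\<bar> * \<bar>J t (y - x)\<bar> \<le> \<bar>g y\<bar> * (C * (3 * (1 / (1 + (y - x0)\<^sup>2))))"
      by (rule mult_left_mono) simp
    then show "\<bar>g y * J t (y - x)\<bar> \<le> 3 * C * (\<bar>g y\<bar> * (1 / (1 + (y - x0)\<^sup>2)))"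
      by (simp only: abs_mult mult_ac)
  qed
qed

lemma kernel_integrable:
  assumes J: "dominated_kernel J" and t: "0 < t"
  shows "integrable lborel (\<lambda>y. g y * J t (y - x))"
proof -
  obtain w where w: "integrable lborel w" "\<And>s x' y. s \<in> {t..t} \<Longrightarrow> \<bar>x' - x\<bar> \<le> 1 \<Longrightarrow> \<bar>g y * J s (y - x')\<bar> \<le> w y"
    using kernel_bound[OF J t order_refl] by blast
  note [measurable] = dominated_kernel_measurable[OF J t, of x]
  show ?thesis
    by (rule Bochner_Integration.integrable_bound[OF w(1)]) (measurable, rule AE_I2, use w(2)[of t x] in \<open>auto intro: order_trans[OF _ abs_ge_self]\<close>)
qed

lemma kernel_integral_continuous:
  assumes J: "dominated_kernel J"
  shows "continuous_on ({0<..} \<times> UNIV) (\<lambda>(t, x). LINT y|lborel. g y * J t (y - x))"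
  unfolding continuous_on_sequentially
proof (intro allI ballI impI, elim conjE)
  fix u :: "nat \<Rightarrow> real \<times> real" and a :: "real \<times> real"
  assume a: "a \<in> {0<..} \<times> UNIV" and u: "\<forall>n. u n \<in> {0<..} \<times> UNIV" and lim: "u \<longlonglongrightarrow> a"
  obtain t0 x0 where a_eq: "a = (t0, x0)" and t0: "0 < t0" using a by auto
  note lim = lim[unfolded a_eq] and u = u[rule_format]
  have ft: "(\<lambda>n. fst (u n)) \<longlonglongrightarrow> t0" and fx: "(\<lambda>n. snd (u n)) \<longlonglongrightarrow> x0"
    using tendsto_fst[OF lim] tendsto_snd[OF lim] by auto
  have "eventually (\<lambda>n. fst (u n) \<in> {t0/2<..<2*t0}) sequentially"
    by (rule topological_tendstoD[OF ft]) (use t0 in auto)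
  moreover have "eventually (\<lambda>n. snd (u n) \<in> {x0-1<..<x0+1}) sequentially"
    by (rule topological_tendstoD[OF fx]) auto
  ultimately have "eventually (\<lambda>n. fst (u n) \<in> {t0/2..2*t0} \<and> \<bar>snd (u n) - x0\<bar> \<le> 1) sequentially"
    by eventually_elim auto
  then obtain N where N: "\<And>n. n \<ge> N \<Longrightarrow> fst (u n) \<in> {t0/2..2*t0} \<and> \<bar>snd (u n) - x0\<bar> \<le> 1"
    by (auto simp: eventually_sequentially)
  obtain w where w: "integrable lborel w" "\<And>t x y. t \<in> {t0/2..2*t0} \<Longrightarrow> \<bar>x - x0\<bar> \<le> 1 \<Longrightarrow> \<bar>g y * J t (y - x)\<bar> \<le> w y"
    using kernel_bound[OF J, of "t0/2" "2*t0" x0] t0 by auto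
  have "(\<lambda>n. LINT y|lborel. g y * J (fst (u (n + N))) (y - snd (u (n + N)))) \<longlonglongrightarrow> (LINT y|lborel. g y * J t0 (y - x0))"
  proof (rule integral_dominated_convergence[where w=w])
    note [measurable] = dominated_kernel_measurable[OF J t0, of x0]
    show "(\<lambda>y. g y * J t0 (y - x0)) \<in> borel_measurable lborel" by measurable
    show "(\<lambda>y. g y * J (fst (u (n + N))) (y - snd (u (n + N)))) \<in> borel_measurable lborel" for n
    proof -
      have "0 < fst (u (n + N))" using u[of "n + N"] by (auto simp: mem_Times_iff)
      note [measurable] = dominated_kernel_measurable[OF J this, of "snd (u (n + N))"]
      show ?thesis by measurable
    qed
    show "AE y in lborel. (\<lambda>n. g y * J (fst (u (n + N))) (y - snd (u (n + N)))) \<longlonglongrightarrow> g y * J t0 (y - x0)"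
    proof (rule AE_I2)
      fix y
      have c: "continuous_on ({0<..} \<times> UNIV) (\<lambda>(t, z). J t z)" using J by (simp add: dominated_kernel_def)
      have l: "(\<lambda>n. (fst (u (n + N)), y - snd (u (n + N)))) \<longlonglongrightarrow> (t0, y - x0)"
        by (intro tendsto_Pair tendsto_diff tendsto_const LIMSEQ_ignore_initial_segment ft fx)
      have "(\<lambda>n. (\<lambda>(t, z). J t z) (fst (u (n + N)), y - snd (u (n + N)))) \<longlonglongrightarrow> (\<lambda>(t, z). J t z) (t0, y - x0)"
        by (rule continuous_on_tendsto_compose[OF c l]) (use t0 u in \<open>auto simp: mem_Times_iff\<close>)
      then show "(\<lambda>n. g y * J (fst (u (n + N))) (y - snd (u (n + N)))) \<longlonglongrightarrow> g y * J t0 (y - x0)"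
        by (intro tendsto_mult tendsto_const) simp
    qed
    show "AE y in lborel. norm (g y * J (fst (u (n + N))) (y - snd (u (n + N)))) \<le> w y" for n
      using w(2) N[of "n + N"] by auto
  qed fact
  then have "(\<lambda>n. LINT y|lborel. g y * J (fst (u n)) (y - snd (u n))) \<longlonglongrightarrow> (LINT y|lborel. g y * J t0 (y - x0))"
    by (rule LIMSEQ_offset)
  then show "((\<lambda>(t, x). LINT y|lborel. g y * J t (y - x)) \<circ> u) \<longlonglongrightarrow> (case a of (t, x) \<Rightarrow> LINT y|lborel. g y * J t (y - x))"
    by (simp add: split_beta' comp_def a_eq)
qed

lemma kernel_integral_deriv_x:
  assumes J: "dominated_kernel J" "dominated_kernel J'" and t: "0 < t"
    and D: "\<And>z. (J t has_real_derivative J' t z) (at z)"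
  shows "((\<lambda>x. LINT y|lborel. g y * J t (y - x)) has_real_derivative - (LINT y|lborel. g y * J' t (y - x))) (at x)"
proof -
  obtain w where w: "integrable lborel w" "\<And>s x' y. s \<in> {t..t} \<Longrightarrow> \<bar>x' - x\<bar> \<le> 1 \<Longrightarrow> \<bar>g y * J' s (y - x')\<bar> \<le> w y"
    using kernel_bound[OF J(2) t order_refl] by blast
  have "((\<lambda>x. LINT y|lborel. g y * J t (y - x)) has_real_derivative (LINT y|lborel. - (g y * J' t (y - x)))) (at x)"
  proof (rule has_real_derivative_integral[where a="x - 1" and b="x + 1" and w=w])
    show "integrable lborel (\<lambda>y. g y * J t (y - s))" for s by (rule kernel_integrable[OF J(1) t])
    show "(\<lambda>y. - (g y * J' t (y - s))) \<in> borel_measurable lborel" for s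
      using borel_measurable_integrable[OF kernel_integrable[OF J(2) t, of s]] by measurable
    show "((\<lambda>s. g y * J t (y - s)) has_real_derivative - (g y * J' t (y - s))) (at s)" for s y
    proof -
      have "((\<lambda>s. J t (y - s)) has_real_derivative J' t (y - s) * (0 - 1)) (at s)"
        by (rule DERIV_chain2[OF D]) (intro DERIV_diff DERIV_const DERIV_ident)
      from DERIV_cmult[OF this, of "g y"] show ?thesis by simp
    qed
  qed (use w in auto)
  then show ?thesis by simp
qed

lemma kernel_integral_deriv_t:
  assumes J: "dominated_kernel J" "dominated_kernel J'" and t: "0 < t"
    and D: "\<And>s z. 0 < s \<Longrightarrow> ((\<lambda>s. J s z) has_real_derivative J' s z) (at s)"
  shows "((\<lambda>s. LINT y|lborel. g y * J s (y - x)) has_real_derivative (LINT y|lborel. g y * J' t (y - x))) (at t)"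
proof -
  obtain w where w: "integrable lborel w" "\<And>s x' y. s \<in> {t/2..2*t} \<Longrightarrow> \<bar>x' - x\<bar> \<le> 1 \<Longrightarrow> \<bar>g y * J' s (y - x')\<bar> \<le> w y"
    using kernel_bound[OF J(2), of "t/2" "2*t"] t by auto
  show ?thesis
  proof (rule has_real_derivative_integral[where a="t/2" and b="2*t" and w=w])
    show "integrable lborel (\<lambda>y. g y * J s (y - x))" if "s \<in> {t/2<..<2*t}" for s
      by (rule kernel_integrable[OF J(1)]) (use that t in auto)
    show "(\<lambda>y. g y * J' s (y - x)) \<in> borel_measurable lborel" if "s \<in> {t/2<..<2*t}" for s
      by (rule borel_measurable_integrable[OF kernel_integrable[OF J(2)]]) (use that t in auto)
    show "((\<lambda>s. g y * J s (y - x)) has_real_derivative g y * J' s (y - x)) (at s)" if "s \<in> {t/2<..<2*t}" for s y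
      by (rule DERIV_cmult[OF D]) (use that t in auto)
  qed (use w t in auto)
qed

end

section \<open>The Gaussian kernel and its derivatives\<close>

definition heat :: "real \<Rightarrow> real \<Rightarrow> real" where
  "heat t z = 1 / sqrt (2 * pi * t) * exp (- z\<^sup>2 / (2 * t))"

definition heat_z :: "real \<Rightarrow> real \<Rightarrow> real" where "heat_z t z = - (z / t) * heat t z"

definition heat_zz :: "real \<Rightarrow> real \<Rightarrow> real" where "heat_zz t z = (z\<^sup>2 / t\<^sup>2 - 1 / t) * heat t z"

lemma exp_ge_square: "0 \<le> u \<Longrightarrow> (1 + u / 2)\<^sup>2 \<le> exp (u::real)"
proof -
  assume "0 \<le> u"
  then have "(1 + u / 2)\<^sup>2 \<le> (exp (u / 2))\<^sup>2" using exp_ge_add_one_self[of "u / 2"] by (intro power_mono) auto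
  also have "\<dots> = exp u" by (simp flip: exp_double)
  finally show ?thesis .
qed

text \<open>One factor \<open>1 + z\<^sup>2\<close> pays for the quadratic polynomials in the
  derivatives of the kernel, the other is the decay required of a dominated kernel. The Gaussian
  therefore has to beat the square of \<open>1 + z\<^sup>2\<close>.\<close>

lemma poly_heat_bound:
  assumes "0 < lo" "lo \<le> hi"
  shows "\<exists>C\<ge>0. \<forall>t\<in>{lo..hi}. \<forall>z. (1 + z\<^sup>2) * heat t z \<le> C * (1 / (1 + z\<^sup>2))"
proof -
  \<comment> \<open>Chosen so that \<open>1 + z\<^sup>2 \<le> 2 * M * (1 + u / 2)\<close>; the
    square of the last factor is at most \<open>exp u\<close>.\<close>
  define M where "M = max 1 (2 * hi)"
  define C where "C = 1 / sqrt lo * (4 * M\<^sup>2)"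
  show ?thesis
  proof (intro exI[of _ C] conjI ballI allI)
    show "0 \<le> C" using assms by (simp add: C_def)
    fix t z :: real assume t: "t \<in> {lo..hi}"
    define u where "u = z\<^sup>2 / (2 * hi)"
    have u: "0 \<le> u" using assms by (simp add: u_def)
    have "1 + z\<^sup>2 = 1 + 2 * hi * u" using assms by (simp add: u_def)
    also have "\<dots> \<le> M + M * u" using u by (intro add_mono mult_right_mono) (auto simp: M_def)
    also have "\<dots> \<le> 2 * M * (1 + u / 2)" by (simp add: M_def algebra_simps)
    finally have "(1 + z\<^sup>2)\<^sup>2 \<le> (2 * M * (1 + u / 2))\<^sup>2" by (intro power_mono) auto
    also have "\<dots> = 4 * M\<^sup>2 * (1 + u / 2)\<^sup>2" by (simp add: power_mult_distrib)
    also have "\<dots> \<le> 4 * M\<^sup>2 * exp u" by (intro mult_left_mono exp_ge_square u) auto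
    finally have 1: "(1 + z\<^sup>2)\<^sup>2 * exp (-u) \<le> 4 * M\<^sup>2" by (simp add: exp_minus divide_simps)
    have "exp (- z\<^sup>2 / (2 * t)) \<le> exp (-u)"
      using t assms by (auto simp: u_def intro!: divide_left_mono)
    moreover have "1 / sqrt (2 * pi * t) \<le> 1 / sqrt lo"
    proof -
      have "1 * lo \<le> 2 * pi * t" using t assms pi_gt3 by (intro mult_mono) auto
      then show ?thesis using assms t by (intro divide_left_mono) auto
    qed
    ultimately have "heat t z \<le> 1 / sqrt lo * exp (-u)"
      unfolding heat_def using assms by (intro mult_mono) auto
    then have "(1 + z\<^sup>2)\<^sup>2 * heat t z \<le> (1 + z\<^sup>2)\<^sup>2 * (1 / sqrt lo * exp (-u))" by (intro mult_left_mono) auto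
    also have "\<dots> = 1 / sqrt lo * ((1 + z\<^sup>2)\<^sup>2 * exp (-u))" by simp
    also have "\<dots> \<le> C" unfolding C_def using assms by (intro mult_left_mono 1) auto
    finally show "(1 + z\<^sup>2) * heat t z \<le> C * (1 / (1 + z\<^sup>2))"
      using zero_le_power2[of z] by (simp add: pos_le_divide_eq add_pos_nonneg power2_eq_square[of "1 + z\<^sup>2"] mult_ac)
  qed
qed

lemma dominated_kernelI:
  assumes c: "continuous_on ({0<..} \<times> UNIV) (\<lambda>(t, z). p t z)"
    and b: "\<And>lo hi. 0 < lo \<Longrightarrow> lo \<le> hi \<Longrightarrow> \<exists>C\<ge>0. \<forall>t\<in>{lo..hi}. \<forall>z. \<bar>p t z\<bar> \<le> C * (1 + z\<^sup>2)"
  shows "dominated_kernel (\<lambda>t z. p t z * heat t z)"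
  unfolding dominated_kernel_def
proof (intro conjI allI impI)
  have "continuous_on ({0<..} \<times> UNIV) (\<lambda>x. (case x of (t, z) \<Rightarrow> p t z) * heat (fst x) (snd x))"
    unfolding heat_def by (intro continuous_on_mult c continuous_intros) auto
  then show "continuous_on ({0<..} \<times> UNIV) (\<lambda>(t, z). p t z * heat t z)" by (simp add: split_beta')
  fix lo hi :: real assume lh: "0 < lo" "lo \<le> hi"
  obtain C1 where C1: "C1 \<ge> 0" "\<forall>t\<in>{lo..hi}. \<forall>z. \<bar>p t z\<bar> \<le> C1 * (1 + z\<^sup>2)" using b[OF lh] by blast
  obtain C2 where C2: "C2 \<ge> 0" "\<forall>t\<in>{lo..hi}. \<forall>z. (1 + z\<^sup>2) * heat t z \<le> C2 * (1 / (1 + z\<^sup>2))" using poly_heat_bound[OF lh] by blast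
  show "\<exists>C\<ge>0. \<forall>t\<in>{lo..hi}. \<forall>z. \<bar>p t z * heat t z\<bar> \<le> C * (1 / (1 + z\<^sup>2))"
  proof (intro exI[of _ "C1 * C2"] conjI ballI allI)
    fix t z assume t: "t \<in> {lo..hi}"
    have "0 \<le> heat t z" using t lh by (simp add: heat_def)
    then have "\<bar>p t z * heat t z\<bar> \<le> C1 * (1 + z\<^sup>2) * heat t z"
      using C1 t by (simp add: abs_mult mult_right_mono)
    also have "\<dots> \<le> C1 * (C2 * (1 / (1 + z\<^sup>2)))" unfolding mult.assoc using C1 C2 t by (intro mult_left_mono) auto
    finally show "\<bar>p t z * heat t z\<bar> \<le> C1 * C2 * (1 / (1 + z\<^sup>2))" by simp
  qed (use C1 C2 in simp)
qed

lemma dominated_heat: "dominated_kernel heat"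
proof -
  have "dominated_kernel (\<lambda>t z. 1 * heat t z)"
    by (rule dominated_kernelI) (auto intro!: exI[of _ 1])
  then show ?thesis by simp
qed

lemma dominated_heat_z: "dominated_kernel heat_z"
  unfolding heat_z_def[abs_def]
proof (rule dominated_kernelI)
  show "continuous_on ({0<..} \<times> UNIV) (\<lambda>(t, z). - (z / t) :: real)"
    unfolding split_beta' by (intro continuous_intros) auto
  fix lo hi :: real assume lh: "0 < lo" "lo \<le> hi"
  show "\<exists>C\<ge>0. \<forall>t\<in>{lo..hi}. \<forall>z. \<bar>- (z / t)\<bar> \<le> C * (1 + z\<^sup>2)"
  proof (intro exI[of _ "1 / lo"] conjI ballI allI)
    fix t z :: real assume t: "t \<in> {lo..hi}"
    have "0 \<le> (\<bar>z\<bar> - 1)\<^sup>2" by simp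
    then have "\<bar>z\<bar> \<le> 1 + z\<^sup>2" using zero_le_power2[of z] by (simp add: power2_eq_square algebra_simps)
    then have "\<bar>z\<bar> / t \<le> (1 + z\<^sup>2) / lo" using t lh by (intro frac_le) auto
    then show "\<bar>- (z / t)\<bar> \<le> 1 / lo * (1 + z\<^sup>2)" using t lh by (simp add: abs_divide)
  qed (use lh in simp)
qed

lemma dominated_heat_zz: "dominated_kernel heat_zz"
  unfolding heat_zz_def[abs_def]
proof (rule dominated_kernelI)
  show "continuous_on ({0<..} \<times> UNIV) (\<lambda>(t, z). z\<^sup>2 / t\<^sup>2 - 1 / t :: real)"
    unfolding split_beta' by (intro continuous_intros) auto
  fix lo hi :: real assume lh: "0 < lo" "lo \<le> hi"
  show "\<exists>C\<ge>0. \<forall>t\<in>{lo..hi}. \<forall>z. \<bar>z\<^sup>2 / t\<^sup>2 - 1 / t\<bar> \<le> C * (1 + z\<^sup>2)"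
  proof (intro exI[of _ "1 / lo\<^sup>2 + 1 / lo"] conjI ballI allI)
    fix t z :: real assume t: "t \<in> {lo..hi}"
    have "z\<^sup>2 / t\<^sup>2 \<le> (1 + z\<^sup>2) / lo\<^sup>2" using t lh by (intro frac_le power_mono) auto
    moreover have "1 / t \<le> (1 + z\<^sup>2) / lo" using t lh by (intro frac_le) auto
    moreover have "0 \<le> z\<^sup>2 / t\<^sup>2" "0 \<le> 1 / t" using t lh by auto
    ultimately have "\<bar>z\<^sup>2 / t\<^sup>2 - 1 / t\<bar> \<le> (1 + z\<^sup>2) / lo\<^sup>2 + (1 + z\<^sup>2) / lo" by linarith
    then show "\<bar>z\<^sup>2 / t\<^sup>2 - 1 / t\<bar> \<le> (1 / lo\<^sup>2 + 1 / lo) * (1 + z\<^sup>2)" by (simp add: algebra_simps add_divide_distrib)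
  qed (use lh in simp)
qed

lemma heat_deriv_z:
  assumes "0 < t" shows "(heat t has_real_derivative heat_z t z) (at z)"
proof -
  have "((\<lambda>z. exp (- z\<^sup>2 / (2 * t))) has_real_derivative exp (- z\<^sup>2 / (2 * t)) * (- (z / t))) (at z)"
    using assms by (auto intro!: derivative_eq_intros simp: less_imp_neq[symmetric])
  from DERIV_cmult[OF this, of "1 / sqrt (2 * pi * t)"] show ?thesis
    by (simp add: heat_def[abs_def] heat_z_def mult_ac)
qed

lemma heat_deriv_zz: "0 < t \<Longrightarrow> (heat_z t has_real_derivative heat_zz t z) (at z)"
proof -
  assume t: "0 < t"
  have "((\<lambda>z. - (z / t) * heat t z) has_real_derivative (- (1 / t)) * heat t z + heat_z t z * (- (z / t))) (at z)"
    by (rule DERIV_mult) (use t in \<open>auto intro!: derivative_eq_intros heat_deriv_z\<close>)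
  moreover have "(- (1 / t)) * heat t z + heat_z t z * (- (z / t)) = heat_zz t z"
    using t by (simp add: heat_z_def heat_zz_def power2_eq_square algebra_simps)
  ultimately show ?thesis by (simp add: heat_z_def[abs_def])
qed

lemma heat_deriv_t: "0 < t \<Longrightarrow> ((\<lambda>t. heat t z) has_real_derivative heat_zz t z / 2) (at t)"
proof -
  assume t: "0 < t"
  have 1: "((\<lambda>t. exp (- z\<^sup>2 / (2 * t))) has_real_derivative exp (- z\<^sup>2 / (2 * t)) * (z\<^sup>2 / (2 * t\<^sup>2))) (at t)"
    using t by (auto intro!: derivative_eq_intros simp: power2_eq_square field_simps)
  have 2: "((\<lambda>t. 1 / sqrt (2 * pi * t)) has_real_derivative - (1 / sqrt (2 * pi * t)) * (1 / (2 * t))) (at t)"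
    using t by (auto intro!: derivative_eq_intros simp: field_simps power2_eq_square real_sqrt_mult)
  from DERIV_mult[OF 2 1] have "((\<lambda>t. heat t z) has_real_derivative
      - (1 / sqrt (2 * pi * t)) * (1 / (2 * t)) * exp (- z\<^sup>2 / (2 * t)) + exp (- z\<^sup>2 / (2 * t)) * (z\<^sup>2 / (2 * t\<^sup>2)) * (1 / sqrt (2 * pi * t))) (at t)"
    by (simp add: heat_def[abs_def])
  moreover have "- (1 / sqrt (2 * pi * t)) * (1 / (2 * t)) * exp (- z\<^sup>2 / (2 * t)) + exp (- z\<^sup>2 / (2 * t)) * (z\<^sup>2 / (2 * t\<^sup>2)) * (1 / sqrt (2 * pi * t)) = heat_zz t z / 2"
  proof -
    have "- A * (1 / (2 * t)) * E + E * (z\<^sup>2 / (2 * t\<^sup>2)) * A = (z\<^sup>2 / t\<^sup>2 - 1 / t) * (A * E) / 2" for A E :: real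
      using t by (simp add: field_simps)
    then show ?thesis by (simp only: heat_zz_def heat_def)
  qed
  ultimately show ?thesis by (rule DERIV_cong)
qed


lemma heat_eq_normal_density: "0 < t \<Longrightarrow> heat t z = normal_density 0 (sqrt t) z"
  by (simp add: heat_def normal_density_def)

lemma heat_integral:
  assumes "0 < t"
  shows "integrable lborel (\<lambda>y. heat t (y - x))" "(LINT y|lborel. heat t (y - x)) = 1"
proof -
  have eq: "heat t (y - x) = normal_density x (sqrt t) y" for y using assms by (simp add: heat_def normal_density_def)
  show "integrable lborel (\<lambda>y. heat t (y - x))" "(LINT y|lborel. heat t (y - x)) = 1"
    unfolding eq using assms by (simp_all add: integral_normal_density)
qed

text \<open>Since \<open>g\<close> is only square integrable, smallness of the kernel away from
  \<open>x0\<close> is not enough: it must come with integrable decay in y. Half the distance from y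
  to \<open>x0\<close> remains when x moves by at most \<open>r / 2\<close>, and the Gaussian
  converts it into both the factor t and the decay.\<close>

lemma heat_off_diagonal:
  assumes t: "0 < t" "t \<le> 1" and r: "0 < r" and y: "r \<le> \<bar>y - x0\<bar>" and x: "\<bar>x - x0\<bar> \<le> r / 2"
  shows "heat t (y - x) \<le> t * (256 * (1 / r\<^sup>2 + 1) / r\<^sup>2) * (1 / (1 + (y - x0)\<^sup>2))"
proof -
  define z where "z = y - x"
  define d where "d = \<bar>y - x0\<bar>"
  have dz: "d / 2 \<le> \<bar>z\<bar>" "0 < d"
    using y x r unfolding d_def z_def by (auto simp: abs_if split: if_splits)
  have z0: "0 < z\<^sup>2" using dz by auto
  define u where "u = z\<^sup>2 / (2 * t)"
  have u: "0 < u" using z0 t by (simp add: u_def)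
  have "u\<^sup>2 / 4 \<le> (1 + u / 2)\<^sup>2" using u by (simp add: power2_eq_square algebra_simps)
  also have "\<dots> \<le> exp u" using exp_ge_square u by simp
  finally have "exp (- u) \<le> 4 / u\<^sup>2" using u by (simp add: exp_minus field_simps)
  also have "\<dots> = 16 * t\<^sup>2 / (z\<^sup>2)\<^sup>2" using t z0 by (simp add: u_def power_divide power_mult_distrib field_simps)
  finally have 1: "exp (- z\<^sup>2 / (2 * t)) \<le> 16 * t\<^sup>2 / (z\<^sup>2)\<^sup>2" by (simp add: u_def)
  \<comment> \<open>This crude bound spends one of the two powers of t gained from the exponential;
    the other one remains in the conclusion.\<close>
  have 2: "1 / sqrt (2 * pi * t) \<le> 1 / t"
  proof -
    have "t\<^sup>2 \<le> t" using t by (simp add: power2_eq_square mult_left_le)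
    moreover have "1 * t \<le> 2 * pi * t" using t pi_gt3 by (intro mult_right_mono) auto
    ultimately have "t\<^sup>2 \<le> 2 * pi * t" by simp
    then have "t \<le> sqrt (2 * pi * t)" using t by (intro real_le_rsqrt) auto
    then show ?thesis using t by (intro divide_left_mono) auto
  qed
  have "heat t (y - x) \<le> 1 / t * (16 * t\<^sup>2 / (z\<^sup>2)\<^sup>2)"
    unfolding heat_def z_def[symmetric] using t by (intro mult_mono 1 2) auto
  also have "\<dots> = t * (16 / (z\<^sup>2)\<^sup>2)" using t by (simp add: power2_eq_square)
  \<comment> \<open>256 is 16 times 16, the second factor coming from the square of
    \<open>d\<^sup>2 / 4 \<le> z\<^sup>2\<close>. The inequality \<open>r \<le> d\<close> reduces
    the fourth power of \<open>1 / d\<close> to \<open>1 / (1 + d\<^sup>2)\<close>.\<close>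
  also have "\<dots> \<le> t * (256 * (1 / r\<^sup>2 + 1) / r\<^sup>2 * (1 / (1 + d\<^sup>2)))"
  proof (intro mult_left_mono)
    have "d\<^sup>2 / 4 \<le> z\<^sup>2" using power_mono[OF dz(1), of 2] dz(2) by (simp add: power_divide)
    then have z4: "(d\<^sup>2 / 4)\<^sup>2 \<le> (z\<^sup>2)\<^sup>2" by (intro power_mono) auto
    have rd: "r\<^sup>2 \<le> d\<^sup>2" using y r by (intro power_mono) (auto simp: d_def)
    have "1 + d\<^sup>2 \<le> d\<^sup>2 * (1 / r\<^sup>2 + 1)" using rd r by (simp add: field_simps)
    then have "r\<^sup>2 * (1 + d\<^sup>2) \<le> d\<^sup>2 * (d\<^sup>2 * (1 / r\<^sup>2 + 1))" using rd by (intro mult_mono) auto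
    then have "r\<^sup>2 * (1 + d\<^sup>2) \<le> 16 * (d\<^sup>2 / 4)\<^sup>2 * (1 / r\<^sup>2 + 1)" by (simp add: power2_eq_square)
    also have "\<dots> \<le> 16 * (z\<^sup>2)\<^sup>2 * (1 / r\<^sup>2 + 1)" using z4 by (intro mult_right_mono mult_left_mono) auto
    finally have key: "r\<^sup>2 * (1 + d\<^sup>2) \<le> 16 * (z\<^sup>2)\<^sup>2 * (1 / r\<^sup>2 + 1)" .
    have "0 < r\<^sup>2 * (1 + d\<^sup>2)" using r by (intro mult_pos_pos) (auto simp: add_pos_nonneg)
    moreover have "0 < (z\<^sup>2)\<^sup>2" using z0 by simp
    moreover have "16 / p \<le> 16 * (16 * k) / l" if "0 < l" "0 < p" "l \<le> 16 * p * k" for k l p :: real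
      using that by (simp add: field_simps)
    ultimately have "16 / (z\<^sup>2)\<^sup>2 \<le> 16 * (16 * (1 / r\<^sup>2 + 1)) / (r\<^sup>2 * (1 + d\<^sup>2))"
      using key by blast
    then show "16 / (z\<^sup>2)\<^sup>2 \<le> 256 * (1 / r\<^sup>2 + 1) / r\<^sup>2 * (1 / (1 + d\<^sup>2))" by simp
  qed (use t in simp)
  finally show ?thesis by (simp add: d_def)
qed

section \<open>Attainment of the initial value and the Cauchy problem\<close>

context L2_initial
begin

text \<open>Near \<open>x0\<close> continuity of \<open>g\<close> controls the integrand; elsewhere
  the kernel is of order t times an integrable weight. Letting x vary together with t gives joint
  continuity at the boundary, not just convergence at a fixed point.\<close>

lemma heat_approx_identity:
  assumes e: "0 < e"
  obtains d where "0 < d" "\<And>t x. 0 < t \<Longrightarrow> t < d \<Longrightarrow> \<bar>x - x0\<bar> < d \<Longrightarrow> \<bar>(LINT y|lborel. g y * heat t (y - x)) - g x0\<bar> < e"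
proof -
  obtain r where r: "0 < r" "\<And>y. \<bar>y - x0\<bar> < r \<Longrightarrow> \<bar>g y - g x0\<bar> < e / 2"
  proof -
    have "isCont g x0" using g_cont by (simp add: continuous_on_eq_continuous_at)
    then show ?thesis using e that unfolding continuous_at_eps_delta dist_real_def by (metis half_gt_zero)
  qed
  define Cr where "Cr = 256 * (1 / r\<^sup>2 + 1) / r\<^sup>2"
  have Cr: "0 \<le> Cr" by (simp add: Cr_def)
  define w where "w y = (\<bar>g y\<bar> + \<bar>g x0\<bar>) * (1 / (1 + (y - x0)\<^sup>2))" for y
  have w: "integrable lborel w" unfolding w_def distrib_right
    by (intro Bochner_Integration.integrable_add integrable_L2_inverse_1_plus g2 integrable_mult_right integrable_inverse_1_plus_shift) simp
  have w0: "0 \<le> w y" for y by (simp add: w_def)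
  define I where "I = (LINT y|lborel. w y)"
  have I0: "0 \<le> I" unfolding I_def by (simp add: w0)
  \<comment> \<open>\<open>r / 2\<close> and 1 meet the hypotheses of
    \<open>heat_off_diagonal\<close>; the last entry makes the contribution away from
    \<open>x0\<close> smaller than \<open>e / 2\<close>, the summand 1 preventing a division by
    zero.\<close>
  define d where "d = min (r / 2) (min 1 (e / (2 * (Cr * I + 1))))"
  have CI: "0 \<le> Cr * I" using Cr I0 by simp
  show ?thesis
  proof (rule that[of d])
    show "0 < d" using r e CI by (simp add: d_def)
    fix t x assume t: "0 < t" "t < d" and x: "\<bar>x - x0\<bar> < d"
    have pw: "\<bar>g y - g x0\<bar> * heat t (y - x) \<le> e / 2 * heat t (y - x) + t * Cr * w y" for y
    proof (cases "\<bar>y - x0\<bar> < r")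
      case True
      have "\<bar>g y - g x0\<bar> * heat t (y - x) \<le> e / 2 * heat t (y - x)"
        using r(2)[OF True] t by (intro mult_right_mono) (auto simp: heat_def)
      moreover have "0 \<le> t * Cr * w y" using t Cr w0 by simp
      ultimately show ?thesis by linarith
    next
      case False
      have "heat t (y - x) \<le> t * Cr * (1 / (1 + (y - x0)\<^sup>2))"
        unfolding Cr_def by (rule heat_off_diagonal) (use t x r False in \<open>auto simp: d_def\<close>)
      then have "\<bar>g y - g x0\<bar> * heat t (y - x) \<le> (\<bar>g y\<bar> + \<bar>g x0\<bar>) * (t * Cr * (1 / (1 + (y - x0)\<^sup>2)))"
        using t by (intro mult_mono) (auto simp: heat_def)
      also have "\<dots> = t * Cr * w y" by (simp add: w_def)
      finally have "\<bar>g y - g x0\<bar> * heat t (y - x) \<le> t * Cr * w y" .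
      moreover have "0 \<le> e / 2 * heat t (y - x)" using e t by (simp add: heat_def)
      ultimately show ?thesis by linarith
    qed
    have i1: "integrable lborel (\<lambda>y. g y * heat t (y - x))" by (rule kernel_integrable[OF dominated_heat t(1)])
    note i2 = heat_integral[OF t(1), of x]
    have i3: "integrable lborel (\<lambda>y. (g y - g x0) * heat t (y - x))" using i1 i2 by (simp add: left_diff_distrib)
    then have i4: "integrable lborel (\<lambda>y. \<bar>g y - g x0\<bar> * heat t (y - x))"
      using integrable_abs[OF i3] t by (simp add: abs_mult heat_def)
    have "(LINT y|lborel. g y * heat t (y - x)) - g x0 = (LINT y|lborel. (g y - g x0) * heat t (y - x))"
      using i1 i2 by (simp add: left_diff_distrib)
    then have "\<bar>(LINT y|lborel. g y * heat t (y - x)) - g x0\<bar> \<le> (LINT y|lborel. \<bar>(g y - g x0) * heat t (y - x)\<bar>)"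
      using integral_abs_bound by simp
    also have "\<dots> = (LINT y|lborel. \<bar>g y - g x0\<bar> * heat t (y - x))" using t by (simp add: abs_mult heat_def)
    also have "\<dots> \<le> (LINT y|lborel. e / 2 * heat t (y - x) + t * Cr * w y)"
      by (rule integral_mono[OF i4]) (use i2 w pw in auto)
    also have "\<dots> = e / 2 + t * (Cr * I)" using i2 w by (simp add: I_def)
    also have "\<dots> < e / 2 + e / 2"
    proof -
      have "t * (Cr * I) \<le> t * (Cr * I + 1)" using t by simp
      moreover have "t * (Cr * I + 1) < e / 2"
      proof -
        have "t < e / (2 * (Cr * I + 1))" using t by (simp add: d_def)
        then show ?thesis using CI by (simp add: field_simps)
      qed
      ultimately show ?thesis by linarith
    qed
    finally show "\<bar>(LINT y|lborel. g y * heat t (y - x)) - g x0\<bar> < e" by simp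
  qed
qed

text \<open>Time 0 has a hypothesis of its own because the kernel formula is valid only for positive
  times. The heat semigroup solves the equation without potential, and the factor
  \<open>exp (t * \<sigma>)\<close> adds the term with \<open>\<sigma>\<close> by the product
  rule.\<close>

lemma heat_semigroup_solves:
  assumes W0: "\<And>x. u 0 x = g x"
    and W: "\<And>t x. 0 < t \<Longrightarrow> u t x = (LINT y|lborel. g y * heat t (y - x)) * exp (t * \<sigma>)"
  shows "solves_parabolic_Cauchy \<sigma> g u"
proof -
  define w where "w t x = (LINT y|lborel. g y * heat t (y - x))" for t x
  define wx where "wx t x = - (LINT y|lborel. g y * heat_z t (y - x))" for t x
  define wxx where "wxx t x = (LINT y|lborel. g y * heat_zz t (y - x))" for t x
  have cw: "continuous_on ({0<..} \<times> UNIV) (\<lambda>(t, x). w t x)"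
    unfolding w_def by (rule kernel_integral_continuous[OF dominated_heat])
  have cwxx: "continuous_on ({0<..} \<times> UNIV) (\<lambda>(t, x). wxx t x)"
    unfolding wxx_def by (rule kernel_integral_continuous[OF dominated_heat_zz])
  have cwx: "continuous_on ({0<..} \<times> UNIV) (\<lambda>(t, x). wx t x)"
    using continuous_on_minus[OF kernel_integral_continuous[OF dominated_heat_z]]
    by (simp add: wx_def split_beta')
  have dwx: "((\<lambda>x. w t x) has_real_derivative wx t x) (at x)" if "0 < t" for t x
    unfolding w_def wx_def by (rule kernel_integral_deriv_x[OF dominated_heat dominated_heat_z that heat_deriv_z[OF that]])
  have dwxx: "((\<lambda>x. wx t x) has_real_derivative wxx t x) (at x)" if "0 < t" for t x
    unfolding wx_def wxx_def
    using DERIV_minus[OF kernel_integral_deriv_x[OF dominated_heat_z dominated_heat_zz that heat_deriv_zz[OF that]]] by simp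
  \<comment> \<open>The time derivative of \<open>heat\<close> is half of \<open>heat_zz\<close>,
    and differentiation in time asks for domination of exactly that kernel.\<close>
  have half: "dominated_kernel (\<lambda>t z. heat_zz t z / 2)"
    unfolding dominated_kernel_def
  proof (intro conjI allI impI)
    show "continuous_on ({0<..} \<times> UNIV) (\<lambda>(t, z). heat_zz t z / 2)"
      using dominated_heat_zz unfolding dominated_kernel_def split_beta'
      by (intro continuous_on_divide continuous_on_const) auto
    fix lo hi :: real assume "0 < lo" "lo \<le> hi"
    then obtain C where C: "C \<ge> 0" "\<forall>t\<in>{lo..hi}. \<forall>z. \<bar>heat_zz t z\<bar> \<le> C * (1 / (1 + z\<^sup>2))"
      using dominated_heat_zz unfolding dominated_kernel_def by blast
    have "\<bar>heat_zz t z / 2\<bar> \<le> C * (1 / (1 + z\<^sup>2))" if "t \<in> {lo..hi}" for t z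
    proof -
      have "\<bar>heat_zz t z / 2\<bar> \<le> \<bar>heat_zz t z\<bar>" by simp
      also have "\<dots> \<le> C * (1 / (1 + z\<^sup>2))" using C(2) that by blast
      finally show ?thesis .
    qed
    with C(1) show "\<exists>C\<ge>0. \<forall>t\<in>{lo..hi}. \<forall>z. \<bar>heat_zz t z / 2\<bar> \<le> C * (1 / (1 + z\<^sup>2))" by blast
  qed
  have dwt: "((\<lambda>s. w s x) has_real_derivative wxx t x / 2) (at t)" if "0 < t" for t x
    using kernel_integral_deriv_t[OF dominated_heat half that heat_deriv_t]
    by (simp add: w_def wxx_def)
  have ex: "continuous_on A (\<lambda>(t, x). exp (t * \<sigma>))" for A :: "(real \<times> real) set"
    unfolding split_beta' by (intro continuous_intros)
  have cmul: "continuous_on A (\<lambda>(t, x). f t x * exp (t * \<sigma>))" if "continuous_on A (\<lambda>(t, x). f t x)" for A and f :: "real \<Rightarrow> real \<Rightarrow> real"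
    using continuous_on_mult[OF that ex] by (simp add: split_beta')
  have u: "u t x = w t x * exp (t * \<sigma>)" if "0 < t" for t x using W[OF that] by (simp add: w_def)
  \<comment> \<open>Division by zero makes \<open>heat 0\<close> vanish identically, so
    \<open>w\<close> has the wrong value at time 0 and the initial value is glued in.\<close>
  define w0 where "w0 t x = (if t = 0 then g x else w t x)" for t x
  have u_eq: "u t x = w0 t x * exp (t * \<sigma>)" if "0 \<le> t" for t x
    using that u W0 by (cases "t = 0") (auto simp: w0_def)
  have cw0: "continuous_on ({0..} \<times> UNIV) (\<lambda>(t, x). w0 t x)"
    unfolding continuous_on_eq_continuous_within
  proof
    fix p :: "real \<times> real" assume p: "p \<in> {0..} \<times> UNIV"
    obtain t0 x0 where p_eq: "p = (t0, x0)" "0 \<le> t0" using p by auto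
    show "continuous (at p within {0..} \<times> UNIV) (\<lambda>(t, x). w0 t x)"
    proof (cases "t0 = 0")
      case False
      have op: "open ({0<..} \<times> UNIV :: (real \<times> real) set)" by (intro open_Times) auto
      have "continuous_on ({0<..} \<times> UNIV) (\<lambda>(t, x). w0 t x)"
        by (rule continuous_on_eq[OF cw]) (auto simp: w0_def)
      then have "isCont (\<lambda>(t, x). w0 t x) p"
        using op p_eq False by (simp add: continuous_on_eq_continuous_at)
      then show ?thesis by (rule continuous_at_imp_continuous_at_within)
    next
      case True
      show ?thesis unfolding continuous_within_eps_delta
      proof (intro allI impI)
        fix e :: real assume e: "0 < e"
        obtain d1 where d1: "0 < d1" "\<And>t x. 0 < t \<Longrightarrow> t < d1 \<Longrightarrow> \<bar>x - x0\<bar> < d1 \<Longrightarrow> \<bar>w t x - g x0\<bar> < e"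
          using heat_approx_identity[OF e, of x0] unfolding w_def by blast
        have "isCont g x0" using g_cont by (simp add: continuous_on_eq_continuous_at)
        then obtain d2 where d2: "0 < d2" "\<And>x. \<bar>x - x0\<bar> < d2 \<Longrightarrow> \<bar>g x - g x0\<bar> < e"
          using e unfolding continuous_at_eps_delta dist_real_def by metis
        show "\<exists>d>0. \<forall>p'\<in>{0..} \<times> UNIV. dist p' p < d \<longrightarrow> dist (case p' of (t, x) \<Rightarrow> w0 t x) (case p of (t, x) \<Rightarrow> w0 t x) < e"
        proof (intro exI[of _ "min d1 d2"] conjI ballI impI)
          fix p' assume p': "p' \<in> {0..} \<times> (UNIV :: real set)" "dist p' p < min d1 d2"
          obtain t x where tx: "p' = (t, x)" "0 \<le> t" using p'(1) by auto
          have "\<bar>t\<bar> < min d1 d2" "\<bar>x - x0\<bar> < min d1 d2"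
            using order_le_less_trans[OF dist_fst_le p'(2)] order_le_less_trans[OF dist_snd_le p'(2)]
            by (simp_all add: tx p_eq True dist_real_def)
          then show "dist (case p' of (t, x) \<Rightarrow> w0 t x) (case p of (t, x) \<Rightarrow> w0 t x) < e"
            using d1(2)[of t x] d2(2)[of x] tx by (auto simp: w0_def p_eq True dist_real_def)
        qed (use d1 d2 in auto)
      qed
    qed
  qed
  show ?thesis unfolding solves_parabolic_Cauchy_def
  proof (intro conjI)
    show "continuous_on ({0..} \<times> UNIV) (\<lambda>(t, x). u t x)"
      by (rule continuous_on_eq[OF cmul[OF cw0]]) (auto simp: u_eq)
    show "\<forall>x. u 0 x = g x" using W0 by simp
    show "\<exists>ut ux uxx. continuous_on ({0<..} \<times> UNIV) (\<lambda>(t, x). ut t x) \<and>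
        continuous_on ({0<..} \<times> UNIV) (\<lambda>(t, x). ux t x) \<and>
        continuous_on ({0<..} \<times> UNIV) (\<lambda>(t, x). uxx t x) \<and>
        (\<forall>t>0. \<forall>x.
           ((\<lambda>\<tau>. u \<tau> x) has_real_derivative ut t x) (at t) \<and>
           ((\<lambda>\<xi>. u t \<xi>) has_real_derivative ux t x) (at x) \<and>
           ((\<lambda>\<xi>. ux t \<xi>) has_real_derivative uxx t x) (at x) \<and>
           ut t x = 1 / 2 * uxx t x + \<sigma> * u t x)"
    proof (intro exI conjI allI impI)
      show "continuous_on ({0<..} \<times> UNIV) (\<lambda>(t, x). (wxx t x / 2 + \<sigma> * w t x) * exp (t * \<sigma>))"
        by (rule cmul) (use cwxx cw in \<open>auto simp: split_beta' intro!: continuous_intros\<close>)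
      show "continuous_on ({0<..} \<times> UNIV) (\<lambda>(t, x). wx t x * exp (t * \<sigma>))"
        "continuous_on ({0<..} \<times> UNIV) (\<lambda>(t, x). wxx t x * exp (t * \<sigma>))"
        by (rule cmul cwx cwxx)+
      fix t x :: real assume t: "0 < t"
      have ut: "u t = (\<lambda>x. w t x * exp (t * \<sigma>))" using u[OF t] by auto
      have "((\<lambda>\<tau>. w \<tau> x * exp (\<tau> * \<sigma>)) has_real_derivative wxx t x / 2 * exp (t * \<sigma>) + exp (t * \<sigma>) * \<sigma> * w t x) (at t)"
        by (rule DERIV_mult[OF dwt[OF t]]) (auto intro!: derivative_eq_intros)
      moreover have "wxx t x / 2 * exp (t * \<sigma>) + exp (t * \<sigma>) * \<sigma> * w t x = (wxx t x / 2 + \<sigma> * w t x) * exp (t * \<sigma>)"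
        by (simp add: algebra_simps)
      ultimately have "((\<lambda>\<tau>. w \<tau> x * exp (\<tau> * \<sigma>)) has_real_derivative (wxx t x / 2 + \<sigma> * w t x) * exp (t * \<sigma>)) (at t)"
        by simp
      then show "((\<lambda>\<tau>. u \<tau> x) has_real_derivative (wxx t x / 2 + \<sigma> * w t x) * exp (t * \<sigma>)) (at t)"
        by (rule has_field_derivative_transform_within_open[of _ _ _ "{0<..}"]) (use t u in auto)
      show "((\<lambda>\<xi>. u t \<xi>) has_real_derivative wx t x * exp (t * \<sigma>)) (at x)"
        unfolding ut by (rule DERIV_cmult_right[OF dwx[OF t]])
      show "((\<lambda>\<xi>. wx t \<xi> * exp (t * \<sigma>)) has_real_derivative wxx t x * exp (t * \<sigma>)) (at x)"
        by (rule DERIV_cmult_right[OF dwxx[OF t]])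
      show "(wxx t x / 2 + \<sigma> * w t x) * exp (t * \<sigma>) = 1 / 2 * (wxx t x * exp (t * \<sigma>)) + \<sigma> * u t x"
        unfolding u[OF t] by (simp add: algebra_simps)
    qed
  qed
qed

end

subsection \<open>The homogenization limit\<close>

context random_environment
begin

lemma expectation_eq_heat_integral:
  assumes [measurable]: "g \<in> borel_measurable borel" and t: "0 < t"
  shows "(LINT \<omega>|\<Omega>. g (x + B t \<omega>)) = (LINT y|lborel. g y * heat t (y - x))"
proof -
  have "(LINT \<omega>|\<Omega>. g (x + B t \<omega>)) = (LINT z|lborel. normal_density 0 (sqrt t) z * g (x + z))"
    using distributed_integral[OF BP_distributed[OF t], of "\<lambda>z. g (x + z)"] t by (simp add: BP_eq)
  also have "\<dots> = (LINT y|lborel. g y * heat t (y - x))"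
    using lborel_integral_real_affine[of 1 "\<lambda>y. g y * heat t (y - x)" x] t
    by (simp add: heat_eq_normal_density mult.commute)
  finally show ?thesis .
qed

end

theorem corollary5p8:
  fixes S :: "'s measure" and \<Omega> :: "'w measure"
    and B :: "real \<Rightarrow> 'w \<Rightarrow> real"
    and c :: "real \<Rightarrow> real \<Rightarrow> 's \<Rightarrow> real"
    and g :: "real \<Rightarrow> real"
  assumes "prob_space S" and "prob_space \<Omega>"
    and "standard_brownian_motion \<Omega> B"
    and "jointly_measurable_field S c"
    and "stationary_field S c"
    and "\<forall>t\<ge>0. \<forall>x. (LINT a|S. c t x a) = 0"
    and "\<exists>K. \<forall>t\<ge>0. \<forall>x. \<forall>a\<in>space S. \<bar>c t x a\<bar> \<le> K"
    and "integrable (lborel \<Otimes>\<^sub>M lborel) (\<lambda>(t, x). field_cov S c t x)"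
    and "\<exists>C>0. \<exists>\<delta>>0. \<forall>r\<ge>0. alpha_um S c r \<le> C * (1 + r) powr (-(2 + \<delta>))"
    and "continuous_on UNIV g" and "square_integrable lborel g"
  shows "set_integrable lborel {0..} (\<lambda>r. LINT \<omega>|\<Omega>. field_cov S c r (B r \<omega>)) \<and>
    (\<forall>t\<ge>0. \<forall>x. integrable \<Omega> (\<lambda>\<omega>. g (x + B t \<omega>))) \<and>
    (\<forall>t\<ge>0. \<forall>x. converges_in_L2 S (\<lambda>\<epsilon>. u_eps \<Omega> B c g \<epsilon> t x)
           (\<lambda>_. u_lim \<Omega> B g (Sigma_eff S \<Omega> B c) t x) (at_right 0)) \<and>
    solves_parabolic_Cauchy (Sigma_eff S \<Omega> B c) g (u_lim \<Omega> B g (Sigma_eff S \<Omega> B c))"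
proof -
  obtain K where K: "\<And>t x a. 0 \<le> t \<Longrightarrow> a \<in> space S \<Longrightarrow> \<bar>c t x a\<bar> \<le> K"
    using assms(7) by blast
  obtain C \<delta> where C: "0 < C" "0 < \<delta>" "\<And>r. 0 \<le> r \<Longrightarrow> alpha_um S c r \<le> C * (1 + r) powr (-(2 + \<delta>))"
    using assms(9) by blast
  interpret random_environment S c K C \<delta> \<Omega> B
    by (intro random_environment.intro decorrelating_field.intro mixing_field.intro brownian.intro
          mixing_field_axioms.intro decorrelating_field_axioms.intro brownian_axioms.intro)
       (use assms K C in auto)
  interpret L2_initial g
    using assms(10,11) by unfold_locales (auto simp: square_integrable_def)
  \<comment> \<open>Together with the next claim this shows that the integrals in
    \<open>Sigma_eff\<close> and \<open>u_lim\<close> converge, rather than taking the default value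
    0 of an integral that does not exist.\<close>
  have 1: "set_integrable lborel {0..} (\<lambda>r. LINT \<omega>|\<Omega>. field_cov S c r (B r \<omega>))"
    using mean_cov_integrable
    by (rule set_integrable_cong[THEN iffD1, rotated 3]) (auto simp: mean_cov_def BP_eq)
  have 2: "integrable \<Omega> (\<lambda>\<omega>. g (x + B t \<omega>))" if "0 \<le> t" for t x
    using g_path_square_integrable(2)[OF g_measurable g2 that, of x] that by (simp add: BP_eq)
  have 3: "converges_in_L2 S (\<lambda>\<epsilon>. u_eps \<Omega> B c g \<epsilon> t x)
      (\<lambda>_. u_lim \<Omega> B g (Sigma_eff S \<Omega> B c) t x) (at_right 0)" if "0 \<le> t" for t x
    unfolding Sigma_eff_eq by (rule u_eps_converges[OF g_measurable g2 that])
  have 4: "solves_parabolic_Cauchy (Sigma_eff S \<Omega> B c) g (u_lim \<Omega> B g (Sigma_eff S \<Omega> B c))"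
  proof (rule heat_semigroup_solves)
    fix x
    have "(LINT \<omega>|\<Omega>. g (x + B 0 \<omega>)) = (LINT \<omega>|\<Omega>. g x)"
      by (intro Bochner_Integration.integral_cong) (auto simp: B_0)
    then show "u_lim \<Omega> B g (Sigma_eff S \<Omega> B c) 0 x = g x"
      by (simp add: u_lim_def bm.prob_space)
  next
    fix t x :: real assume "0 < t"
    then show "u_lim \<Omega> B g (Sigma_eff S \<Omega> B c) t x
        = (LINT y|lborel. g y * heat t (y - x)) * exp (t * Sigma_eff S \<Omega> B c)"
      by (simp add: u_lim_def expectation_eq_heat_integral)
  qed
  show ?thesis using 1 2 3 4 by blast
qed

end
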